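(* Let $Y$ be a uniformly retract rational real affine variety and let $X$ be a compact real affine variety. Let $f,g:X\rightarrow Y$ be two homotopic regular mappings. Then there exists a regular mapping $F:X\times\mathbb{R}\rightarrow Y$ such that $F(x,0)=f(x)$ and $F(x,1)=g(x)$ for all $x\in X$.
   Context: A real affine variety is a space with a sheaf of real-valued functions isomorphic to a Zariski closed subset $X$ of some $\mathbb{R}^n$ with its sheaf of regular functions; a regular function on a Zariski open $U\subset X$ is a function of the form $P/Q$ with $P,Q$ polynomials and $Q$ nowhere zero on $U$. Varieties need not be irreducible. Zariski locally closed subsets of affine varieties are real affine varieties in this sense. Morphisms are called regular maps. Compactness and homotopy (through continuous maps) refer to the Euclidean topology. A real affine variety $V$ is globally retract rational if there exist, for some $n$, a Zariski open subset $W\subset\mathbb{R}^n$ and regular mappings $i:V\to W$, $r:W\to V$ with $r\circ i=\mathrm{id}_V$. A real affine variety $Y$ is uniformly retract rational if every point $y\in Y$ has a Zariski open neighbourhood $V$ in $Y$ which is globally retract rational. *)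

theory Defs
  imports "HOL-Analysis.Analysis" "HOL-Computational_Algebra.Polynomial"
begin

section \<open>Spaces with a sheaf of real-valued functions\<close>

text \<open>A section over an open set \<open>U\<close> is represented by a total function that is extensional on
  \<open>U\<close>, i.e. \<open>undefined\<close> outside \<open>U\<close>, so that equality of sections is equality of functions on \<open>U\<close>.\<close>

record 'a fspace =
  zariski :: "'a topology"
  sections :: "'a set \<Rightarrow> ('a \<Rightarrow> real) set"

abbreviation points :: "'a fspace \<Rightarrow> 'a set" where
  "points X \<equiv> topspace (zariski X)"

abbreviation preim :: "'a fspace \<Rightarrow> ('a \<Rightarrow> 'b) \<Rightarrow> 'b set \<Rightarrow> 'a set" where
  "preim X f V \<equiv> {x \<in> points X. f x \<in> V}"

definition regular_map :: "'a fspace \<Rightarrow> 'b fspace \<Rightarrow> ('a \<Rightarrow> 'b) \<Rightarrow> bool" where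
  "regular_map X Y f \<longleftrightarrow>
     continuous_map (zariski X) (zariski Y) f \<and>
     (\<forall>V s. openin (zariski Y) V \<longrightarrow> s \<in> sections Y V \<longrightarrow>
        restrict (s \<circ> f) (preim X f V) \<in> sections X (preim X f V))"

definition isomorphism :: "'a fspace \<Rightarrow> 'b fspace \<Rightarrow> ('a \<Rightarrow> 'b) \<Rightarrow> bool" where
  "isomorphism X Y h \<longleftrightarrow>
     homeomorphic_map (zariski X) (zariski Y) h \<and>
     (\<forall>V. openin (zariski Y) V \<longrightarrow>
        sections X (preim X h V) = (\<lambda>s. restrict (s \<circ> h) (preim X h V)) ` sections Y V)"

definition open_subspace :: "'a fspace \<Rightarrow> 'a set \<Rightarrow> 'a fspace" where
  "open_subspace X U = \<lparr>zariski = subtopology (zariski X) U, sections = sections X\<rparr>"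

section \<open>Real affine varieties\<close>

text \<open>The space on the set \<open>S\<close> determined by an algebra \<open>A\<close> of functions: the closed sets are the
  common zero sets in \<open>S\<close> of subsets of \<open>A\<close>, and the sections over \<open>U\<close> are the quotients \<open>P / Q\<close>
  with \<open>P, Q \<in> A\<close> and \<open>Q\<close> nowhere zero on \<open>U\<close>. Lemma \<open>openin_fspace_of\<close> below shows that this is a
  topology as soon as \<open>A\<close> contains \<open>1\<close> and is closed under multiplication on \<open>S\<close>.\<close>

definition fspace_of :: "'a set \<Rightarrow> ('a \<Rightarrow> real) set \<Rightarrow> 'a fspace" where
  "fspace_of S A =
     \<lparr>zariski = topology (\<lambda>U. U \<subseteq> S \<and> (\<exists>F\<subseteq>A. S - U = {x \<in> S. \<forall>P\<in>F. P x = 0})),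
      sections = (\<lambda>U. {restrict (\<lambda>x. P x / Q x) U | P Q. P \<in> A \<and> Q \<in> A \<and> (\<forall>x\<in>U. Q x \<noteq> 0)})\<rparr>"

text \<open>Polynomials in \<open>n\<close> variables, as functions. As in \<^const>\<open>Euclidean_space\<close>, the points of
  \<open>\<real>\<^sup>n\<close> are the sequences that vanish from index \<open>n\<close> on.\<close>

inductive_set polys :: "nat \<Rightarrow> ((nat \<Rightarrow> real) \<Rightarrow> real) set" for n where
  const: "(\<lambda>x. c) \<in> polys n"
| var: "i < n \<Longrightarrow> (\<lambda>x. x i) \<in> polys n"
| add: "P \<in> polys n \<Longrightarrow> Q \<in> polys n \<Longrightarrow> (\<lambda>x. P x + Q x) \<in> polys n"
| mult: "P \<in> polys n \<Longrightarrow> Q \<in> polys n \<Longrightarrow> (\<lambda>x. P x * Q x) \<in> polys n"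

definition affine_space :: "nat \<Rightarrow> (nat \<Rightarrow> real) fspace" where
  "affine_space n = fspace_of (topspace (Euclidean_space n)) (polys n)"

text \<open>Being isomorphic to \<open>Z\<close> with its sheaf of regular functions includes that the sections of
  \<open>X\<close> form a sheaf.\<close>

definition real_affine_variety :: "'a fspace \<Rightarrow> bool" where
  "real_affine_variety X \<longleftrightarrow>
     (\<exists>n Z h. closedin (zariski (affine_space n)) Z \<and> isomorphism X (fspace_of Z (polys n)) h)"

text \<open>The Euclidean topology, defined without choosing an embedding as the coarsest topology that
  makes all global regular functions continuous. Lemma \<open>euclidean_topology_eq\<close> below shows that
  it is the topology induced from \<open>\<real>\<^sup>n\<close> by any isomorphism with a subset of \<open>\<real>\<^sup>n\<close>.\<close>

definition euclidean_topology :: "'a fspace \<Rightarrow> 'a topology" where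
  "euclidean_topology X =
     topology_generated_by {{x \<in> points X. s x \<in> U} | s U. s \<in> sections X (points X) \<and> open U}"

text \<open>The product of affine varieties: its algebra of functions is generated by the global regular
  functions of the two factors. Lemma \<open>isomorphism_prod_real_line\<close> below shows that, for
  \<open>X\<close> isomorphic to \<open>Z \<subseteq> \<real>\<^sup>n\<close>, the product of \<open>X\<close> with the real line is isomorphic to
  \<open>Z \<times> \<real> \<subseteq> \<real>\<^sup>n\<^sup>+\<^sup>1\<close>; in particular it is again a real affine variety.\<close>

definition variety_prod :: "'a fspace \<Rightarrow> 'b fspace \<Rightarrow> ('a \<times> 'b) fspace" where
  "variety_prod X Y = fspace_of (points X \<times> points Y)
     {\<lambda>(x, y). \<Sum>k<m. s k x * t k y | (m::nat) s t.
        \<forall>k<m. s k \<in> sections X (points X) \<and> t k \<in> sections Y (points Y)}"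

definition real_line :: "real fspace" where
  "real_line = fspace_of UNIV (range poly)"

section \<open>Retract rationality\<close>

definition globally_retract_rational :: "'a fspace \<Rightarrow> bool" where
  "globally_retract_rational V \<longleftrightarrow>
     (\<exists>n W i r. openin (zariski (affine_space n)) W \<and>
        regular_map V (open_subspace (affine_space n) W) i \<and>
        regular_map (open_subspace (affine_space n) W) V r \<and>
        (\<forall>x\<in>points V. r (i x) = x))"

definition uniformly_retract_rational :: "'a fspace \<Rightarrow> bool" where
  "uniformly_retract_rational Y \<longleftrightarrow>
     (\<forall>y\<in>points Y. \<exists>V. openin (zariski Y) V \<and> y \<in> V \<and>
        globally_retract_rational (open_subspace Y V))"

section \<open>The definitions agree with their descriptions in coordinates\<close>

lemma openin_fspace_of_pointwise:
  assumes one: "\<exists>P\<in>A. \<forall>x\<in>S. P x = 1"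
    and mul: "\<forall>P\<in>A. \<forall>Q\<in>A. \<exists>R\<in>A. \<forall>x\<in>S. R x = P x * Q x"
  shows "openin (zariski (fspace_of S A)) U \<longleftrightarrow>
           U \<subseteq> S \<and> (\<exists>F\<subseteq>A. S - U = {x \<in> S. \<forall>P\<in>F. P x = 0})" (is ?thesis1)
    and "openin (zariski (fspace_of S A)) U \<longleftrightarrow>
           U \<subseteq> S \<and> (\<forall>x\<in>U. \<exists>P\<in>A. P x \<noteq> 0 \<and> (\<forall>y\<in>S-U. P y = 0))" (is ?thesis2)
proof -
  define op where "op = (\<lambda>U. U \<subseteq> S \<and> (\<exists>F\<subseteq>A. S - U = {x \<in> S. \<forall>P\<in>F. P x = 0}))"
  have op_iff: "op U \<longleftrightarrow> U \<subseteq> S \<and> (\<forall>x\<in>U. \<exists>P\<in>A. P x \<noteq> 0 \<and> (\<forall>y\<in>S-U. P y = 0))" for U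
  proof
    assume "op U"
    then obtain F where F: "U \<subseteq> S" "F \<subseteq> A" "S - U = {x \<in> S. \<forall>P\<in>F. P x = 0}"
      unfolding op_def by blast
    have "\<exists>P\<in>A. P x \<noteq> 0 \<and> (\<forall>y\<in>S-U. P y = 0)" if "x \<in> U" for x
    proof -
      have "x \<notin> S - U" "x \<in> S" using that F(1) by auto
      then obtain P where "P \<in> F" "P x \<noteq> 0" using F(3) by blast
      with F show ?thesis by blast
    qed
    with F(1) show "U \<subseteq> S \<and> (\<forall>x\<in>U. \<exists>P\<in>A. P x \<noteq> 0 \<and> (\<forall>y\<in>S-U. P y = 0))" by blast
  next
    assume R: "U \<subseteq> S \<and> (\<forall>x\<in>U. \<exists>P\<in>A. P x \<noteq> 0 \<and> (\<forall>y\<in>S-U. P y = 0))"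
    show "op U"
      unfolding op_def
    proof (intro conjI exI)
      show "{P\<in>A. \<forall>y\<in>S-U. P y = 0} \<subseteq> A" by blast
      show "S - U = {x \<in> S. \<forall>P\<in>{P\<in>A. \<forall>y\<in>S-U. P y = 0}. P x = 0}"
        using R by blast
    qed (use R in blast)
  qed
  have "istopology op"
    unfolding istopology_def
  proof (intro conjI allI impI)
    fix U V assume "op U" "op V"
    show "op (U \<inter> V)"
      unfolding op_iff
    proof (intro conjI ballI)
      show "U \<inter> V \<subseteq> S" using \<open>op U\<close> op_iff by blast
      fix x assume x: "x \<in> U \<inter> V"
      obtain P where P: "P \<in> A" "P x \<noteq> 0" "\<forall>y\<in>S-U. P y = 0"
        using \<open>op U\<close> x unfolding op_iff by blast
      obtain Q where Q: "Q \<in> A" "Q x \<noteq> 0" "\<forall>y\<in>S-V. Q y = 0"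
        using \<open>op V\<close> x unfolding op_iff by blast
      obtain R where R: "R \<in> A" "\<forall>x\<in>S. R x = P x * Q x" using mul P(1) Q(1) by blast
      have "R x \<noteq> 0" using R(2) P(2) Q(2) x \<open>U \<inter> V \<subseteq> S\<close> by auto
      moreover have "\<forall>y\<in>S-(U\<inter>V). R y = 0" using R(2) P(3) Q(3) by auto
      ultimately show "\<exists>P\<in>A. P x \<noteq> 0 \<and> (\<forall>y\<in>S-(U\<inter>V). P y = 0)" using R(1) by blast
    qed
  next
    fix K assume K: "\<forall>U\<in>K. op U"
    show "op (\<Union>K)"
      unfolding op_iff
    proof (intro conjI ballI)
      show "\<Union>K \<subseteq> S" using K op_iff by blast
      fix x assume "x \<in> \<Union>K"
      then obtain U where "U \<in> K" "x \<in> U" by blast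
      then obtain P where "P \<in> A" "P x \<noteq> 0" "\<forall>y\<in>S-U. P y = 0"
        using K unfolding op_iff by blast
      then show "\<exists>P\<in>A. P x \<noteq> 0 \<and> (\<forall>y\<in>S-\<Union>K. P y = 0)" using \<open>U \<in> K\<close> by blast
    qed
  qed
  moreover have "zariski (fspace_of S A) = topology op"
    by (simp add: fspace_of_def op_def)
  ultimately have eq: "openin (zariski (fspace_of S A)) U = op U"
    by simp
  show ?thesis1 unfolding eq op_def ..
  show ?thesis2 unfolding eq by (rule op_iff)
qed

lemmas openin_fspace_of = openin_fspace_of_pointwise(1)

lemma points_fspace_of:
  assumes one: "\<exists>P\<in>A. \<forall>x\<in>S. P x = 1"
    and mul: "\<forall>P\<in>A. \<forall>Q\<in>A. \<exists>R\<in>A. \<forall>x\<in>S. R x = P x * Q x"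
  shows "points (fspace_of S A) = S"
proof -
  note op = openin_fspace_of_pointwise(2)[OF one mul]
  obtain P where P: "P \<in> A" "\<forall>x\<in>S. P x = 1" using one by blast
  have "openin (zariski (fspace_of S A)) S"
    unfolding op using P by (intro conjI ballI bexI[where x = P]) auto
  then have "S \<subseteq> points (fspace_of S A)" by (rule openin_subset)
  moreover have "points (fspace_of S A) \<subseteq> S"
    using openin_topspace[of "zariski (fspace_of S A)"] unfolding op by (rule conjunct1)
  ultimately show ?thesis by (rule subset_antisym[rotated])
qed

lemma polys_one: "\<exists>P\<in>polys n. \<forall>x\<in>S. P x = 1"
  by (rule bexI[OF _ polys.const[of 1]]) simp

lemma polys_mult:
  "\<forall>P\<in>polys n. \<forall>Q\<in>polys n. \<exists>R\<in>polys n. \<forall>x\<in>S. R x = P x * Q x"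
proof (intro ballI)
  fix P Q assume "P \<in> polys n" "Q \<in> polys n"
  then show "\<exists>R\<in>polys n. \<forall>x\<in>S. R x = P x * Q x"
    by (intro bexI[where x = "\<lambda>x. P x * Q x"] polys.mult) simp_all
qed

lemmas openin_polys = openin_fspace_of[OF polys_one polys_mult]
lemmas points_polys = points_fspace_of[OF polys_one polys_mult]

lemma sections_fspace_of:
  "sections (fspace_of S A) U =
     {restrict (\<lambda>x. P x / Q x) U | P Q. P \<in> A \<and> Q \<in> A \<and> (\<forall>x\<in>U. Q x \<noteq> 0)}"
  by (simp add: fspace_of_def)

lemma isomorphism_onto_polys:
  assumes "isomorphism X (fspace_of Z (polys n)) h"
  shows "h ` points X = Z" "inj_on h (points X)"
    "sections X (points X) = {restrict (\<lambda>x. P (h x) / Q (h x)) (points X) | P Q.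
       P \<in> polys n \<and> Q \<in> polys n \<and> (\<forall>x\<in>points X. Q (h x) \<noteq> 0)}"
proof -
  have hom: "homeomorphic_map (zariski X) (zariski (fspace_of Z (polys n))) h"
    using assms by (simp add: isomorphism_def)
  show Z: "h ` points X = Z"
    using homeomorphic_imp_surjective_map[OF hom] by (simp add: points_polys)
  show "inj_on h (points X)"
    using homeomorphic_imp_injective_map[OF hom] .
  have "preim X h Z = points X" using Z by auto
  moreover have "openin (zariski (fspace_of Z (polys n))) Z"
    using openin_topspace[of "zariski (fspace_of Z (polys n))"] by (simp add: points_polys)
  moreover have "sections X (preim X h Z) =
      (\<lambda>s. restrict (s \<circ> h) (preim X h Z)) ` sections (fspace_of Z (polys n)) Z"
    if "openin (zariski (fspace_of Z (polys n))) Z"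
    using assms that unfolding isomorphism_def by blast
  ultimately have eq: "sections X (points X) =
      (\<lambda>s. restrict (s \<circ> h) (points X)) ` sections (fspace_of Z (polys n)) Z"
    by simp
  have re: "restrict (restrict (\<lambda>x. P x / Q x) Z \<circ> h) (points X)
      = restrict (\<lambda>x. P (h x) / Q (h x)) (points X)" for P Q
    using Z by (intro ext) (auto simp: restrict_def)
  show "sections X (points X) = {restrict (\<lambda>x. P (h x) / Q (h x)) (points X) | P Q.
       P \<in> polys n \<and> Q \<in> polys n \<and> (\<forall>x\<in>points X. Q (h x) \<noteq> 0)}"
    unfolding eq sections_fspace_of
  proof (intro set_eqI iffI)
    fix s assume "s \<in> (\<lambda>s. restrict (s \<circ> h) (points X)) ` {restrict (\<lambda>x. P x / Q x) Z | P Q.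
        P \<in> polys n \<and> Q \<in> polys n \<and> (\<forall>x\<in>Z. Q x \<noteq> 0)}"
    then obtain P Q where PQ: "s = restrict (restrict (\<lambda>x. P x / Q x) Z \<circ> h) (points X)"
      "P \<in> polys n" "Q \<in> polys n" "\<forall>x\<in>Z. Q x \<noteq> 0" by auto
    have "\<forall>x\<in>points X. Q (h x) \<noteq> 0" using PQ(4) Z by blast
    then show "s \<in> {restrict (\<lambda>x. P (h x) / Q (h x)) (points X) | P Q.
       P \<in> polys n \<and> Q \<in> polys n \<and> (\<forall>x\<in>points X. Q (h x) \<noteq> 0)}"
      using PQ(2,3) by (intro CollectI exI conjI) (simp_all only: PQ(1) re)
  next
    fix s assume "s \<in> {restrict (\<lambda>x. P (h x) / Q (h x)) (points X) | P Q.
       P \<in> polys n \<and> Q \<in> polys n \<and> (\<forall>x\<in>points X. Q (h x) \<noteq> 0)}"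
    then obtain P Q where PQ: "s = restrict (\<lambda>x. P (h x) / Q (h x)) (points X)"
      "P \<in> polys n" "Q \<in> polys n" "\<forall>x\<in>points X. Q (h x) \<noteq> 0" by blast
    have "\<forall>x\<in>Z. Q x \<noteq> 0" using PQ(4) Z by blast
    then have "restrict (\<lambda>x. P x / Q x) Z \<in> {restrict (\<lambda>x. P x / Q x) Z | P Q.
        P \<in> polys n \<and> Q \<in> polys n \<and> (\<forall>x\<in>Z. Q x \<noteq> 0)}" using PQ by blast
    then show "s \<in> (\<lambda>s. restrict (s \<circ> h) (points X)) ` {restrict (\<lambda>x. P x / Q x) Z | P Q.
        P \<in> polys n \<and> Q \<in> polys n \<and> (\<forall>x\<in>Z. Q x \<noteq> 0)}"
      by (rule image_eqI[rotated]) (simp only: PQ(1) re)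
  qed
qed

lemma continuous_map_polys:
  assumes "P \<in> polys n"
  shows "continuous_map (Euclidean_space m) euclideanreal P"
  using assms
proof induction
  case (var i)
  have "continuous_map (powertop_real UNIV) euclideanreal (\<lambda>x. x i)"
    by (rule continuous_map_product_projection) simp
  then show ?case
    unfolding Euclidean_space_def by (rule continuous_map_from_subtopology)
qed (auto intro: continuous_map_add continuous_map_real_mult)

lemma euclidean_topology_eq:
  assumes Z: "Z \<subseteq> topspace (Euclidean_space n)"
    and iso: "isomorphism X (fspace_of Z (polys n)) h"
  shows "euclidean_topology X = pullback_topology (points X) h (Euclidean_space n)"
proof -
  note sec = isomorphism_onto_polys[OF iso]
  let ?G = "{{x \<in> points X. s x \<in> U} | s U. s \<in> sections X (points X) \<and> open U}"
  let ?P = "pullback_topology (points X) h (Euclidean_space n)"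
  have tP: "topspace ?P = points X"
    using sec(1) Z by (auto simp: topspace_pullback_topology)
  have "openin ?P B" if B: "B \<in> ?G" for B
  proof -
    obtain s U where s: "s \<in> sections X (points X)" "open U" "B = {x \<in> points X. s x \<in> U}"
      using B by blast
    obtain P Q where PQ: "s = restrict (\<lambda>x. P (h x) / Q (h x)) (points X)"
      "P \<in> polys n" "Q \<in> polys n" "\<forall>x\<in>points X. Q (h x) \<noteq> 0"
      using s(1) unfolding sec(3) by blast
    have "continuous_map (subtopology (Euclidean_space n) Z) euclideanreal (\<lambda>x. P x / Q x)"
      using PQ sec(1)
      by (intro continuous_map_real_divide continuous_map_from_subtopology continuous_map_polys) auto
    then have "openin (subtopology (Euclidean_space n) Z)
        {x \<in> topspace (subtopology (Euclidean_space n) Z). P x / Q x \<in> U}"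
      using s(2) by (intro openin_continuous_map_preimage[where Y=euclideanreal]) auto
    then obtain T where T: "openin (Euclidean_space n) T"
      "{x \<in> topspace (subtopology (Euclidean_space n) Z). P x / Q x \<in> U} = T \<inter> Z"
      unfolding openin_subtopology by blast
    have "{x \<in> Z. P x / Q x \<in> U} = T \<inter> Z" using T(2) Z by auto
    then have "B = h -` T \<inter> points X"
      unfolding s(3) PQ(1) using sec(1) by auto
    then show ?thesis using T(1) by (auto simp: openin_pullback_topology)
  qed
  then have le: "openin ?P B" if "openin (euclidean_topology X) B" for B
    using that generate_topology_on_coarsest[of "openin ?P" ?G B]
    unfolding euclidean_topology_def openin_topology_generated_by_iff by simp
  have one: "restrict (\<lambda>x. 1) (points X) \<in> sections X (points X)"
    unfolding sec(3) by (rule CollectI, rule exI[of _ "\<lambda>x. 1"], rule exI[of _ "\<lambda>x. 1"])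
      (auto intro: polys.const)
  have tE: "topspace (euclidean_topology X) = points X"
  proof
    show "topspace (euclidean_topology X) \<subseteq> points X"
      unfolding euclidean_topology_def topology_generated_by_topspace by blast
    have "{x \<in> points X. restrict (\<lambda>x. 1) (points X) x \<in> (UNIV :: real set)} \<in> ?G"
      using one open_UNIV by (intro CollectI exI conjI) (rule refl)
    then have "{x \<in> points X. restrict (\<lambda>x. 1) (points X) x \<in> (UNIV :: real set)} \<subseteq> \<Union>?G"
      by (rule Union_upper)
    then show "points X \<subseteq> topspace (euclidean_topology X)"
      unfolding euclidean_topology_def topology_generated_by_topspace by simp
  qed
  have comp: "continuous_map (euclidean_topology X) euclideanreal (\<lambda>x. h x i)" for i
  proof (cases "i < n")
    case True
    have "restrict (\<lambda>x. h x i) (points X) \<in> sections X (points X)"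
      unfolding sec(3) by (rule CollectI, rule exI[of _ "\<lambda>x. x i"], rule exI[of _ "\<lambda>x. 1"])
        (auto intro: polys.const polys.var True)
    then have "openin (euclidean_topology X) {x \<in> points X. restrict (\<lambda>x. h x i) (points X) x \<in> U}"
      if "open U" for U
      unfolding euclidean_topology_def using that
      by (intro topology_generated_by_Basis CollectI exI conjI) (rule refl)
    moreover have "{x \<in> points X. restrict (\<lambda>x. h x i) (points X) x \<in> U} = {x \<in> points X. h x i \<in> U}"
      for U by auto
    ultimately show ?thesis by (simp add: continuous_map tE)
  next
    case False
    have h0: "h x i = 0" if "x \<in> topspace (euclidean_topology X)" for x
      using that False sec(1) Z unfolding tE topspace_Euclidean_space by fastforce
    show ?thesis by (rule continuous_map_eq[where f = "\<lambda>x. 0"]) (simp_all add: h0)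
  qed
  have "continuous_map (euclidean_topology X) (Euclidean_space n) h"
    unfolding Euclidean_space_def continuous_map_in_subtopology continuous_map_componentwise_UNIV tE
    using comp sec(1) Z by (auto simp: topspace_Euclidean_space)
  then have ge: "openin (euclidean_topology X) B" if B: "openin ?P B" for B
  proof -
    obtain T where T: "openin (Euclidean_space n) T" "B = h -` T \<inter> points X"
      using B by (auto simp: openin_pullback_topology)
    have "B = {x \<in> topspace (euclidean_topology X). h x \<in> T}" using T(2) tE by auto
    then show ?thesis
      using openin_continuous_map_preimage[OF \<open>continuous_map _ _ h\<close> T(1)] by simp
  qed
  show ?thesis unfolding topology_eq using le ge by blast
qed

lemma isomorphism_fspace_of:
  assumes A: "\<exists>P\<in>A. \<forall>x\<in>S. P x = 1" "\<forall>P\<in>A. \<forall>Q\<in>A. \<exists>R\<in>A. \<forall>x\<in>S. R x = P x * Q x"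
    and B: "\<exists>P\<in>B. \<forall>x\<in>T. P x = 1" "\<forall>P\<in>B. \<forall>Q\<in>B. \<exists>R\<in>B. \<forall>x\<in>T. R x = P x * Q x"
    and k: "bij_betw k S T"
    and BA: "\<And>b. b \<in> B \<Longrightarrow> \<exists>a\<in>A. \<forall>x\<in>S. a x = b (k x)"
    and AB: "\<And>a. a \<in> A \<Longrightarrow> \<exists>P\<in>B. \<exists>Q\<in>B. \<forall>x\<in>S. Q (k x) \<noteq> 0 \<and> a x = P (k x) / Q (k x)"
  shows "isomorphism (fspace_of S A) (fspace_of T B) k"
proof -
  note opA = openin_fspace_of_pointwise(2)[OF A]
  note opB = openin_fspace_of_pointwise(2)[OF B]
  note ptA = points_fspace_of[OF A]
  note ptB = points_fspace_of[OF B]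
  have kS: "k ` S = T" and inj: "inj_on k S" using k by (auto simp: bij_betw_def)
  have op: "openin (zariski (fspace_of S A)) U \<longleftrightarrow> openin (zariski (fspace_of T B)) (k ` U)"
    if U: "U \<subseteq> S" for U
  proof
    assume *: "openin (zariski (fspace_of S A)) U"
    show "openin (zariski (fspace_of T B)) (k ` U)"
      unfolding opB
    proof (intro conjI ballI)
      show "k ` U \<subseteq> T" using U kS by blast
      fix y assume "y \<in> k ` U"
      then obtain x where x: "x \<in> U" "y = k x" by blast
      then obtain a where a: "a \<in> A" "a x \<noteq> 0" "\<forall>z\<in>S-U. a z = 0" using * unfolding opA by blast
      obtain P Q where PQ: "P \<in> B" "\<forall>x\<in>S. Q (k x) \<noteq> 0 \<and> a x = P (k x) / Q (k x)"
        using AB[OF a(1)] by blast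
      have "P y \<noteq> 0" using PQ(2) x U a(2) by fastforce
      moreover have "P z = 0" if z: "z \<in> T - k ` U" for z
      proof -
        obtain w where "w \<in> S - U" "z = k w" using z kS by blast
        then show ?thesis using PQ(2) a(3) by force
      qed
      ultimately show "\<exists>P\<in>B. P y \<noteq> 0 \<and> (\<forall>z\<in>T - k ` U. P z = 0)" using PQ(1) by blast
    qed
  next
    assume *: "openin (zariski (fspace_of T B)) (k ` U)"
    show "openin (zariski (fspace_of S A)) U"
      unfolding opA
    proof (intro conjI ballI)
      fix x assume x: "x \<in> U"
      then obtain P where P: "P \<in> B" "P (k x) \<noteq> 0" "\<forall>z\<in>T - k ` U. P z = 0"
        using * unfolding opB by blast
      obtain a where a: "a \<in> A" "\<forall>x\<in>S. a x = P (k x)" using BA[OF P(1)] by blast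
      have "a z = 0" if z: "z \<in> S - U" for z
      proof -
        have "k z \<in> T - k ` U" using z kS inj U by (auto simp: inj_on_def)
        then show ?thesis using a(2) P(3) z by auto
      qed
      moreover have "a x \<noteq> 0" using a(2) P(2) x U by auto
      ultimately show "\<exists>P\<in>A. P x \<noteq> 0 \<and> (\<forall>y\<in>S - U. P y = 0)" using a(1) by blast
    qed (rule U)
  qed
  have "homeomorphic_map (zariski (fspace_of S A)) (zariski (fspace_of T B)) k"
  proof (rule bijective_open_imp_homeomorphic_map)
    show "continuous_map (zariski (fspace_of S A)) (zariski (fspace_of T B)) k"
      unfolding continuous_map_def ptA ptB
    proof (intro conjI allI impI)
      fix V assume V: "openin (zariski (fspace_of T B)) V"
      then have "V \<subseteq> T" unfolding opB by blast
      then have "k ` {x \<in> S. k x \<in> V} = V" using kS by blast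
      then show "openin (zariski (fspace_of S A)) {x \<in> S. k x \<in> V}"
        using op[of "{x \<in> S. k x \<in> V}"] V by auto
    qed (use kS in auto)
    show "open_map (zariski (fspace_of S A)) (zariski (fspace_of T B)) k"
      unfolding open_map_def
    proof (intro allI impI)
      fix U assume U: "openin (zariski (fspace_of S A)) U"
      then have "U \<subseteq> S" unfolding opA by blast
      then show "openin (zariski (fspace_of T B)) (k ` U)" using op U by blast
    qed
  qed (use kS inj in \<open>simp_all add: ptA ptB\<close>)
  moreover have "sections (fspace_of S A) (preim (fspace_of S A) k V) =
      (\<lambda>s. restrict (s \<circ> k) (preim (fspace_of S A) k V)) ` sections (fspace_of T B) V"
    if V: "openin (zariski (fspace_of T B)) V" for V
  proof -
    define U where "U = {x \<in> S. k x \<in> V}"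
    have "V \<subseteq> T" using V unfolding opB by blast
    then have kU: "k ` U = V" unfolding U_def using kS by blast
    have US: "U \<subseteq> S" unfolding U_def by blast
    have re: "restrict (restrict (\<lambda>x. P x / Q x) V \<circ> k) U = restrict (\<lambda>x. P (k x) / Q (k x)) U"
      for P Q :: "'b \<Rightarrow> real"
      unfolding U_def by (intro ext) (auto simp: restrict_def)
    have "sections (fspace_of S A) U = (\<lambda>s. restrict (s \<circ> k) U) ` sections (fspace_of T B) V"
    proof (intro subset_antisym subsetI)
      fix s assume "s \<in> sections (fspace_of S A) U"
      then obtain p q where s: "s = restrict (\<lambda>x. p x / q x) U" "p \<in> A" "q \<in> A" "\<forall>x\<in>U. q x \<noteq> 0"
        unfolding sections_fspace_of by blast
      obtain P1 Q1 where p: "P1 \<in> B" "Q1 \<in> B" "\<forall>x\<in>S. Q1 (k x) \<noteq> 0 \<and> p x = P1 (k x) / Q1 (k x)"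
        using AB[OF s(2)] by blast
      obtain P2 Q2 where q: "P2 \<in> B" "Q2 \<in> B" "\<forall>x\<in>S. Q2 (k x) \<noteq> 0 \<and> q x = P2 (k x) / Q2 (k x)"
        using AB[OF s(3)] by blast
      obtain P where P: "P \<in> B" "\<forall>x\<in>T. P x = P1 x * Q2 x" using B(2) p q by blast
      obtain Q where Q: "Q \<in> B" "\<forall>x\<in>T. Q x = Q1 x * P2 x" using B(2) p q by blast
      have nz: "Q (k x) \<noteq> 0 \<and> p x / q x = P (k x) / Q (k x)" if x: "x \<in> U" for x
      proof -
        have "x \<in> S" "k x \<in> T" using x US kS by auto
        moreover have "P2 (k x) \<noteq> 0" using s(4) x q(3) \<open>x \<in> S\<close> by force
        ultimately show ?thesis using p(3) q(3) P(2) Q(2) by simp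
      qed
      have "restrict (\<lambda>x. P x / Q x) V \<in> sections (fspace_of T B) V"
        unfolding sections_fspace_of using P(1) Q(1) nz kU by blast
      moreover have "s = restrict (restrict (\<lambda>x. P x / Q x) V \<circ> k) U"
        unfolding re s(1) using nz by (intro restrict_ext) blast
      ultimately show "s \<in> (\<lambda>s. restrict (s \<circ> k) U) ` sections (fspace_of T B) V" by blast
    next
      fix s assume "s \<in> (\<lambda>s. restrict (s \<circ> k) U) ` sections (fspace_of T B) V"
      then obtain P Q where s: "s = restrict (restrict (\<lambda>x. P x / Q x) V \<circ> k) U"
        "P \<in> B" "Q \<in> B" "\<forall>x\<in>V. Q x \<noteq> 0"
        unfolding sections_fspace_of by auto
      obtain p where p: "p \<in> A" "\<forall>x\<in>S. p x = P (k x)" using BA[OF s(2)] by blast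
      obtain q where q: "q \<in> A" "\<forall>x\<in>S. q x = Q (k x)" using BA[OF s(3)] by blast
      have "s = restrict (\<lambda>x. p x / q x) U"
        unfolding s(1) re using p(2) q(2) US by (intro restrict_ext) auto
      moreover have "\<forall>x\<in>U. q x \<noteq> 0" using s(4) kU q(2) US by fastforce
      ultimately show "s \<in> sections (fspace_of S A) U"
        unfolding sections_fspace_of using p(1) q(1) by blast
    qed
    then show ?thesis unfolding ptA U_def .
  qed
  ultimately show ?thesis unfolding isomorphism_def by blast
qed

lemma real_line_one: "\<exists>P\<in>range poly. \<forall>x\<in>S. P x = (1::real)"
  by (rule bexI[where x = "poly 1"]) auto

lemma real_line_mult:
  "\<forall>P\<in>range poly. \<forall>Q\<in>range poly. \<exists>R\<in>range poly. \<forall>x\<in>S. R x = P x * (Q x :: real)"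
proof (intro ballI)
  fix P Q :: "real \<Rightarrow> real" assume "P \<in> range poly" "Q \<in> range poly"
  then obtain p q where "P = poly p" "Q = poly q" by blast
  then show "\<exists>R\<in>range poly. \<forall>x\<in>S. R x = P x * Q x"
    by (intro bexI[where x = "poly (p * q)"]) auto
qed

lemma points_real_line: "points real_line = UNIV"
  unfolding real_line_def by (rule points_fspace_of[OF real_line_one real_line_mult])

lemma polys_update:
  assumes "P \<in> polys n"
  shows "P (x(n := t)) = P x" "P \<in> polys (Suc n)"
  using assms by (induction) (auto intro: polys.intros)

lemma poly_in_polys: "(\<lambda>z. poly p (z n)) \<in> polys (Suc n)"
proof (induction p)
  case (pCons a p)
  have "(\<lambda>z. a + z n * poly p (z n)) \<in> polys (Suc n)"
    by (intro polys.add polys.mult polys.const polys.var pCons.IH) simp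
  then show ?case by simp
qed (simp add: polys.const)

lemma isomorphism_prod_real_line:
  assumes Z: "Z \<subseteq> topspace (Euclidean_space n)"
    and iso: "isomorphism X (fspace_of Z (polys n)) h"
  shows "isomorphism (variety_prod X real_line)
           (fspace_of {z(n := t) | z t. z \<in> Z} (polys (Suc n))) (\<lambda>(x, t). (h x)(n := t))"
proof -
  define OX where "OX = sections X (points X)"
  define OR where "OR = sections real_line (points real_line)"
  define A where "A = {\<lambda>(x, y). \<Sum>k<m. s k x * t k y | (m::nat) s t. \<forall>k<m. s k \<in> OX \<and> t k \<in> OR}"
  define S where "S = points X \<times> (UNIV :: real set)"
  let ?k = "\<lambda>(x, t). (h x)(n := t)"
  note iX = isomorphism_onto_polys[OF iso, folded OX_def]
  have OR: "OR = {restrict (\<lambda>x. P x / Q x) UNIV | P Q. P \<in> range poly \<and> Q \<in> range poly \<and> (\<forall>x\<in>UNIV. Q x \<noteq> 0)}"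
    unfolding OR_def points_real_line by (simp add: real_line_def sections_fspace_of)
  have OXI: "\<exists>s\<in>OX. \<forall>x\<in>points X. s x = P (h x)" if P: "P \<in> polys n" for P
  proof (rule bexI)
    show "restrict (\<lambda>x. P (h x) / (\<lambda>x. 1) (h x)) (points X) \<in> OX"
      unfolding iX(3) using P polys.const[of 1 n]
      by (intro CollectI exI[of _ P] exI[of _ "\<lambda>x. 1"]) auto
  qed simp
  have ORI: "\<exists>s\<in>OR. \<forall>t. s t = poly p t" for p
  proof (rule bexI)
    show "restrict (\<lambda>x. poly p x / poly 1 x) UNIV \<in> OR"
      unfolding OR by (intro CollectI exI[of _ "poly p"] exI[of _ "poly 1"]) auto
  qed simp
  have OXm: "\<exists>r\<in>OX. \<forall>x\<in>points X. r x = s x * s' x" if s: "s \<in> OX" "s' \<in> OX" for s s'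
  proof -
    obtain P Q where 1: "s = restrict (\<lambda>x. P (h x) / Q (h x)) (points X)"
      "P \<in> polys n" "Q \<in> polys n" "\<forall>x\<in>points X. Q (h x) \<noteq> 0" using s(1) unfolding iX(3) by blast
    obtain P' Q' where 2: "s' = restrict (\<lambda>x. P' (h x) / Q' (h x)) (points X)"
      "P' \<in> polys n" "Q' \<in> polys n" "\<forall>x\<in>points X. Q' (h x) \<noteq> 0" using s(2) unfolding iX(3) by blast
    show ?thesis
    proof (rule bexI)
      show "restrict (\<lambda>x. (\<lambda>z. P z * P' z) (h x) / (\<lambda>z. Q z * Q' z) (h x)) (points X) \<in> OX"
        unfolding iX(3) using 1 2 polys.mult
        by (intro CollectI exI[of _ "\<lambda>z. P z * P' z"] exI[of _ "\<lambda>z. Q z * Q' z"]) auto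
    qed (simp add: 1(1) 2(1))
  qed
  have ORm: "\<exists>r\<in>OR. \<forall>x. r x = s x * s' x" if s: "s \<in> OR" "s' \<in> OR" for s s'
  proof -
    obtain P Q where 1: "s = restrict (\<lambda>x. poly P x / poly Q x) UNIV"
      "\<forall>x. poly Q x \<noteq> 0" using s(1) unfolding OR by auto
    obtain P' Q' where 2: "s' = restrict (\<lambda>x. poly P' x / poly Q' x) UNIV"
      "\<forall>x. poly Q' x \<noteq> 0" using s(2) unfolding OR by auto
    show ?thesis
    proof (rule bexI)
      show "restrict (\<lambda>x. poly (P * P') x / poly (Q * Q') x) UNIV \<in> OR"
        unfolding OR using 1 2
        by (intro CollectI exI[of _ "poly (P * P')"] exI[of _ "poly (Q * Q')"]) auto
    qed (simp add: 1(1) 2(1))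
  qed
  have A_sum: "\<exists>a\<in>A. \<forall>x\<in>points X. \<forall>y. a (x, y) = (\<Sum>k\<in>K. s k x * t k y)"
    if K: "finite K" "\<And>k. k \<in> K \<Longrightarrow> s k \<in> OX \<and> t k \<in> OR" for K :: "(nat \<times> nat) set" and s t
  proof -
    obtain e where e: "bij_betw e {..<card K} K"
      using ex_bij_betw_nat_finite[OF K(1)] by (auto simp: atLeast0LessThan)
    let ?a = "\<lambda>(x, y). \<Sum>k<card K. s (e k) x * t (e k) y"
    have "\<forall>k<card K. s (e k) \<in> OX \<and> t (e k) \<in> OR"
      using K(2) bij_betwE[OF e] by blast
    then have "?a \<in> A" unfolding A_def by (intro CollectI exI[of _ "card K"] exI[of _ "\<lambda>k. s (e k)"] exI[of _ "\<lambda>k. t (e k)"]) auto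
    moreover have "?a (x, y) = (\<Sum>k\<in>K. s k x * t k y)" for x y
      using sum.reindex_bij_betw[OF e, of "\<lambda>k. s k x * t k y"] by simp
    ultimately show ?thesis by blast
  qed
  have A_tensor: "\<exists>a\<in>A. \<forall>x\<in>points X. \<forall>y. a (x, y) = s x * t y" if s: "s \<in> OX" "t \<in> OR" for s t
    using A_sum[of "{(0,0)}" "\<lambda>_. s" "\<lambda>_. t"] s by simp
  have A_add: "\<exists>c\<in>A. \<forall>x\<in>points X. \<forall>y. c (x, y) = a (x, y) + b (x, y)" if ab: "a \<in> A" "b \<in> A" for a b
  proof -
    obtain m s t where a: "a = (\<lambda>(x, y). \<Sum>k<(m::nat). s k x * t k y)" "\<forall>k<m. s k \<in> OX \<and> t k \<in> OR"
      using ab(1) unfolding A_def by blast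
    obtain m' s' t' where b: "b = (\<lambda>(x, y). \<Sum>k<(m'::nat). s' k x * t' k y)" "\<forall>k<m'. s' k \<in> OX \<and> t' k \<in> OR"
      using ab(2) unfolding A_def by blast
    let ?s = "\<lambda>(i::nat, k). if i = 0 then s k else s' k"
    let ?t = "\<lambda>(i::nat, k). if i = 0 then t k else t' k"
    let ?K = "(Pair 0 ` {..<m}) \<union> (Pair 1 ` {..<m'}) :: (nat \<times> nat) set"
    have "\<exists>c\<in>A. \<forall>x\<in>points X. \<forall>y. c (x, y) = (\<Sum>k\<in>?K. ?s k x * ?t k y)"
      using a(2) b(2) by (intro A_sum) auto
    moreover have "(\<Sum>k\<in>?K. ?s k x * ?t k y) = a (x, y) + b (x, y)" for x y
      by (subst sum.union_disjoint) (auto simp: a(1) b(1) sum.reindex inj_on_def)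
    ultimately show ?thesis by simp
  qed
  have A_mul: "\<exists>c\<in>A. \<forall>x\<in>points X. \<forall>y. c (x, y) = a (x, y) * b (x, y)" if ab: "a \<in> A" "b \<in> A" for a b
  proof -
    obtain m s t where a: "a = (\<lambda>(x, y). \<Sum>k<(m::nat). s k x * t k y)" "\<forall>k<m. s k \<in> OX \<and> t k \<in> OR"
      using ab(1) unfolding A_def by blast
    obtain m' s' t' where b: "b = (\<lambda>(x, y). \<Sum>k<(m'::nat). s' k x * t' k y)" "\<forall>k<m'. s' k \<in> OX \<and> t' k \<in> OR"
      using ab(2) unfolding A_def by blast
    have "\<forall>i\<in>{..<m} \<times> {..<m'}. \<exists>r\<in>OX. \<forall>x\<in>points X. r x = s (fst i) x * s' (snd i) x"
      using OXm a(2) b(2) by auto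
    then obtain u where u: "\<forall>i\<in>{..<m} \<times> {..<m'}. u i \<in> OX \<and> (\<forall>x\<in>points X. u i x = s (fst i) x * s' (snd i) x)"
      by metis
    have "\<forall>i\<in>{..<m} \<times> {..<m'}. \<exists>r\<in>OR. \<forall>x. r x = t (fst i) x * t' (snd i) x"
      using ORm a(2) b(2) by auto
    then obtain v where v: "\<forall>i\<in>{..<m} \<times> {..<m'}. v i \<in> OR \<and> (\<forall>x. v i x = t (fst i) x * t' (snd i) x)"
      by metis
    have "\<exists>c\<in>A. \<forall>x\<in>points X. \<forall>y. c (x, y) = (\<Sum>k\<in>{..<m} \<times> {..<m'}. u k x * v k y)"
      using u v by (intro A_sum) auto
    moreover have "(\<Sum>k\<in>{..<m} \<times> {..<m'}. u k x * v k y) = a (x, y) * b (x, y)" if x: "x \<in> points X" for x y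
    proof -
      have "(\<Sum>k\<in>{..<m} \<times> {..<m'}. u k x * v k y)
          = (\<Sum>(i,j)\<in>{..<m} \<times> {..<m'}. (s i x * t i y) * (s' j x * t' j y))"
        using u v x by (intro sum.cong refl) (auto simp: mult_ac)
      also have "\<dots> = a (x, y) * b (x, y)"
        by (simp add: a(1) b(1) sum_product sum.cartesian_product)
      finally show ?thesis .
    qed
    ultimately show ?thesis by simp
  qed
  have P1: "\<exists>P\<in>A. \<forall>x\<in>S. P x = 1"
  proof -
    obtain s where s: "s \<in> OX" "\<forall>x\<in>points X. s x = 1" using OXI[OF polys.const[of 1]] by auto
    obtain t where t: "t \<in> OR" "\<forall>x. t x = 1" using ORI[of 1] by auto
    show ?thesis using A_tensor[OF s(1) t(1)] s t unfolding S_def by auto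
  qed
  have P2: "\<forall>P\<in>A. \<forall>Q\<in>A. \<exists>R\<in>A. \<forall>x\<in>S. R x = P x * Q x"
  proof (intro ballI)
    fix a b assume "a \<in> A" "b \<in> A"
    from A_mul[OF this] show "\<exists>R\<in>A. \<forall>x\<in>S. R x = a x * b x" unfolding S_def by auto
  qed
  have hz: "h x \<in> Z" if "x \<in> points X" for x using iX(1) that by blast
  have z0: "z n = 0" if "z \<in> Z" for z using Z that by (auto simp: topspace_Euclidean_space)
  have "isomorphism (fspace_of S A) (fspace_of {z(n := t) | z t. z \<in> Z} (polys (Suc n))) ?k"
  proof (rule isomorphism_fspace_of[OF P1 P2 polys_one polys_mult])
    show "bij_betw ?k S {z(n := t) | z t. z \<in> Z}"
      unfolding bij_betw_def
    proof (intro conjI)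
      show "inj_on ?k S"
      proof (rule inj_onI)
        fix p q assume pq: "p \<in> S" "q \<in> S" "?k p = ?k q"
        obtain x t y u where e: "p = (x, t)" "q = (y, u)" by fastforce
        have eq: "(h x)(n := t) = (h y)(n := u)" using pq(3) e by simp
        have xy: "x \<in> points X" "y \<in> points X" using pq e by (auto simp: S_def)
        have "t = u" using fun_cong[OF eq, of n] by simp
        moreover have "h x i = h y i" for i
          using fun_cong[OF eq, of i] z0[OF hz[OF xy(1)]] z0[OF hz[OF xy(2)]] by (cases "i = n") auto
        then have "h x = h y" by blast
        then have "x = y" using iX(2) xy by (auto simp: inj_on_def)
        ultimately show "p = q" using e by simp
      qed
      show "?k ` S = {z(n := t) | z t. z \<in> Z}"
        using iX(1) unfolding S_def by (auto simp: image_iff) 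
    qed
  next
    fix b assume "b \<in> polys (Suc n)"
    then have "\<exists>a\<in>A. \<forall>x\<in>points X. \<forall>t. a (x, t) = b ((h x)(n := t))"
    proof induction
      case (const c)
      obtain s where s: "s \<in> OX" "\<forall>x\<in>points X. s x = c" using OXI[OF polys.const[of c]] by auto
      obtain t where t: "t \<in> OR" "\<forall>x. t x = 1" using ORI[of 1] by auto
      show ?case using A_tensor[OF s(1) t(1)] s t by auto
    next
      case (var i)
      show ?case
      proof (cases "i = n")
        case True
        obtain s where s: "s \<in> OX" "\<forall>x\<in>points X. s x = 1" using OXI[OF polys.const[of 1]] by auto
        obtain t where t: "t \<in> OR" "\<forall>x. t x = x" using ORI[of "[:0,1:]"] by auto
        show ?thesis using A_tensor[OF s(1) t(1)] s t True by auto
      next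
        case False
        then have "i < n" using var by simp
        obtain s where s: "s \<in> OX" "\<forall>x\<in>points X. s x = h x i" using OXI[OF polys.var[OF \<open>i < n\<close>]] by auto
        obtain t where t: "t \<in> OR" "\<forall>x. t x = 1" using ORI[of 1] by auto
        show ?thesis using A_tensor[OF s(1) t(1)] s t False by auto
      qed
    next
      case (add P Q)
      then obtain a b where ab: "a \<in> A" "b \<in> A"
        "\<forall>x\<in>points X. \<forall>t. a (x, t) = P ((h x)(n := t))"
        "\<forall>x\<in>points X. \<forall>t. b (x, t) = Q ((h x)(n := t))" by blast
      from A_add[OF ab(1,2)] ab(3,4) show ?case by (simp del: fun_upd_apply)
    next
      case (mult P Q)
      then obtain a b where ab: "a \<in> A" "b \<in> A"
        "\<forall>x\<in>points X. \<forall>t. a (x, t) = P ((h x)(n := t))"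
        "\<forall>x\<in>points X. \<forall>t. b (x, t) = Q ((h x)(n := t))" by blast
      from A_mul[OF ab(1,2)] ab(3,4) show ?case by (simp del: fun_upd_apply)
    qed
    then show "\<exists>a\<in>A. \<forall>x\<in>S. a x = b (?k x)" unfolding S_def by auto
  next
    fix a assume "a \<in> A"
    then obtain m s t where a: "a = (\<lambda>(x, y). \<Sum>k<(m::nat). s k x * t k y)"
      and st: "\<And>k. k < m \<Longrightarrow> s k \<in> OX \<and> t k \<in> OR"
      unfolding A_def by blast
    have "\<exists>P\<in>polys (Suc n). \<exists>Q\<in>polys (Suc n). \<forall>x\<in>points X. \<forall>y. Q ((h x)(n := y)) \<noteq> 0 \<and>
        (\<Sum>k<m. s k x * t k y) = P ((h x)(n := y)) / Q ((h x)(n := y))"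
      using st
    proof (induction m)
      case 0
      show ?case
        by (intro bexI[where x = "\<lambda>z. 0"] bexI[where x = "\<lambda>z. 1"] polys.const) auto
    next
      case (Suc m)
      then obtain P Q where PQ: "P \<in> polys (Suc n)" "Q \<in> polys (Suc n)"
        "\<forall>x\<in>points X. \<forall>y. Q ((h x)(n := y)) \<noteq> 0 \<and>
          (\<Sum>k<m. s k x * t k y) = P ((h x)(n := y)) / Q ((h x)(n := y))" by fastforce
      have sm: "s m \<in> OX" "t m \<in> OR" using Suc.prems by auto
      obtain P1 Q1 where 1: "s m = restrict (\<lambda>x. P1 (h x) / Q1 (h x)) (points X)"
        "P1 \<in> polys n" "Q1 \<in> polys n" "\<forall>x\<in>points X. Q1 (h x) \<noteq> 0" using sm(1) unfolding iX(3) by blast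
      obtain p q where 2: "t m = restrict (\<lambda>x. poly p x / poly q x) UNIV"
        "\<forall>x. poly q x \<noteq> 0" using sm(2) unfolding OR by auto
      let ?N = "\<lambda>z. P1 z * poly p (z n)" and ?D = "\<lambda>z. Q1 z * poly q (z n)"
      have N: "?N \<in> polys (Suc n)" and D: "?D \<in> polys (Suc n)"
        by (intro polys.mult poly_in_polys polys_update(2) 1)+
      show ?case
      proof (rule bexI[where x = "\<lambda>z. P z * ?D z + ?N z * Q z"],
          rule bexI[where x = "\<lambda>z. Q z * ?D z"], intro ballI allI)
        show "(\<lambda>z. P z * ?D z + ?N z * Q z) \<in> polys (Suc n)"
          by (intro polys.add polys.mult[OF PQ(1) D] polys.mult[OF N PQ(2)])
        show "(\<lambda>z. Q z * ?D z) \<in> polys (Suc n)" by (rule polys.mult[OF PQ(2) D])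
        fix x y assume x: "x \<in> points X"
        let ?z = "(h x)(n := y)"
        have "s m x * t m y = ?N ?z / ?D ?z"
          using x by (simp add: 1(1) 2(1) polys_update(1)[OF 1(2)] polys_update(1)[OF 1(3)])
        moreover have D0: "?D ?z \<noteq> 0" using x 1(4) 2(2) by (simp add: polys_update(1)[OF 1(3)])
        moreover have Q0: "Q ?z \<noteq> 0" "(\<Sum>k<m. s k x * t k y) = P ?z / Q ?z" using PQ(3) x by blast+
        ultimately have "(\<Sum>k<Suc m. s k x * t k y) = P ?z / Q ?z + ?N ?z / ?D ?z"
          unfolding sum.lessThan_Suc by (simp only:)
        also have "\<dots> = (P ?z * ?D ?z + ?N ?z * Q ?z) / (Q ?z * ?D ?z)"
          by (rule add_frac_eq[OF Q0(1) D0])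
        finally show "Q ?z * ?D ?z \<noteq> 0 \<and> (\<Sum>k<Suc m. s k x * t k y)
            = (P ?z * ?D ?z + ?N ?z * Q ?z) / (Q ?z * ?D ?z)"
          using Q0(1) D0 by (simp only: mult_eq_0_iff de_Morgan_disj simp_thms)
      qed
    qed
    then obtain P Q where PQ: "P \<in> polys (Suc n)" "Q \<in> polys (Suc n)"
      "\<forall>x\<in>points X. \<forall>y. Q ((h x)(n := y)) \<noteq> 0 \<and>
        (\<Sum>k<m. s k x * t k y) = P ((h x)(n := y)) / Q ((h x)(n := y))" by blast
    have "\<forall>x\<in>S. Q (?k x) \<noteq> 0 \<and> a x = P (?k x) / Q (?k x)"
    proof
      fix p assume "p \<in> S"
      then obtain x y where "p = (x, y)" "x \<in> points X" unfolding S_def by blast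
      then show "Q (?k p) \<noteq> 0 \<and> a p = P (?k p) / Q (?k p)"
        using PQ(3) unfolding a by (simp del: fun_upd_apply)
    qed
    then show "\<exists>P\<in>polys (Suc n). \<exists>Q\<in>polys (Suc n). \<forall>x\<in>S. Q (?k x) \<noteq> 0 \<and> a x = P (?k x) / Q (?k x)"
      using PQ(1,2) by blast
  qed
  moreover have "variety_prod X real_line = fspace_of S A"
    unfolding variety_prod_def S_def A_def OX_def OR_def points_real_line ..
  ultimately show ?thesis by simp
qed

lemma closedin_affine_space:
  "closedin (zariski (affine_space n)) Z \<longleftrightarrow>
     (\<exists>F\<subseteq>polys n. Z = {x \<in> topspace (Euclidean_space n). \<forall>P\<in>F. P x = 0})"
proof -
  let ?E = "topspace (Euclidean_space n)"
  have "closedin (zariski (affine_space n)) Z \<longleftrightarrow>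
      Z \<subseteq> ?E \<and> (\<exists>F\<subseteq>polys n. ?E - (?E - Z) = {x \<in> ?E. \<forall>P\<in>F. P x = 0})"
    unfolding affine_space_def closedin_def points_polys openin_polys by simp
  also have "\<dots> \<longleftrightarrow> (\<exists>F\<subseteq>polys n. Z = {x \<in> ?E. \<forall>P\<in>F. P x = 0})"
  proof (cases "Z \<subseteq> ?E")
    case True
    then have "?E - (?E - Z) = Z" by blast
    with True show ?thesis by simp
  qed blast
  finally show ?thesis .
qed

corollary real_affine_variety_prod_real_line:
  assumes "real_affine_variety X"
  shows "real_affine_variety (variety_prod X real_line)"
proof -
  obtain n Z h where Z: "closedin (zariski (affine_space n)) Z"
    and iso: "isomorphism X (fspace_of Z (polys n)) h"
    using assms unfolding real_affine_variety_def by blast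
  obtain F where F: "F \<subseteq> polys n" "Z = {x \<in> topspace (Euclidean_space n). \<forall>P\<in>F. P x = 0}"
    using Z unfolding closedin_affine_space by blast
  have "{z(n := t) | z t. z \<in> Z} = {x \<in> topspace (Euclidean_space (Suc n)). \<forall>P\<in>F. P x = 0}"
  proof (intro subset_antisym subsetI)
    fix x assume "x \<in> {z(n := t) | z t. z \<in> Z}"
    then obtain z t where x: "x = z(n := t)" "z \<in> Z" by blast
    have z: "\<forall>i\<ge>n. z i = 0" "\<forall>P\<in>F. P z = 0"
      using x(2) F(2) by (simp_all add: topspace_Euclidean_space)
    have "P x = 0" if P: "P \<in> F" for P
    proof -
      have "P x = P z" unfolding x(1) using P F(1) by (intro polys_update(1)) blast
      then show ?thesis using z(2) P by simp
    qed
    moreover have "\<forall>i\<ge>Suc n. x i = 0" using z(1) x(1) by simp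
    ultimately show "x \<in> {x \<in> topspace (Euclidean_space (Suc n)). \<forall>P\<in>F. P x = 0}"
      by (simp add: topspace_Euclidean_space)
  next
    fix x assume x: "x \<in> {x \<in> topspace (Euclidean_space (Suc n)). \<forall>P\<in>F. P x = 0}"
    then have x0: "\<forall>i\<ge>Suc n. x i = 0" "\<forall>P\<in>F. P x = 0"
      by (simp_all add: topspace_Euclidean_space)
    have "P (x(n := 0)) = 0" if P: "P \<in> F" for P
    proof -
      have "P (x(n := 0)) = P x" using P F(1) by (intro polys_update(1)) blast
      then show ?thesis using x0(2) P by simp
    qed
    moreover have "\<forall>i\<ge>n. (x(n := 0)) i = 0" using x0(1) by (simp add: le_Suc_eq Suc_le_eq)
    ultimately have "x(n := 0) \<in> Z"
      unfolding F(2) topspace_Euclidean_space by (simp del: fun_upd_apply)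
    moreover have "x = (x(n := 0))(n := x n)" by simp
    ultimately show "x \<in> {z(n := t) | z t. z \<in> Z}"
      by (intro CollectI exI[of _ "x(n := 0)"] exI[of _ "x n"] conjI)
  qed
  moreover have "F \<subseteq> polys (Suc n)" using F(1) polys_update(2) by blast
  ultimately have "closedin (zariski (affine_space (Suc n))) {z(n := t) | z t. z \<in> Z}"
    unfolding closedin_affine_space by blast
  moreover have "Z \<subseteq> topspace (Euclidean_space n)" using F(2) by blast
  ultimately show ?thesis
    unfolding real_affine_variety_def using isomorphism_prod_real_line[OF _ iso] by blast
qed

end

theory Submission
  imports Defs
begin

text \<open>
  Embed \<open>Y\<close> in \<open>\<real>\<^sup>m\<close>. Extending \<open>i\<close> to a rational map on \<open>\<real>\<^sup>m\<close>, every point of \<open>Y\<close> gets a rational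
  retraction \<open>\<rho> = P / Q\<close> of \<open>{Q \<noteq> 0} \<subseteq> \<real>\<^sup>m\<close> into \<open>Y\<close>. The spray \<open>(y, v) \<mapsto> \<rho> (y + c Q(y)\<^sup>2 v)\<close> extends
  regularly by \<open>(y, v) \<mapsto> y\<close> across \<open>{Q = 0}\<close>, and finitely many of them are composed to a map
  \<open>S(y, v)\<close> with \<open>S(y, 0) = y\<close>. The key point is that for \<open>z\<close> close to \<open>y\<close> the equation
  \<open>S(y, v) = z\<close> has a solution \<open>v\<close> that is a \<^emph>\<open>rational\<close> function of \<open>(y, z)\<close>. It is found by keeping the
  current point in the form \<open>p = z + \<mu> b\<close>, where \<open>\<mu> = \<nu> \<Sum>\<^sub>i\<^sub>\<ge>\<^sub>j Q\<^sub>i(z)\<^sup>2\<close> before the \<open>j\<close>-th spray: as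
  \<open>Q\<^sub>j(p) - Q\<^sub>j(z)\<close> is a small multiple of \<open>\<mu>\<close>, the number \<open>Q\<^sub>j(p)\<^sup>2 + \<Sum>\<^sub>i\<^sub>>\<^sub>j Q\<^sub>i(z)\<^sup>2\<close> is a unit times
  \<open>\<Sum>\<^sub>i\<^sub>\<ge>\<^sub>j Q\<^sub>i(z)\<^sup>2\<close>, so that \<open>\<mu> = \<nu>' Q\<^sub>j(p)\<^sup>2 + \<nu>' \<Sum>\<^sub>i\<^sub>>\<^sub>j Q\<^sub>i(z)\<^sup>2\<close>; the \<open>j\<close>-th spray, which can absorb the
  factor \<open>Q\<^sub>j(p)\<^sup>2\<close>, removes the first summand. After the last spray \<open>\<mu> = 0\<close>.

  Now cut the homotopy into small steps. Each step is \<open>S(_, v(x))\<close> with \<open>v\<close> continuous; replacing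
  \<open>v\<close> by a polynomial map \<open>w\<close> and inserting \<open>\<sigma>(t) w(x)\<close> yields a regular homotopy from \<open>f\<close> to a
  regular map close to \<open>g\<close>. For the last step, to \<open>g\<close> itself, \<open>v\<close> is regular already.
\<close>

section \<open>Polynomials in coordinates\<close>

lemma polys_cong:
  assumes "P \<in> polys n" "\<And>i. i < n \<Longrightarrow> x i = y i"
  shows "P x = P y"
  using assms by induction auto

lemma polys_mono:
  assumes "P \<in> polys n" "n \<le> m"
  shows "P \<in> polys m"
  using assms by induction (auto intro: polys.intros)

lemma polys_uminus: "P \<in> polys n \<Longrightarrow> (\<lambda>x. - P x) \<in> polys n"
  using polys.mult[OF polys.const[of "-1"], of P n] by simp

lemma polys_diff: "P \<in> polys n \<Longrightarrow> R \<in> polys n \<Longrightarrow> (\<lambda>x. P x - R x) \<in> polys n"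
  using polys.add[OF _ polys_uminus, of P n R] by simp

lemma polys_prod:
  assumes "finite I" "\<And>i. i \<in> I \<Longrightarrow> P i \<in> polys n"
  shows "(\<lambda>x. \<Prod>i\<in>I. P i x) \<in> polys n"
  using assms
proof (induction I rule: finite_induct)
  case (insert i I)
  then show ?case using polys.mult[of "P i" n "\<lambda>x. \<Prod>i\<in>I. P i x"] by simp
qed (simp add: polys.const)

lemma continuous_on_polys:
  assumes "P \<in> polys n"
  shows "continuous_on S P"
  using assms
proof induction
  case (const c)
  show ?case by (rule continuous_on_const)
next
  case (var i)
  show ?case by (rule continuous_on_subset[OF continuous_on_product_coordinates]) simp
next
  case (add P Q)
  show ?case by (rule continuous_on_add[OF add.IH])
next
  case (mult P Q)
  show ?case by (rule continuous_on_mult[OF mult.IH])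
qed

section \<open>Difference quotients along lines and polynomial majorants\<close>

definition lin :: "nat \<Rightarrow> (nat \<Rightarrow> real) \<Rightarrow> real \<Rightarrow> (nat \<Rightarrow> real) \<Rightarrow> nat \<Rightarrow> real" where
  "lin m y \<tau> d = (\<lambda>l. if l < m then y l + \<tau> * d l else 0)"

text \<open>Packs base point, direction and step length into one point, so that a difference
  quotient is again a polynomial, to which majorants and further difference quotients apply. All
  indices from \<open>2 * m\<close> on carry \<tau>; a polynomial in
  \<open>polys (2 * m + 1)\<close> reads only the first of them.\<close>

definition join :: "nat \<Rightarrow> (nat \<Rightarrow> real) \<Rightarrow> (nat \<Rightarrow> real) \<Rightarrow> real \<Rightarrow> nat \<Rightarrow> real" where
  "join m y d \<tau> = (\<lambda>i. if i < m then y i else if i < 2 * m then d (i - m) else \<tau>)"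

lemma polys_join: "P \<in> polys m \<Longrightarrow> P (join m y d \<tau>) = P y"
  by (rule polys_cong) (auto simp: join_def)

text \<open>Structural induction; for a product, the increment divided by \<tau> is
  \<open>P' Q + P Q' + \<tau> P' Q'\<close>. The last clause is carried along because at \<tau> = 0
  it cannot be read off from the equation at that point. It makes all corrections vanish on the
  diagonal \<open>y = z\<close>.\<close>

lemma diffquot_ex:
  assumes "P \<in> polys m"
  shows "\<exists>R\<in>polys (2 * m + 1).
    (\<forall>y d \<tau>. P (lin m y \<tau> d) = P y + \<tau> * R (join m y d \<tau>)) \<and>
    (\<forall>y d \<tau>. (\<forall>l<m. d l = 0) \<longrightarrow> R (join m y d \<tau>) = 0)"
  using assms
proof induction
  case (const c)
  show ?case by (rule bexI[OF _ polys.const[of 0]]) auto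
next
  case (var i)
  then show ?case
    by (intro bexI[OF _ polys.var[of "m + i"]]) (auto simp: lin_def join_def)
next
  case (add P Q)
  then obtain P' Q' where "P' \<in> polys (2 * m + 1)" "Q' \<in> polys (2 * m + 1)"
    "\<forall>y d \<tau>. P (lin m y \<tau> d) = P y + \<tau> * P' (join m y d \<tau>)"
    "\<forall>y d \<tau>. (\<forall>l<m. d l = 0) \<longrightarrow> P' (join m y d \<tau>) = 0"
    "\<forall>y d \<tau>. Q (lin m y \<tau> d) = Q y + \<tau> * Q' (join m y d \<tau>)"
    "\<forall>y d \<tau>. (\<forall>l<m. d l = 0) \<longrightarrow> Q' (join m y d \<tau>) = 0"
    by blast
  then show ?case
    by (intro bexI[where x = "\<lambda>x. P' x + Q' x"] polys.add) (auto simp: algebra_simps)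
next
  case (mult P Q)
  then obtain P' Q' where *: "P' \<in> polys (2 * m + 1)" "Q' \<in> polys (2 * m + 1)"
    "\<forall>y d \<tau>. P (lin m y \<tau> d) = P y + \<tau> * P' (join m y d \<tau>)"
    "\<forall>y d \<tau>. (\<forall>l<m. d l = 0) \<longrightarrow> P' (join m y d \<tau>) = 0"
    "\<forall>y d \<tau>. Q (lin m y \<tau> d) = Q y + \<tau> * Q' (join m y d \<tau>)"
    "\<forall>y d \<tau>. (\<forall>l<m. d l = 0) \<longrightarrow> Q' (join m y d \<tau>) = 0"
    by blast
  have \<tau>: "join m y d \<tau> (2 * m) = \<tau>" for y d \<tau> by (simp add: join_def)
  let ?R = "\<lambda>x. P' x * Q x + (P x * Q' x + x (2 * m) * (P' x * Q' x))"
  have "P \<in> polys (2 * m + 1)" "Q \<in> polys (2 * m + 1)"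
    using mult.hyps by (auto intro: polys_mono)
  then have "?R \<in> polys (2 * m + 1)"
    using *(1,2) by (intro polys.add polys.mult polys.var) simp_all
  moreover have "P (lin m y \<tau> d) * Q (lin m y \<tau> d) = P y * Q y + \<tau> * ?R (join m y d \<tau>)" for y d \<tau>
    unfolding *(3,5)[rule_format] polys_join[OF mult.hyps(1)] polys_join[OF mult.hyps(2)] \<tau>
    by (simp add: algebra_simps)
  moreover have "?R (join m y d \<tau>) = 0" if "\<forall>l<m. d l = 0" for y d \<tau>
    using * that by simp
  ultimately show ?case by (intro bexI[where x = ?R]) simp_all
qed

definition diffquot :: "nat \<Rightarrow> ((nat \<Rightarrow> real) \<Rightarrow> real) \<Rightarrow> (nat \<Rightarrow> real) \<Rightarrow> real" where
  "diffquot m P = (SOME R. R \<in> polys (2 * m + 1) \<and>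
    (\<forall>y d \<tau>. P (lin m y \<tau> d) = P y + \<tau> * R (join m y d \<tau>)) \<and>
    (\<forall>y d \<tau>. (\<forall>l<m. d l = 0) \<longrightarrow> R (join m y d \<tau>) = 0))"

lemma diffquot:
  assumes "P \<in> polys m"
  shows "diffquot m P \<in> polys (2 * m + 1)"
    and "P (lin m y \<tau> d) = P y + \<tau> * diffquot m P (join m y d \<tau>)"
    and "(\<And>l. l < m \<Longrightarrow> d l = 0) \<Longrightarrow> diffquot m P (join m y d \<tau>) = 0"
  using someI_ex[OF diffquot_ex[OF assms, unfolded Bex_def]] unfolding diffquot_def[symmetric] by auto

text \<open>Constants are replaced by their absolute values, and variables by
  \<open>1 + x i * x i\<close>, which dominates the absolute value. The bound has to be a
  polynomial, and not a maximum over the box, so that \<open>scale\<close> stays regular.\<close>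

lemma majorant_ex:
  assumes "P \<in> polys n"
  shows "\<exists>E\<in>polys n. \<forall>x x'. (\<forall>i<n. \<bar>x' i\<bar> \<le> \<bar>x i\<bar>) \<longrightarrow> \<bar>P x'\<bar> \<le> E x"
  using assms
proof induction
  case (const c)
  show ?case by (rule bexI[OF _ polys.const[of "\<bar>c\<bar>"]]) auto
next
  case (var i)
  have "\<bar>t\<bar> \<le> 1 + t * t" for t :: real
    using zero_le_power2[of "\<bar>t\<bar> - 1/2"] by (simp add: power2_eq_square algebra_simps)
  then show ?case
    using var by (intro bexI[where x = "\<lambda>x. 1 + x i * x i"] polys.intros) (auto intro: order_trans)
next
  case (add P Q)
  then obtain E F where "E \<in> polys n" "F \<in> polys n"
    "\<forall>x x'. (\<forall>i<n. \<bar>x' i\<bar> \<le> \<bar>x i\<bar>) \<longrightarrow> \<bar>P x'\<bar> \<le> E x"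
    "\<forall>x x'. (\<forall>i<n. \<bar>x' i\<bar> \<le> \<bar>x i\<bar>) \<longrightarrow> \<bar>Q x'\<bar> \<le> F x" by blast
  then show ?case
    by (intro bexI[where x = "\<lambda>x. E x + F x"] polys.add)
      (auto intro!: order_trans[OF abs_triangle_ineq] add_mono)
next
  case (mult P Q)
  then obtain E F where *: "E \<in> polys n" "F \<in> polys n"
    "\<forall>x x'. (\<forall>i<n. \<bar>x' i\<bar> \<le> \<bar>x i\<bar>) \<longrightarrow> \<bar>P x'\<bar> \<le> E x"
    "\<forall>x x'. (\<forall>i<n. \<bar>x' i\<bar> \<le> \<bar>x i\<bar>) \<longrightarrow> \<bar>Q x'\<bar> \<le> F x" by blast
  have "\<bar>P x' * Q x'\<bar> \<le> E x * F x" if "\<forall>i<n. \<bar>x' i\<bar> \<le> \<bar>x i\<bar>" for x x'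
    unfolding abs_mult using *(3,4) that
    by (intro mult_mono') auto
  with *(1,2) show ?case
    by (intro bexI[where x = "\<lambda>x. E x * F x"] polys.mult) auto
qed

definition majorant :: "nat \<Rightarrow> ((nat \<Rightarrow> real) \<Rightarrow> real) \<Rightarrow> (nat \<Rightarrow> real) \<Rightarrow> real" where
  "majorant n P = (SOME E. E \<in> polys n \<and> (\<forall>x x'. (\<forall>i<n. \<bar>x' i\<bar> \<le> \<bar>x i\<bar>) \<longrightarrow> \<bar>P x'\<bar> \<le> E x))"

lemma majorant:
  assumes "P \<in> polys n"
  shows "majorant n P \<in> polys n"
    and "(\<And>i. i < n \<Longrightarrow> \<bar>x' i\<bar> \<le> \<bar>x i\<bar>) \<Longrightarrow> \<bar>P x'\<bar> \<le> majorant n P x"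
  using someI_ex[OF majorant_ex[OF assms, unfolded Bex_def]] unfolding majorant_def[symmetric] by auto

section \<open>Algebras of functions closed under division\<close>

text \<open>Regular functions and continuous functions on \<open>D\<close> are both instances, so that one argument gives
  the regularity and the continuity of a rational construction.\<close>

locale function_algebra =
  fixes D :: "'d set" and A :: "('d \<Rightarrow> real) set"
  assumes const: "(\<lambda>x. c) \<in> A"
    and add: "f \<in> A \<Longrightarrow> g \<in> A \<Longrightarrow> (\<lambda>x. f x + g x) \<in> A"
    and mult: "f \<in> A \<Longrightarrow> g \<in> A \<Longrightarrow> (\<lambda>x. f x * g x) \<in> A"
    and divide: "f \<in> A \<Longrightarrow> g \<in> A \<Longrightarrow> (\<And>x. x \<in> D \<Longrightarrow> g x \<noteq> 0) \<Longrightarrow> (\<lambda>x. f x / g x) \<in> A"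
    and cong: "f \<in> A \<Longrightarrow> (\<And>x. x \<in> D \<Longrightarrow> f x = g x) \<Longrightarrow> g \<in> A"
begin

lemma uminus: "f \<in> A \<Longrightarrow> (\<lambda>x. - f x) \<in> A"
  using mult[OF const[of "-1"], of f] by simp

lemma diff: "f \<in> A \<Longrightarrow> g \<in> A \<Longrightarrow> (\<lambda>x. f x - g x) \<in> A"
  using add[OF _ uminus, of f g] by simp

lemma power: "f \<in> A \<Longrightarrow> (\<lambda>x. f x ^ n) \<in> A"
  by (induction n) (auto intro: const mult)

lemma sum:
  assumes "\<And>i. i \<in> I \<Longrightarrow> f i \<in> A"
  shows "(\<lambda>x. \<Sum>i\<in>I. f i x) \<in> A"
  using assms by (induction I rule: infinite_finite_induct) (auto intro: const add)

lemma polys: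
  assumes "P \<in> polys n" "\<And>i. i < n \<Longrightarrow> (\<lambda>x. y x i) \<in> A"
  shows "(\<lambda>x. P (y x)) \<in> A"
  using assms by induction (auto intro: const add mult)

lemma lin:
  assumes "\<And>l. l < m \<Longrightarrow> (\<lambda>x. y x l) \<in> A" "\<tau> \<in> A" "\<And>l. l < m \<Longrightarrow> (\<lambda>x. d x l) \<in> A"
  shows "(\<lambda>x. lin m (y x) (\<tau> x) (d x) i) \<in> A"
  using assms by (cases "i < m") (simp_all add: lin_def const add mult)

lemma join:
  assumes "\<And>l. l < m \<Longrightarrow> (\<lambda>x. y x l) \<in> A" "\<And>l. l < m \<Longrightarrow> (\<lambda>x. d x l) \<in> A" "\<tau> \<in> A"
  shows "(\<lambda>x. join m (y x) (d x) (\<tau> x) i) \<in> A"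
  using assms by (cases "i < m"; cases "i < 2 * m") (simp_all add: join_def)

end

lemma function_algebra_continuous: "function_algebra D {f. continuous_on D f}"
proof
  fix f g :: "'a \<Rightarrow> real"
  assume "f \<in> {f. continuous_on D f}" "\<And>x. x \<in> D \<Longrightarrow> f x = g x"
  then show "g \<in> {f. continuous_on D f}" using continuous_on_cong[of D D f g] by simp
qed (auto intro: continuous_on_add continuous_on_mult continuous_on_divide)

text \<open>The coordinate map \<open>e\<close> is a parameter, so that one notion serves coordinate
  sets (\<open>e\<close> the identity), abstract varieties (\<open>e\<close> their isomorphism) and
  products with the line (\<open>e\<close> equal to \<open>snoc n\<close>).\<close>

definition regular_functions :: "('d \<Rightarrow> nat \<Rightarrow> real) \<Rightarrow> nat \<Rightarrow> 'd set \<Rightarrow> ('d \<Rightarrow> real) set" where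
  "regular_functions e n D =
     {f. \<exists>P\<in>polys n. \<exists>Q\<in>polys n. \<forall>x\<in>D. Q (e x) \<noteq> 0 \<and> f x = P (e x) / Q (e x)}"

lemma regular_functionsI:
  assumes "P \<in> polys n" "Q \<in> polys n" "\<And>x. x \<in> D \<Longrightarrow> Q (e x) \<noteq> 0"
    "\<And>x. x \<in> D \<Longrightarrow> f x = P (e x) / Q (e x)"
  shows "f \<in> regular_functions e n D"
  using assms unfolding regular_functions_def by blast

lemma regular_functionsE:
  assumes "f \<in> regular_functions e n D"
  obtains P Q where "P \<in> polys n" "Q \<in> polys n" "\<And>x. x \<in> D \<Longrightarrow> Q (e x) \<noteq> 0"
    "\<And>x. x \<in> D \<Longrightarrow> f x = P (e x) / Q (e x)"
  using assms unfolding regular_functions_def by blast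

lemma regular_functions_polys: "P \<in> polys n \<Longrightarrow> (\<lambda>x. P (e x)) \<in> regular_functions e n D"
  by (rule regular_functionsI[OF _ polys.const[of 1]]) auto

lemma regular_functions_subset:
  "f \<in> regular_functions e n D \<Longrightarrow> D' \<subseteq> D \<Longrightarrow> f \<in> regular_functions e n D'"
  unfolding regular_functions_def by blast

lemma function_algebra_regular: "function_algebra D (regular_functions e n D)"
proof
  fix c
  show "(\<lambda>x. c) \<in> regular_functions e n D"
    by (rule regular_functions_polys[OF polys.const])
next
  fix f g assume "f \<in> regular_functions e n D" "g \<in> regular_functions e n D"
  then obtain P Q P' Q' where f: "P \<in> polys n" "Q \<in> polys n" "\<And>x. x \<in> D \<Longrightarrow> Q (e x) \<noteq> 0"
    "\<And>x. x \<in> D \<Longrightarrow> f x = P (e x) / Q (e x)"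
    and g: "P' \<in> polys n" "Q' \<in> polys n" "\<And>x. x \<in> D \<Longrightarrow> Q' (e x) \<noteq> 0"
    "\<And>x. x \<in> D \<Longrightarrow> g x = P' (e x) / Q' (e x)"
    by (elim regular_functionsE) blast
  note PQ = polys.mult[OF f(1) g(2)] polys.mult[OF g(1) f(2)] polys.mult[OF f(2) g(2)]
    polys.mult[OF f(1) g(1)] polys.mult[OF f(2) g(1)]
  show "(\<lambda>x. f x + g x) \<in> regular_functions e n D"
    by (rule regular_functionsI[OF polys.add[OF PQ(1,2)] PQ(3)])
      (simp_all add: f(3,4) g(3,4) add_frac_eq mult.commute)
  show "(\<lambda>x. f x * g x) \<in> regular_functions e n D"
    by (rule regular_functionsI[OF PQ(4,3)]) (simp_all add: f(3,4) g(3,4))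
  assume nz: "\<And>x. x \<in> D \<Longrightarrow> g x \<noteq> 0"
  have P': "P' (e x) \<noteq> 0" if "x \<in> D" for x using nz[OF that] g(4)[OF that] by auto
  show "(\<lambda>x. f x / g x) \<in> regular_functions e n D"
    by (rule regular_functionsI[OF PQ(1,5)]) (simp_all add: f(3,4) g(3,4) P')
next
  fix f g assume fg: "f \<in> regular_functions e n D" "\<And>x. x \<in> D \<Longrightarrow> f x = g x"
  obtain P Q where f: "P \<in> polys n" "Q \<in> polys n" "\<And>x. x \<in> D \<Longrightarrow> Q (e x) \<noteq> 0"
    "\<And>x. x \<in> D \<Longrightarrow> f x = P (e x) / Q (e x)"
    by (rule regular_functionsE[OF fg(1)]) blast
  show "g \<in> regular_functions e n D"
    by (rule regular_functionsI[OF f(1-3)]) (simp_all add: fg(2)[symmetric] f(4))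
qed

section \<open>Sprays from retractions\<close>

text \<open>Chart \<open>j\<close> is the rational retraction with coordinates
  \<open>P j l / Q j\<close>. \<open>P_on\<close> is written without division and so holds also
  where \<open>Q j\<close> vanishes, which makes \<open>N j l\<close> vanish on all of
  \<open>Y\<close>. That charts cover a point enters later, as positivity of
  \<open>tail 0\<close>.\<close>

locale retraction_charts =
  fixes m k :: nat and Y :: "(nat \<Rightarrow> real) set"
    and P :: "nat \<Rightarrow> nat \<Rightarrow> (nat \<Rightarrow> real) \<Rightarrow> real" and Q :: "nat \<Rightarrow> (nat \<Rightarrow> real) \<Rightarrow> real"
  assumes Y_space: "y \<in> Y \<Longrightarrow> m \<le> l \<Longrightarrow> y l = 0"
    and P_polys: "j < k \<Longrightarrow> l < m \<Longrightarrow> P j l \<in> polys m"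
    and Q_polys: "j < k \<Longrightarrow> Q j \<in> polys m"
    and P_on: "j < k \<Longrightarrow> l < m \<Longrightarrow> y \<in> Y \<Longrightarrow> P j l y = y l * Q j y"
    and retraction_in: "j < k \<Longrightarrow> Q j u \<noteq> 0 \<Longrightarrow> (\<lambda>l. if l < m then P j l u / Q j u else 0) \<in> Y"
begin

text \<open>\<open>N j l / Q j\<close> is the displacement of coordinate \<open>l\<close> under the
  retraction of chart \<open>j\<close>.\<close>

definition N :: "nat \<Rightarrow> nat \<Rightarrow> (nat \<Rightarrow> real) \<Rightarrow> real" where
  "N j l u = P j l u - u l * Q j u"

text \<open>The scaling factor keeps \<open>Q j\<close> nonzero at the argument of the retraction in \<open>spray\<close>, for all \<open>v\<close> in
  the unit cube; see \<open>Q_spray\<close>.\<close>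

definition scale :: "nat \<Rightarrow> (nat \<Rightarrow> real) \<Rightarrow> real" where
  "scale j y = 1 / (1 + majorant (2 * m + 1) (\<lambda>x. Q j x * diffquot m (Q j) x) (join m y (\<lambda>_. 1) ((Q j y)\<^sup>2)))"

definition spray :: "nat \<Rightarrow> (nat \<Rightarrow> real) \<Rightarrow> (nat \<Rightarrow> real) \<Rightarrow> nat \<Rightarrow> real" where
  "spray j y v = (if Q j y = 0 then y else
     let u = lin m y ((Q j y)\<^sup>2 * scale j y) v in (\<lambda>l. if l < m then P j l u / Q j u else 0))"

section \<open>A single spray\<close>

lemma N_polys: "j < k \<Longrightarrow> l < m \<Longrightarrow> N j l \<in> polys m"
  unfolding N_def by (intro polys_diff P_polys polys.mult Q_polys polys.var)

lemma N_zero: "j < k \<Longrightarrow> l < m \<Longrightarrow> y \<in> Y \<Longrightarrow> N j l y = 0"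
  by (simp add: N_def P_on)

lemma majorant_polys:
  assumes j: "j < k"
  shows "(\<lambda>x. Q j x * diffquot m (Q j) x) \<in> polys (2 * m + 1)"
proof (rule polys.mult)
  show "Q j \<in> polys (2 * m + 1)" by (rule polys_mono[OF Q_polys[OF j]]) simp
qed (rule diffquot(1)[OF Q_polys[OF j]])

lemma majorant_nonneg:
  assumes j: "j < k"
  shows "0 \<le> majorant (2 * m + 1) (\<lambda>x. Q j x * diffquot m (Q j) x) x"
  using majorant(2)[OF majorant_polys[OF j], of x x] by linarith

lemma scale_pos: "j < k \<Longrightarrow> 0 < scale j y"
  using majorant_nonneg unfolding scale_def by (simp add: add_pos_nonneg)

lemma scale_le_1: "j < k \<Longrightarrow> scale j y \<le> 1"
  using majorant_nonneg[of j] unfolding scale_def by (simp add: divide_le_eq_1 add_pos_nonneg)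

text \<open>As \<tau> contains \<open>(Q j y)\<^sup>2\<close>, the increment of \<open>Q j\<close>
  has \<open>Q j y\<close> as a factor. For positivity: \<open>scale j y\<close> is at most 1 and
  \<open>v\<close> is in the unit cube, so \<open>join m y v \<tau>\<close> lies in the box on which
  the majorant \<open>E\<close> inside \<open>scale\<close> is valid, and the perturbation of 1 is
  at most \<open>E / (1 + E)\<close> in absolute value.\<close>

lemma Q_spray:
  fixes y v :: "nat \<Rightarrow> real"
  assumes j: "j < k" and v: "\<forall>l<m. \<bar>v l\<bar> \<le> 1"
  defines "\<tau> \<equiv> (Q j y)\<^sup>2 * scale j y"
  shows "Q j (lin m y \<tau> v) = Q j y * (1 + Q j y * scale j y * diffquot m (Q j) (join m y v \<tau>))" (is "_ = _ * ?u")
    and "0 < 1 + Q j y * scale j y * diffquot m (Q j) (join m y v \<tau>)"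
proof -
  show "Q j (lin m y \<tau> v) = Q j y * ?u"
    unfolding diffquot(2)[OF Q_polys[OF j]] by (simp add: \<tau>_def power2_eq_square algebra_simps)
  let ?B = "\<lambda>x. Q j x * diffquot m (Q j) x"
  let ?E = "majorant (2 * m + 1) ?B (join m y (\<lambda>_. 1) ((Q j y)\<^sup>2))"
  have "\<bar>\<tau>\<bar> \<le> \<bar>(Q j y)\<^sup>2\<bar>"
    using scale_pos[OF j, of y] scale_le_1[OF j, of y]
    by (simp add: \<tau>_def abs_mult mult_left_le)
  then have "\<bar>join m y v \<tau> i\<bar> \<le> \<bar>join m y (\<lambda>_. 1) ((Q j y)\<^sup>2) i\<bar>" for i
    using v by (simp add: join_def)
  then have "\<bar>?B (join m y v \<tau>)\<bar> \<le> ?E"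
    by (intro majorant(2)[OF majorant_polys[OF j]])
  then have "\<bar>Q j y * diffquot m (Q j) (join m y v \<tau>)\<bar> \<le> ?E"
    by (simp add: polys_join[OF Q_polys[OF j]])
  also have "\<dots> < 1 + ?E" by simp
  finally have "scale j y * \<bar>Q j y * diffquot m (Q j) (join m y v \<tau>)\<bar> < 1"
    using majorant_nonneg[OF j] unfolding scale_def
    by (simp add: divide_less_eq add_pos_nonneg)
  then have "\<bar>Q j y * scale j y * diffquot m (Q j) (join m y v \<tau>)\<bar> < 1"
    using scale_pos[OF j, of y] by (simp add: abs_mult mult_ac)
  then show "0 < ?u" by linarith
qed

text \<open>The retraction moves \<open>u\<close> by \<open>N j l u / Q j u\<close>. As
  \<open>N j l\<close> vanishes at \<open>y\<close>, the numerator is \<tau> times a difference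
  quotient, and the denominator is \<open>Q j y\<close> times a positive unit. One of the two
  factors \<open>Q j y\<close> in \<tau> survives, so the expression has no pole along
  \<open>Q j y = 0\<close> and equals \<open>y l\<close> there.\<close>

lemma spray_formula:
  fixes y v :: "nat \<Rightarrow> real"
  assumes j: "j < k" and y: "y \<in> Y" and v: "\<forall>l<m. \<bar>v l\<bar> \<le> 1" and l: "l < m"
  defines "\<tau> \<equiv> (Q j y)\<^sup>2 * scale j y"
  shows "spray j y v l = y l + \<tau> * v l + Q j y * scale j y * diffquot m (N j l) (join m y v \<tau>) /
    (1 + Q j y * scale j y * diffquot m (Q j) (join m y v \<tau>))"
proof (cases "Q j y = 0")
  case True
  then show ?thesis by (simp add: spray_def \<tau>_def)
next
  case False
  let ?u = "lin m y \<tau> v"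
  let ?w = "1 + Q j y * scale j y * diffquot m (Q j) (join m y v \<tau>)"
  note Qs = Q_spray[OF j v, where y = y, folded \<tau>_def]
  have Qu: "Q j ?u = Q j y * ?w" by (rule Qs(1))
  have w: "?w \<noteq> 0" using Qs(2) by simp
  have "spray j y v l = P j l ?u / Q j ?u"
    using False l by (simp add: spray_def \<tau>_def Let_def)
  also have "P j l ?u = ?u l * Q j ?u + N j l ?u" by (simp add: N_def)
  also have "N j l ?u = \<tau> * diffquot m (N j l) (join m y v \<tau>)"
    unfolding diffquot(2)[OF N_polys[OF j l]] using N_zero[OF j l y] by simp
  also have "(?u l * Q j ?u + \<tau> * diffquot m (N j l) (join m y v \<tau>)) / Q j ?u
      = ?u l + Q j y * scale j y * diffquot m (N j l) (join m y v \<tau>) / ?w"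
  proof -
    have "\<tau> / Q j ?u = Q j y * scale j y / ?w"
    proof -
      have "a\<^sup>2 * s / (a * b) = a * s / b" if "a \<noteq> 0" for a s b :: real
        using that by (simp add: power2_eq_square)
      from this[OF False, of "scale j y" ?w] show ?thesis unfolding Qu \<tau>_def[symmetric] .
    qed
    moreover have "Q j ?u \<noteq> 0" unfolding Qu using False w by simp
    moreover have "(a * c + t * d) / c = a + r * d / w" if "c \<noteq> 0" "t / c = r / w" for a c t d r w :: real
    proof -
      have "(a * c + t * d) / c = a + (t / c) * d" using that(1) by (simp add: add_divide_distrib)
      then show ?thesis unfolding that(2) by simp
    qed
    ultimately show ?thesis by blast
  qed
  finally show ?thesis using l by (simp add: lin_def)
qed

lemma spray_in:
  assumes j: "j < k" and y: "y \<in> Y" and v: "\<forall>l<m. \<bar>v l\<bar> \<le> 1"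
  shows "spray j y v \<in> Y"
proof (cases "Q j y = 0")
  case False
  then have "Q j (lin m y ((Q j y)\<^sup>2 * scale j y) v) \<noteq> 0"
    using Q_spray[OF j v, where y = y] by auto
  from retraction_in[OF j this] False show ?thesis by (simp add: spray_def Let_def)
qed (simp add: spray_def y)

lemma spray_zero:
  assumes j: "j < k" and y: "y \<in> Y" and v: "\<forall>l<m. v l = 0"
  shows "spray j y v = y"
proof (cases "Q j y = 0")
  case False
  have "lin m y ((Q j y)\<^sup>2 * scale j y) v = y"
    using v Y_space[OF y] by (auto simp: lin_def)
  then show ?thesis
    using False Y_space[OF y] P_on[OF j _ y] by (auto simp: spray_def Let_def)
qed (simp add: spray_def)

lemma scale_algebra:
  assumes "function_algebra D A" and j: "j < k"
    and y: "\<And>l. l < m \<Longrightarrow> (\<lambda>x. y x l) \<in> A"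
  shows "(\<lambda>x. scale j (y x)) \<in> A"
proof -
  interpret function_algebra D A by fact
  have "(\<lambda>x. (Q j (y x))\<^sup>2) \<in> A" by (rule power[OF polys[OF Q_polys[OF j] y]])
  note jn = join[OF y const[of 1] this]
  have "(\<lambda>x. 1 + majorant (2 * m + 1) (\<lambda>x. Q j x * diffquot m (Q j) x)
      (join m (y x) (\<lambda>_. 1) ((Q j (y x))\<^sup>2))) \<in> A"
    by (rule add[OF const polys[OF majorant(1)[OF majorant_polys[OF j]] jn]]) 
  from divide[OF const[of 1] this] show ?thesis
    unfolding scale_def using majorant_nonneg[OF j] by (smt (verit))
qed

text \<open>The case distinction in \<open>spray\<close> cannot be formed inside \<open>A\<close>;
  the expression of \<open>spray_formula\<close> can, and it agrees with the spray on
  \<open>D\<close>.\<close>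

lemma spray_algebra:
  assumes "function_algebra D A" and j: "j < k"
    and y: "\<And>l. l < m \<Longrightarrow> (\<lambda>x. y x l) \<in> A" "\<And>x. x \<in> D \<Longrightarrow> y x \<in> Y"
    and v: "\<And>l. l < m \<Longrightarrow> (\<lambda>x. v x l) \<in> A" "\<And>x. x \<in> D \<Longrightarrow> \<forall>l<m. \<bar>v x l\<bar> \<le> 1"
    and l: "l < m"
  shows "(\<lambda>x. spray j (y x) (v x) l) \<in> A"
proof -
  interpret function_algebra D A by fact
  note sc = scale_algebra[OF assms(1) j y(1)]
  note Qy = polys[OF Q_polys[OF j] y(1)]
  define \<tau> where "\<tau> x = (Q j (y x))\<^sup>2 * scale j (y x)" for x
  have \<tau>: "\<tau> \<in> A" unfolding \<tau>_def by (rule mult[OF power[OF Qy] sc])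
  note jn = join[OF y(1) v(1) \<tau>]
  note dN = polys[OF diffquot(1)[OF N_polys[OF j l]] jn]
  note dQ = polys[OF diffquot(1)[OF Q_polys[OF j]] jn]
  have "(\<lambda>x. y x l + \<tau> x * v x l + Q j (y x) * scale j (y x) * diffquot m (N j l) (join m (y x) (v x) (\<tau> x)) /
    (1 + Q j (y x) * scale j (y x) * diffquot m (Q j) (join m (y x) (v x) (\<tau> x)))) \<in> A"
  proof (rule add[OF add[OF y(1)[OF l] mult[OF \<tau> v(1)[OF l]]]
        divide[OF mult[OF mult[OF Qy sc] dN] add[OF const mult[OF mult[OF Qy sc] dQ]]]])
    fix x assume x: "x \<in> D"
    show "1 + Q j (y x) * scale j (y x) * diffquot m (Q j) (join m (y x) (v x) (\<tau> x)) \<noteq> 0"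
      using Q_spray(2)[OF j v(2)[OF x], where y = "y x"] unfolding \<tau>_def by simp
  qed
  then show ?thesis
  proof (rule cong)
    fix x assume x: "x \<in> D"
    show "y x l + \<tau> x * v x l + Q j (y x) * scale j (y x) * diffquot m (N j l) (join m (y x) (v x) (\<tau> x)) /
        (1 + Q j (y x) * scale j (y x) * diffquot m (Q j) (join m (y x) (v x) (\<tau> x)))
      = spray j (y x) (v x) l"
      unfolding \<tau>_def by (rule spray_formula[OF j y(2)[OF x] v(2)[OF x] l, symmetric])
  qed
qed

section \<open>The composed spray\<close>

primrec sprays :: "nat \<Rightarrow> (nat \<Rightarrow> real) \<Rightarrow> (nat \<Rightarrow> nat \<Rightarrow> real) \<Rightarrow> nat \<Rightarrow> real" where
  "sprays 0 y v = y"
| "sprays (Suc j) y v = spray j (sprays j y v) (v j)"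

lemma sprays_in:
  assumes "j \<le> k" "y \<in> Y" "\<And>i l. i < j \<Longrightarrow> l < m \<Longrightarrow> \<bar>v i l\<bar> \<le> 1"
  shows "sprays j y v \<in> Y"
  using assms by (induction j) (auto intro: spray_in)

lemma sprays_zero:
  assumes "j \<le> k" "y \<in> Y" "\<And>i l. i < j \<Longrightarrow> l < m \<Longrightarrow> v i l = 0"
  shows "sprays j y v = y"
  using assms by (induction j) (auto intro: spray_zero)

lemma sprays_algebra:
  assumes A: "function_algebra D A" and "j \<le> k"
    and y: "\<And>l. l < m \<Longrightarrow> (\<lambda>x. y x l) \<in> A" "\<And>x. x \<in> D \<Longrightarrow> y x \<in> Y"
    and "\<And>i l. i < j \<Longrightarrow> l < m \<Longrightarrow> (\<lambda>x. v x i l) \<in> A"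
    and "\<And>x i l. x \<in> D \<Longrightarrow> i < j \<Longrightarrow> l < m \<Longrightarrow> \<bar>v x i l\<bar> \<le> 1"
    and "l < m"
  shows "(\<lambda>x. sprays j (y x) (v x) l) \<in> A"
  using assms(2,5-)
proof (induction j arbitrary: l)
  case 0
  then show ?case by (simp add: y)
next
  case (Suc j)
  have "sprays j (y x) (v x) \<in> Y" if "x \<in> D" for x
    using Suc.prems that by (intro sprays_in y) auto
  then show ?case
    using Suc by (simp, intro spray_algebra[OF A]) auto
qed

end

text \<open>No point of the real line is isolated, so \<open>h a\<close> is a limit of zeros. This
  serves to reach \<mu> = 0 in identities obtained by cancelling \<mu>.\<close>

lemma continuous_on_zero_extend:
  fixes h :: "real \<Rightarrow> real"
  assumes "open U" "a \<in> U" "continuous_on U h" "\<And>x. x \<in> U \<Longrightarrow> x \<noteq> a \<Longrightarrow> h x = 0"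
  shows "h a = 0"
proof -
  have "isCont h a" using assms continuous_on_eq_continuous_at by blast
  then have "(h \<longlongrightarrow> h a) (at a)" by (simp add: isCont_def)
  moreover have "\<forall>\<^sub>F x in at a. h x = 0"
    unfolding eventually_at_topological using assms by blast
  then have "(h \<longlongrightarrow> 0) (at a)" by (rule tendsto_eventually)
  ultimately show ?thesis by (rule tendsto_unique[OF trivial_limit_at])
qed

section \<open>Exact connection of nearby points\<close>

context retraction_charts
begin

text \<open>Positive for \<open>j = 0\<close> exactly when some chart is defined at
  \<open>z\<close>, and an empty sum for \<open>j = k\<close>, which is why the last position is
  \<open>z\<close> itself.\<close>

definition tail :: "nat \<Rightarrow> (nat \<Rightarrow> real) \<Rightarrow> real" where
  "tail j z = (\<Sum>i=j..<k. (Q i z)\<^sup>2)"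

text \<open>The \<open>correction\<close> is chosen so that \<open>(Q j p)\<^sup>2 + tail (Suc j) z = tail j z * (1 + correction j z b \<nu>)\<close>
  for \<open>p = z + \<nu> * tail j z * b\<close>.\<close>

definition correction :: "nat \<Rightarrow> (nat \<Rightarrow> real) \<Rightarrow> (nat \<Rightarrow> real) \<Rightarrow> real \<Rightarrow> real" where
  "correction j z b \<nu> = (let \<theta> = diffquot m (Q j) (join m z b (\<nu> * tail j z)) in
     \<nu> * (2 * Q j z * \<theta> + \<nu> * tail j z * \<theta>\<^sup>2))"

definition next_weight :: "nat \<Rightarrow> (nat \<Rightarrow> real) \<Rightarrow> (nat \<Rightarrow> real) \<Rightarrow> real \<Rightarrow> real" where
  "next_weight j z b \<nu> = \<nu> / (1 + correction j z b \<nu>)"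

text \<open>Scaled by \<open>(Q j p)\<^sup>2 * scale j p\<close>, as in the spray, this vector
  becomes \<open>- \<nu>' (Q j p)\<^sup>2 b\<close> with \<nu>' the next weight: the summand of
  \<open>\<mu> b\<close> to be removed at this step.\<close>

definition move :: "nat \<Rightarrow> (nat \<Rightarrow> real) \<Rightarrow> (nat \<Rightarrow> real) \<Rightarrow> (nat \<Rightarrow> real) \<Rightarrow> real \<Rightarrow> nat \<Rightarrow> real" where
  "move j z p b \<nu> = (\<lambda>l. - next_weight j z b \<nu> * b l / scale j p)"

text \<open>The retraction sends \<open>z + \<mu> b\<close> to \<open>z + \<mu> b'\<close> with this
  new direction \<open>b'\<close>, see \<open>retraction_lin\<close>. For \<open>Q j p = 0\<close>
  the spray is the identity and the direction is kept.\<close>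

definition next_direction :: "nat \<Rightarrow> (nat \<Rightarrow> real) \<Rightarrow> (nat \<Rightarrow> real) \<Rightarrow> (nat \<Rightarrow> real) \<Rightarrow> real \<Rightarrow> nat \<Rightarrow> real" where
  "next_direction j z p b \<nu> = (let \<mu> = next_weight j z b \<nu> * tail (Suc j) z in
     (\<lambda>l. if Q j p = 0 then b l
        else b l + diffquot m (N j l) (join m z b \<mu>) / Q j (lin m z \<mu> b)))"

text \<open>Put \<open>\<mu> = \<nu> * tail j z\<close>. If \<open>\<mu> \<noteq> 0\<close>, the last condition follows from \<open>z + \<mu> b \<in> Y\<close>; if \<open>\<mu> = 0\<close>, it
  expresses that \<open>b\<close> is tangent to \<open>Y\<close> at \<open>z\<close>.\<close>

definition invariant :: "nat \<Rightarrow> (nat \<Rightarrow> real) \<Rightarrow> (nat \<Rightarrow> real) \<Rightarrow> (nat \<Rightarrow> real) \<Rightarrow> real \<Rightarrow> bool" where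
  "invariant j z p b \<nu> \<longleftrightarrow> z \<in> Y \<and> p \<in> Y \<and> p = lin m z (\<nu> * tail j z) b \<and>
     (\<forall>i<k. \<forall>l<m. diffquot m (N i l) (join m z b (\<nu> * tail j z)) = 0)"

text \<open>Strict inequalities, so that the condition is open; the second one puts the move into
  the cube on which the sprays are controlled.\<close>

definition admissible :: "nat \<Rightarrow> (nat \<Rightarrow> real) \<Rightarrow> (nat \<Rightarrow> real) \<Rightarrow> (nat \<Rightarrow> real) \<Rightarrow> real \<Rightarrow> bool" where
  "admissible j z p b \<nu> \<longleftrightarrow> 0 < 1 + correction j z b \<nu> \<and> (\<forall>l<m. \<bar>move j z p b \<nu> l\<bar> < 1)"

section \<open>One step of the connection\<close>

lemma tail_Suc: "j < k \<Longrightarrow> tail j z = (Q j z)\<^sup>2 + tail (Suc j) z"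
  unfolding tail_def by (rule sum.atLeast_Suc_lessThan)

text \<open>Squaring \<open>Q j p = Q j z + \<nu> * tail j z * \<theta>\<close> turns
  \<open>(Q j p)\<^sup>2 + tail (Suc j) z\<close> into
  \<open>tail j z * (1 + correction j z b \<nu>)\<close>, and the next weight is \<nu> divided by
  the last factor.\<close>

lemma weight_step:
  assumes j: "j < k" and inv: "invariant j z p b \<nu>" and adm: "admissible j z p b \<nu>"
  shows "next_weight j z b \<nu> * tail (Suc j) z = \<nu> * tail j z - next_weight j z b \<nu> * (Q j p)\<^sup>2"
proof -
  define \<theta> where "\<theta> = diffquot m (Q j) (join m z b (\<nu> * tail j z))"
  have p: "p = lin m z (\<nu> * tail j z) b" using inv by (simp add: invariant_def)
  have "Q j p = Q j z + \<nu> * tail j z * \<theta>"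
    unfolding p diffquot(2)[OF Q_polys[OF j]] \<theta>_def ..
  then have "(Q j p)\<^sup>2 + tail (Suc j) z = tail j z * (1 + correction j z b \<nu>)"
    unfolding correction_def \<theta>_def[symmetric] Let_def
    using tail_Suc[OF j, of z] by (simp add: power2_eq_square algebra_simps)
  moreover have "1 + correction j z b \<nu> \<noteq> 0" using adm by (simp add: admissible_def)
  ultimately have "next_weight j z b \<nu> * ((Q j p)\<^sup>2 + tail (Suc j) z) = \<nu> * tail j z"
    unfolding next_weight_def by simp
  then show ?thesis by (simp add: algebra_simps)
qed

text \<open>The move cancels a summand of \<mu> and nothing else, so the retraction inside the spray
  is applied to a point on the same line through \<open>z\<close> in direction
  \<open>b\<close>.\<close>

lemma lin_step:
  assumes j: "j < k" and inv: "invariant j z p b \<nu>" and adm: "admissible j z p b \<nu>"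
  shows "lin m p ((Q j p)\<^sup>2 * scale j p) (move j z p b \<nu>)
    = lin m z (next_weight j z b \<nu> * tail (Suc j) z) b"
proof
  fix l
  have c: "scale j p \<noteq> 0" using scale_pos[OF j, of p] by simp
  have "p l = z l + \<nu> * tail j z * b l" if "l < m"
    using inv that unfolding invariant_def by (metis lin_def)
  then show "lin m p ((Q j p)\<^sup>2 * scale j p) (move j z p b \<nu>) l
    = lin m z (next_weight j z b \<nu> * tail (Suc j) z) b l"
    unfolding lin_def weight_step[OF assms] move_def using c by (simp add: algebra_simps)
qed

lemma admissible_le: "admissible j z p b \<nu> \<Longrightarrow> \<forall>l<m. \<bar>move j z p b \<nu> l\<bar> \<le> 1"
  unfolding admissible_def by (blast intro: less_imp_le)

lemma Q_lin_step:
  assumes j: "j < k" and inv: "invariant j z p b \<nu>" and adm: "admissible j z p b \<nu>"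
  shows "Q j (lin m z (next_weight j z b \<nu> * tail (Suc j) z) b) = Q j p *
    (1 + Q j p * scale j p * diffquot m (Q j) (join m p (move j z p b \<nu>) ((Q j p)\<^sup>2 * scale j p)))"
  using Q_spray(1)[OF j admissible_le[OF adm], of p] unfolding lin_step[OF assms] .

lemma Q_lin_step_nonzero:
  assumes "j < k" "invariant j z p b \<nu>" "admissible j z p b \<nu>" "Q j p \<noteq> 0"
  shows "Q j (lin m z (next_weight j z b \<nu> * tail (Suc j) z) b) \<noteq> 0"
  using Q_lin_step[OF assms(1-3)] Q_spray(2)[OF assms(1) admissible_le[OF assms(3)], of p] assms(4)
  by simp

text \<open>\<open>N j l\<close> vanishes at \<open>z\<close>, so the displacement
  \<open>N j l / Q j\<close> at \<open>z + \<mu> b\<close> is a multiple of \<mu> and can be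
  absorbed into the direction.\<close>

lemma retraction_lin:
  assumes j: "j < k" and z: "z \<in> Y" and nz: "Q j (lin m z \<mu> b) \<noteq> 0"
  shows "(\<lambda>l. if l < m then P j l (lin m z \<mu> b) / Q j (lin m z \<mu> b) else 0)
    = lin m z \<mu> (\<lambda>l. b l + diffquot m (N j l) (join m z b \<mu>) / Q j (lin m z \<mu> b))"
proof
  fix l
  let ?u = "lin m z \<mu> b"
  show "(if l < m then P j l ?u / Q j ?u else 0)
    = lin m z \<mu> (\<lambda>l. b l + diffquot m (N j l) (join m z b \<mu>) / Q j ?u) l"
  proof (cases "l < m")
    case True
    have "N j l ?u = \<mu> * diffquot m (N j l) (join m z b \<mu>)"
      unfolding diffquot(2)[OF N_polys[OF j True]] using N_zero[OF j True z] by simp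
    moreover have "P j l ?u = ?u l * Q j ?u + N j l ?u" by (simp add: N_def)
    ultimately have "P j l ?u / Q j ?u = ?u l + \<mu> * (diffquot m (N j l) (join m z b \<mu>) / Q j ?u)"
      using nz by (simp add: add_divide_distrib)
    moreover have "?u l = z l + \<mu> * b l" using True by (simp add: lin_def)
    ultimately show ?thesis using True by (simp add: lin_def[of m z \<mu> "\<lambda>l. _ l + _ l"] distrib_left)
  qed (simp add: lin_def)
qed

lemma spray_step:
  assumes j: "j < k" and inv: "invariant j z p b \<nu>" and adm: "admissible j z p b \<nu>"
  shows "spray j p (move j z p b \<nu>)
    = lin m z (next_weight j z b \<nu> * tail (Suc j) z) (next_direction j z p b \<nu>)"
proof (cases "Q j p = 0")
  case True
  \<comment> \<open>Weight and tail may both change, but their product \<mu> does not.\<close>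
  then have "next_weight j z b \<nu> * tail (Suc j) z = \<nu> * tail j z"
    using weight_step[OF assms] by simp
  moreover have "next_direction j z p b \<nu> = b" using True by (simp add: next_direction_def)
  moreover have "p = lin m z (\<nu> * tail j z) b" using inv by (simp add: invariant_def)
  ultimately show ?thesis using True unfolding spray_def by simp
next
  case False
  have z: "z \<in> Y" using inv by (simp add: invariant_def)
  show ?thesis
    using False retraction_lin[OF j z Q_lin_step_nonzero[OF assms False]]
    by (simp add: spray_def lin_step[OF assms] next_direction_def Let_def)
qed

text \<open>Let \<mu> vary with \<open>z\<close> and \<open>b\<close> fixed. For \<mu> \<noteq> 0
  the retracted point lies in \<open>Y\<close>, where \<open>N i l\<close> vanishes, and \<mu> can
  be cancelled. Everything is continuous in \<mu> on the open set where \<open>Q j\<close> is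
  nonzero, so the identity extends to \<mu> = 0, where it expresses tangency of the new
  direction.\<close>

lemma diffquot_retraction_zero:
  assumes j: "j < k" and z: "z \<in> Y" and nz: "Q j (lin m z \<mu> b) \<noteq> 0" and i: "i < k" and l: "l < m"
  shows "diffquot m (N i l) (join m z
    (\<lambda>l. b l + diffquot m (N j l) (join m z b \<mu>) / Q j (lin m z \<mu> b)) \<mu>) = 0"
proof -
  define b' where "b' \<mu> = (\<lambda>l. b l + diffquot m (N j l) (join m z b \<mu>) / Q j (lin m z \<mu> b))" for \<mu>
  define h where "h \<mu> = diffquot m (N i l) (join m z (b' \<mu>) \<mu>)" for \<mu>
  define U where "U = {\<mu>. Q j (lin m z \<mu> b) \<noteq> 0}"
  have zero: "h \<mu> = 0" if "\<mu> \<in> U" "\<mu> \<noteq> 0" for \<mu>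
  proof -
    have nz: "Q j (lin m z \<mu> b) \<noteq> 0" using that by (simp add: U_def)
    have "lin m z \<mu> (b' \<mu>) \<in> Y"
      unfolding b'_def retraction_lin[OF j z nz, symmetric] by (rule retraction_in[OF j nz])
    then have "\<mu> * h \<mu> = 0"
      using diffquot(2)[OF N_polys[OF i l], of z \<mu> "b' \<mu>"] N_zero[OF i l] z by (simp add: h_def)
    with \<open>\<mu> \<noteq> 0\<close> show ?thesis by simp
  qed
  have Q: "continuous_on UNIV (\<lambda>\<mu>. Q j (lin m z \<mu> b))"
  proof -
    interpret function_algebra "UNIV :: real set" "{f. continuous_on UNIV f}"
      by (rule function_algebra_continuous)
    have "(\<lambda>\<mu>. Q j (lin m z \<mu> b)) \<in> {f. continuous_on UNIV f}"
      by (intro polys[OF Q_polys[OF j]] lin const) simp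
    then show ?thesis by simp
  qed
  have U: "open U" unfolding U_def by (rule open_Collect_neq[OF Q continuous_on_const])
  have "continuous_on U h"
  proof -
    interpret function_algebra U "{f. continuous_on U f}"
      by (rule function_algebra_continuous)
    have id: "(\<lambda>\<mu>. \<mu>) \<in> {f. continuous_on U f}" by simp
    have dN: "diffquot m (N i l) \<in> polys (2 * m + 1)" if "i < k" "l < m" for i l
      by (rule diffquot(1)[OF N_polys[OF that]])
    have b': "(\<lambda>\<mu>. b' \<mu> l) \<in> {f. continuous_on U f}" if "l < m" for l
      unfolding b'_def
    proof (rule add[OF const divide])
      show "(\<lambda>\<mu>. diffquot m (N j l) (join m z b \<mu>)) \<in> {f. continuous_on U f}"
        by (intro polys[OF dN[OF j that]] join const id)
      show "(\<lambda>\<mu>. Q j (lin m z \<mu> b)) \<in> {f. continuous_on U f}"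
        by (intro polys[OF Q_polys[OF j]] lin const id)
    qed (simp add: U_def)
    have "h \<in> {f. continuous_on U f}"
      unfolding h_def by (intro polys[OF dN[OF i l]] join const id b')
    then show ?thesis by simp
  qed
  moreover have "\<mu> \<in> U" using nz by (simp add: U_def)
  ultimately have "h \<mu> = 0"
    using zero continuous_on_zero_extend[OF U, of 0 h] by (cases "\<mu> = 0") auto
  then show ?thesis by (simp add: h_def b'_def)
qed

lemma invariant_step:
  assumes j: "j < k" and inv: "invariant j z p b \<nu>" and adm: "admissible j z p b \<nu>"
  shows "invariant (Suc j) z (spray j p (move j z p b \<nu>)) (next_direction j z p b \<nu>) (next_weight j z b \<nu>)"
proof -
  have z: "z \<in> Y" and p: "p \<in> Y" using inv unfolding invariant_def by blast+
  have "diffquot m (N i l) (join m z (next_direction j z p b \<nu>)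
      (next_weight j z b \<nu> * tail (Suc j) z)) = 0" if il: "i < k" "l < m" for i l
  proof (cases "Q j p = 0")
    case True
    then have "next_weight j z b \<nu> * tail (Suc j) z = \<nu> * tail j z"
      using weight_step[OF assms] by simp
    moreover have "next_direction j z p b \<nu> = b" using True by (simp add: next_direction_def)
    ultimately show ?thesis using inv il by (simp add: invariant_def)
  next
    case False
    from diffquot_retraction_zero[OF j z Q_lin_step_nonzero[OF assms False] il] False
    show ?thesis by (simp add: next_direction_def Let_def)
  qed
  then show ?thesis
    unfolding invariant_def
    using z spray_in[OF j p admissible_le[OF adm]] spray_step[OF assms] by blast
qed

section \<open>Rational dependence of one step on its data\<close>

lemma tail_algebra:
  assumes "function_algebra D A" and z: "\<And>l. l < m \<Longrightarrow> (\<lambda>x. z x l) \<in> A"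
  shows "(\<lambda>x. tail j (z x)) \<in> A"
proof -
  interpret function_algebra D A by fact
  show ?thesis
    unfolding tail_def by (intro sum power polys[OF Q_polys] z) simp
qed

lemma correction_algebra:
  assumes "function_algebra D A" and j: "j < k" and z: "\<And>l. l < m \<Longrightarrow> (\<lambda>x. z x l) \<in> A"
    and b: "\<And>l. l < m \<Longrightarrow> (\<lambda>x. b x l) \<in> A" and \<nu>: "\<nu> \<in> A"
  shows "(\<lambda>x. correction j (z x) (b x) (\<nu> x)) \<in> A"
proof -
  interpret function_algebra D A by fact
  note t = tail_algebra[OF assms(1) z]
  note \<theta> = polys[OF diffquot(1)[OF Q_polys[OF j]] join[OF z b mult[OF \<nu> t]]]
  show ?thesis
    unfolding correction_def Let_def
    by (intro mult[OF \<nu>] add mult power const t \<theta> \<nu> polys[OF Q_polys[OF j] z])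
qed

lemma weight_algebra:
  assumes "function_algebra D A" and j: "j < k" and z: "\<And>l. l < m \<Longrightarrow> (\<lambda>x. z x l) \<in> A"
    and b: "\<And>l. l < m \<Longrightarrow> (\<lambda>x. b x l) \<in> A" and \<nu>: "\<nu> \<in> A"
    and nz: "\<And>x. x \<in> D \<Longrightarrow> 1 + correction j (z x) (b x) (\<nu> x) \<noteq> 0"
  shows "(\<lambda>x. next_weight j (z x) (b x) (\<nu> x)) \<in> A"
proof -
  interpret function_algebra D A by fact
  show ?thesis
    unfolding next_weight_def
    by (rule divide[OF \<nu> add[OF const correction_algebra[OF assms(1) j z b \<nu>]] nz])
qed

lemma move_algebra:
  assumes "function_algebra D A" and j: "j < k" and z: "\<And>l. l < m \<Longrightarrow> (\<lambda>x. z x l) \<in> A"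
    and p: "\<And>l. l < m \<Longrightarrow> (\<lambda>x. p x l) \<in> A"
    and b: "\<And>l. l < m \<Longrightarrow> (\<lambda>x. b x l) \<in> A" and \<nu>: "\<nu> \<in> A"
    and nz: "\<And>x. x \<in> D \<Longrightarrow> 1 + correction j (z x) (b x) (\<nu> x) \<noteq> 0" and l: "l < m"
  shows "(\<lambda>x. move j (z x) (p x) (b x) (\<nu> x) l) \<in> A"
proof -
  interpret function_algebra D A by fact
  show ?thesis
    unfolding move_def
  proof (rule divide[OF mult[OF uminus[OF weight_algebra[OF assms(1) j z b \<nu> nz]] b[OF l]]
      scale_algebra[OF assms(1) j p]])
    show "scale j (p x) \<noteq> 0" for x using scale_pos[OF j, of "p x"] by simp
  qed
qed

text \<open>The denominator in \<open>next_direction\<close> has the possibly vanishing factor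
  \<open>Q j p\<close>. The numerator is a value of \<open>diffquot m (N j l)\<close> which, by the
  invariant, would be zero for the old \<mu>. Old and new \<mu> differ by a multiple of
  \<open>(Q j p)\<^sup>2\<close>, so a second difference quotient, in \<mu> alone, exhibits this
  factor and the pole cancels. This is the purpose of the last clause of
  \<open>invariant\<close>.\<close>

lemma direction_formula:
  assumes j: "j < k" and inv: "invariant j z p b \<nu>" and adm: "admissible j z p b \<nu>" and l: "l < m"
  shows "next_direction j z p b \<nu> l = b l - next_weight j z b \<nu> * Q j p *
    diffquot (2 * m + 1) (diffquot m (N j l)) (join (2 * m + 1) (join m z b (\<nu> * tail j z))
      (\<lambda>i. if i = 2 * m then 1 else 0) (- next_weight j z b \<nu> * (Q j p)\<^sup>2)) /
    (1 + Q j p * scale j p * diffquot m (Q j) (join m p (move j z p b \<nu>) ((Q j p)\<^sup>2 * scale j p)))"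
    (is "_ = _ - _ * ?D / ?w")
proof (cases "Q j p = 0")
  case True
  then show ?thesis by (simp add: next_direction_def)
next
  case False
  let ?\<mu> = "next_weight j z b \<nu> * tail (Suc j) z" and ?n = "next_weight j z b \<nu>"
  \<comment> \<open>Index \<open>2 * m\<close> is the place of the step length in
    \<open>join m\<close>, so \<open>?e\<close> varies \<mu> and leaves \<open>z\<close> and
    \<open>b\<close> fixed.\<close>
  let ?e = "\<lambda>i. if i = 2 * m then 1 else (0::real)" and ?d = "- ?n * (Q j p)\<^sup>2"
  have dN: "diffquot m (N j l) \<in> polys (2 * m + 1)" by (rule diffquot(1)[OF N_polys[OF j l]])
  have "diffquot m (N j l) (join m z b ?\<mu>)
      = diffquot m (N j l) (lin (2 * m + 1) (join m z b (\<nu> * tail j z)) ?d ?e)"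
    by (rule polys_cong[OF dN]) (auto simp: lin_def join_def weight_step[OF j inv adm])
  also have "\<dots> = diffquot m (N j l) (join m z b (\<nu> * tail j z)) + ?d * ?D"
    by (rule diffquot(2)[OF dN])
  also have "diffquot m (N j l) (join m z b (\<nu> * tail j z)) = 0"
    using inv j l by (simp add: invariant_def)
  finally have "diffquot m (N j l) (join m z b ?\<mu>) / Q j (lin m z ?\<mu> b) = - ?n * (Q j p)\<^sup>2 * ?D / (Q j p * ?w)"
    unfolding Q_lin_step[OF j inv adm] by simp
  also have "\<dots> = - (?n * Q j p * ?D / ?w)"
  proof -
    have "- a * s\<^sup>2 * c / (s * w) = - (a * s * c / w)" if "s \<noteq> 0" for a s c w :: real
      using that by (simp add: power2_eq_square)
    from this[OF False] show ?thesis .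
  qed
  finally show ?thesis using False by (simp add: next_direction_def Let_def)
qed

lemma direction_algebra:
  assumes "function_algebra D A" and j: "j < k" and z: "\<And>l. l < m \<Longrightarrow> (\<lambda>x. z x l) \<in> A"
    and p: "\<And>l. l < m \<Longrightarrow> (\<lambda>x. p x l) \<in> A"
    and b: "\<And>l. l < m \<Longrightarrow> (\<lambda>x. b x l) \<in> A" and \<nu>: "\<nu> \<in> A"
    and inv: "\<And>x. x \<in> D \<Longrightarrow> invariant j (z x) (p x) (b x) (\<nu> x)"
    and adm: "\<And>x. x \<in> D \<Longrightarrow> admissible j (z x) (p x) (b x) (\<nu> x)" and l: "l < m"
  shows "(\<lambda>x. next_direction j (z x) (p x) (b x) (\<nu> x) l) \<in> A"
proof -
  interpret function_algebra D A by fact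
  have nz: "1 + correction j (z x) (b x) (\<nu> x) \<noteq> 0" if "x \<in> D" for x
    using adm[OF that] by (simp add: admissible_def)
  note t = tail_algebra[OF assms(1) z] and w = weight_algebra[OF assms(1) j z b \<nu> nz]
    and mv = move_algebra[OF assms(1) j z p b \<nu> nz] and sc = scale_algebra[OF assms(1) j p]
    and Qp = polys[OF Q_polys[OF j] p]
  have dN: "diffquot m (N j l) \<in> polys (2 * m + 1)" by (rule diffquot(1)[OF N_polys[OF j l]])
  note dd = polys[OF diffquot(1)[OF dN] join[OF join[OF z b mult[OF \<nu> t]]
      const[of "if i = 2 * m then 1 else 0" for i] mult[OF uminus[OF w] power[OF Qp]]]]
  note dQ = polys[OF diffquot(1)[OF Q_polys[OF j]] join[OF p mv mult[OF power[OF Qp] sc]]]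
  show ?thesis
  proof (rule cong[OF diff[OF b[OF l] divide[OF mult[OF mult[OF w Qp] dd]
          add[OF const mult[OF mult[OF Qp sc] dQ]]]]])
    fix x assume x: "x \<in> D"
    note direction_formula[OF j inv[OF x] adm[OF x] l]
    then show "b x l - next_weight j (z x) (b x) (\<nu> x) * Q j (p x) *
        diffquot (2 * m + 1) (diffquot m (N j l)) (join (2 * m + 1) (join m (z x) (b x) (\<nu> x * tail j (z x)))
          (\<lambda>i. if i = 2 * m then 1 else 0) (- next_weight j (z x) (b x) (\<nu> x) * (Q j (p x))\<^sup>2)) /
        (1 + Q j (p x) * scale j (p x) * diffquot m (Q j) (join m (p x) (move j (z x) (p x) (b x) (\<nu> x)) ((Q j (p x))\<^sup>2 * scale j (p x))))
      = next_direction j (z x) (p x) (b x) (\<nu> x) l" by (rule sym)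
    show "1 + Q j (p x) * scale j (p x) * diffquot m (Q j) (join m (p x) (move j (z x) (p x) (b x) (\<nu> x)) ((Q j (p x))\<^sup>2 * scale j (p x))) \<noteq> 0"
      using Q_spray(2)[OF j admissible_le[OF adm[OF x]], of "p x"] by simp
  qed
qed

text \<open>Difference quotients vanish in direction zero, hence so do the correction, the move and
  the change of direction.\<close>

lemma diagonal_step:
  assumes j: "j < k" and b: "\<forall>l<m. b l = 0"
  shows "admissible j z p b \<nu>" "\<forall>l<m. next_direction j z p b \<nu> l = 0"
proof -
  have "diffquot m (Q j) (join m z b \<mu>) = 0" for \<mu> using b by (intro diffquot(3)[OF Q_polys[OF j]]) simp
  then show "admissible j z p b \<nu>"
    using b by (simp add: admissible_def correction_def move_def)
  have "diffquot m (N j l) (join m z b \<mu>) = 0" if "l < m" for \<mu> l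
    using b by (intro diffquot(3)[OF N_polys[OF j that]]) simp
  then show "\<forall>l<m. next_direction j z p b \<nu> l = 0"
    using b by (simp add: next_direction_def Let_def)
qed

end

section \<open>The iterated construction and its open domain\<close>

lemma openin_Collect_less:
  fixes f :: "'a::topological_space \<Rightarrow> real"
  assumes "continuous_on D f"
  shows "openin (top_of_set D) {x\<in>D. f x < c}"
proof -
  have "{x\<in>D. f x < c} = D \<inter> f -` {..<c}" by auto
  with continuous_openin_preimage_gen[OF assms open_lessThan] show ?thesis by simp
qed

lemma openin_Collect_all_less:
  assumes "\<And>l. l < n \<Longrightarrow> openin (top_of_set D) {x\<in>D. R l x}"
  shows "openin (top_of_set D) {x\<in>D. \<forall>l<(n::nat). R l x}"
  using assms
proof (induction n)
  case (Suc n)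
  have "{x\<in>D. \<forall>l<Suc n. R l x} = {x\<in>D. \<forall>l<n. R l x} \<inter> {x\<in>D. R n x}"
    by (auto simp: less_Suc_eq)
  then show ?case using Suc by auto
qed simp

context retraction_charts
begin

text \<open>The components are position, direction and weight. The start is
  \<open>y = z + 1 * (y - z)\<close>, that is \<mu> = 1, whence the weight
  \<open>1 / tail 0 z\<close>.\<close>

primrec state :: "(nat \<Rightarrow> real) \<Rightarrow> (nat \<Rightarrow> real) \<Rightarrow> nat \<Rightarrow> (nat \<Rightarrow> real) \<times> (nat \<Rightarrow> real) \<times> real" where
  "state y z 0 = (y, (\<lambda>l. y l - z l), 1 / tail 0 z)"
| "state y z (Suc j) = (let (p, b, \<nu>) = state y z j in
     (spray j p (move j z p b \<nu>), next_direction j z p b \<nu>, next_weight j z b \<nu>))"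

definition position :: "nat \<Rightarrow> (nat \<Rightarrow> real) \<Rightarrow> (nat \<Rightarrow> real) \<Rightarrow> nat \<Rightarrow> real" where
  "position j y z = fst (state y z j)"

definition direction :: "nat \<Rightarrow> (nat \<Rightarrow> real) \<Rightarrow> (nat \<Rightarrow> real) \<Rightarrow> nat \<Rightarrow> real" where
  "direction j y z = fst (snd (state y z j))"

definition weight :: "nat \<Rightarrow> (nat \<Rightarrow> real) \<Rightarrow> (nat \<Rightarrow> real) \<Rightarrow> real" where
  "weight j y z = snd (snd (state y z j))"

definition connector :: "(nat \<Rightarrow> real) \<Rightarrow> (nat \<Rightarrow> real) \<Rightarrow> nat \<Rightarrow> nat \<Rightarrow> real" where
  "connector y z j = move j z (position j y z) (direction j y z) (weight j y z)"

text \<open>Only the first \<open>j\<close> steps are constrained, so that regularity of the state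
  and openness of its domain can be proved by induction on \<open>j\<close>.\<close>

definition connectable :: "nat \<Rightarrow> ((nat \<Rightarrow> real) \<times> (nat \<Rightarrow> real)) set" where
  "connectable j = {(y, z). y \<in> Y \<and> z \<in> Y \<and> 0 < tail 0 z \<and>
     (\<forall>i<j. admissible i z (position i y z) (direction i y z) (weight i y z))}"

lemma state_simps:
  "position 0 y z = y" "direction 0 y z = (\<lambda>l. y l - z l)" "weight 0 y z = 1 / tail 0 z"
  "position (Suc j) y z = spray j (position j y z) (connector y z j)"
  "direction (Suc j) y z = next_direction j z (position j y z) (direction j y z) (weight j y z)"
  "weight (Suc j) y z = next_weight j z (direction j y z) (weight j y z)"
  by (simp_all add: position_def direction_def weight_def connector_def Let_def split: prod.split)

lemma position_eq_sprays: "position j y z = sprays j y (connector y z)"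
  by (induction j) (simp_all add: state_simps)

text \<open>At the start \<mu> = 1, so the difference quotients are
  \<open>N i l y - N i l z\<close>, which is zero for two points of \<open>Y\<close>.\<close>

lemma invariant_state:
  assumes "j \<le> k" "(y, z) \<in> connectable j"
  shows "invariant j z (position j y z) (direction j y z) (weight j y z)"
  using assms
proof (induction j)
  case 0
  then have y: "y \<in> Y" and z: "z \<in> Y" and t: "1 / tail 0 z * tail 0 z = 1"
    by (auto simp: connectable_def)
  have eq: "lin m z 1 (\<lambda>l. y l - z l) = y"
    using Y_space[OF y] by (auto simp: lin_def)
  have "diffquot m (N i l) (join m z (\<lambda>l. y l - z l) 1) = 0" if "i < k" "l < m" for i l
    using diffquot(2)[OF N_polys[OF that], of z 1 "\<lambda>l. y l - z l"] N_zero[OF that] y z eq by simp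
  then show ?case unfolding invariant_def state_simps t eq using y z by simp
next
  case (Suc j)
  have j: "j < k" "(y, z) \<in> connectable j" using Suc.prems by (auto simp: connectable_def)
  have "admissible j z (position j y z) (direction j y z) (weight j y z)"
    using Suc.prems by (auto simp: connectable_def)
  from invariant_step[OF j(1) Suc.IH[OF _ j(2)] this] j(1) show ?case
    by (simp add: state_simps connector_def)
qed

lemma connectable_mono: "i \<le> j \<Longrightarrow> connectable j \<subseteq> connectable i"
  by (auto simp: connectable_def)

lemma connectable_admissible:
  "(y, z) \<in> connectable j \<Longrightarrow> i < j \<Longrightarrow> admissible i z (position i y z) (direction i y z) (weight i y z)"
  by (simp add: connectable_def)

lemma connector_small:
  "(y, z) \<in> connectable k \<Longrightarrow> j < k \<Longrightarrow> l < m \<Longrightarrow> \<bar>connector y z j l\<bar> < 1"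
  using connectable_admissible[of y z k j] by (simp add: admissible_def connector_def)

text \<open>\<open>tail k z\<close> is an empty sum, so the invariant places the final position at
  \<open>z + 0 * b\<close>.\<close>

lemma sprays_connector:
  assumes "(y, z) \<in> connectable k"
  shows "sprays k y (connector y z) = z"
proof -
  have "invariant k z (position k y z) (direction k y z) (weight k y z)"
    by (rule invariant_state[OF le_refl assms])
  then have "position k y z = lin m z 0 (direction k y z)" "z \<in> Y"
    by (simp_all add: invariant_def tail_def)
  then have "position k y z = z" using Y_space by (auto simp: lin_def)
  then show ?thesis by (simp add: position_eq_sprays)
qed

lemma state_algebra:
  assumes A: "function_algebra D A" and "j \<le> k"
    and y: "\<And>l. l < m \<Longrightarrow> (\<lambda>x. y x l) \<in> A" and z: "\<And>l. l < m \<Longrightarrow> (\<lambda>x. z x l) \<in> A"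
    and "\<And>x. x \<in> D \<Longrightarrow> (y x, z x) \<in> connectable j"
  shows "(\<forall>l<m. (\<lambda>x. position j (y x) (z x) l) \<in> A) \<and>
    (\<forall>l<m. (\<lambda>x. direction j (y x) (z x) l) \<in> A) \<and> (\<lambda>x. weight j (y x) (z x)) \<in> A"
  using assms(2,5)
proof (induction j)
  case 0
  interpret function_algebra D A by fact
  have "(\<lambda>x. 1 / tail 0 (z x)) \<in> A"
    by (rule divide[OF const tail_algebra[OF A z]]) (use 0 in \<open>force simp: connectable_def\<close>)+
  then show ?case by (simp add: state_simps y z diff)
next
  case (Suc j)
  have j: "j < k" "\<And>x. x \<in> D \<Longrightarrow> (y x, z x) \<in> connectable j"
    using Suc.prems connectable_mono[of j "Suc j"] by auto
  have adm: "admissible j (z x) (position j (y x) (z x)) (direction j (y x) (z x)) (weight j (y x) (z x))"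
    if "x \<in> D" for x using connectable_admissible[OF Suc.prems(2)[OF that]] by simp
  have inv: "invariant j (z x) (position j (y x) (z x)) (direction j (y x) (z x)) (weight j (y x) (z x))"
    if "x \<in> D" for x using invariant_state[OF _ j(2)[OF that]] j(1) by simp
  from Suc.IH j have IH: "\<And>l. l < m \<Longrightarrow> (\<lambda>x. position j (y x) (z x) l) \<in> A"
    "\<And>l. l < m \<Longrightarrow> (\<lambda>x. direction j (y x) (z x) l) \<in> A" "(\<lambda>x. weight j (y x) (z x)) \<in> A" by auto
  have nz: "1 + correction j (z x) (direction j (y x) (z x)) (weight j (y x) (z x)) \<noteq> 0" if "x \<in> D" for x
    using adm[OF that] by (simp add: admissible_def)
  have "(\<lambda>x. spray j (position j (y x) (z x)) (connector (y x) (z x) j) l) \<in> A" if l: "l < m" for l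
  proof (rule spray_algebra[OF A j(1) IH(1) _ _ _ l])
    show "position j (y x) (z x) \<in> Y" if "x \<in> D" for x
      using inv[OF that] unfolding invariant_def by blast
    show "\<forall>l<m. \<bar>connector (y x) (z x) j l\<bar> \<le> 1" if "x \<in> D" for x
      unfolding connector_def by (rule admissible_le[OF adm[OF that]])
    show "(\<lambda>x. connector (y x) (z x) j l) \<in> A" if "l < m" for l
      unfolding connector_def by (rule move_algebra[OF A j(1) z IH nz that])
  qed
  moreover have "(\<lambda>x. next_direction j (z x) (position j (y x) (z x)) (direction j (y x) (z x))
      (weight j (y x) (z x)) l) \<in> A" if l: "l < m" for l
    by (rule direction_algebra[OF A j(1) z IH inv adm l])
  moreover have "(\<lambda>x. next_weight j (z x) (direction j (y x) (z x)) (weight j (y x) (z x))) \<in> A"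
    by (rule weight_algebra[OF A j(1) z IH(2,3) nz])
  ultimately show ?case by (simp add: state_simps)
qed

lemma connector_algebra:
  assumes A: "function_algebra D A" and j: "j < k"
    and y: "\<And>l. l < m \<Longrightarrow> (\<lambda>x. y x l) \<in> A" and z: "\<And>l. l < m \<Longrightarrow> (\<lambda>x. z x l) \<in> A"
    and D: "\<And>x. x \<in> D \<Longrightarrow> (y x, z x) \<in> connectable k" and l: "l < m"
  shows "(\<lambda>x. connector (y x) (z x) j l) \<in> A"
proof -
  have "(y x, z x) \<in> connectable j" if "x \<in> D" for x
    using D[OF that] connectable_mono[of j k] j by auto
  note st = state_algebra[OF A less_imp_le[OF j] y z this]
  have "1 + correction j (z x) (direction j (y x) (z x)) (weight j (y x) (z x)) \<noteq> 0" if "x \<in> D" for x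
    using connectable_admissible[OF D[OF that] j] by (simp add: admissible_def)
  then show ?thesis
    unfolding connector_def using st by (intro move_algebra[OF A j z _ _ _ _ l]) auto
qed

text \<open>The direction starts as \<open>z - z\<close> and stays zero by
  \<open>diagonal_step\<close>, which also makes each step admissible.\<close>

lemma connectable_diagonal:
  assumes "z \<in> Y" "0 < tail 0 z" "j \<le> k"
  shows "(z, z) \<in> connectable j"
proof -
  have dir: "\<forall>l<m. direction i z z l = 0" if "i \<le> k" for i
    using that
  proof (induction i)
    case (Suc i)
    then show ?case unfolding state_simps by (intro diagonal_step(2)) auto
  qed (simp add: state_simps)
  then show ?thesis
    using assms diagonal_step(1) by (auto simp: connectable_def)
qed

lemma openin_connectable:
  assumes "j \<le> k"
  shows "openin (top_of_set (Y \<times> Y)) (connectable j)"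
  using assms
proof (induction j)
  case 0
  have z: "(\<lambda>x. snd x l) \<in> {f. continuous_on (Y \<times> Y) f}" for l :: nat
    by (simp add: continuous_on_product_then_coordinatewise[OF continuous_on_snd[OF continuous_on_id]])
  have "openin (top_of_set (Y \<times> Y)) {x\<in>Y\<times>Y. - tail 0 (snd x) < 0}"
    using tail_algebra[OF function_algebra_continuous z] by (intro openin_Collect_less continuous_on_minus) simp
  moreover have "{x\<in>Y\<times>Y. - tail 0 (snd x) < 0} = connectable 0" by (auto simp: connectable_def)
  ultimately show ?case by simp
next
  case (Suc j)
  then have j: "j < k" and op: "openin (top_of_set (Y \<times> Y)) (connectable j)" by auto
  let ?cor = "\<lambda>x. correction j (snd x) (direction j (fst x) (snd x)) (weight j (fst x) (snd x))"
  let ?mv = "\<lambda>l x. move j (snd x) (position j (fst x) (snd x)) (direction j (fst x) (snd x)) (weight j (fst x) (snd x)) l"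
  \<comment> \<open>The correction is continuous on \<open>connectable j\<close>, but the move
    divides by \<open>1 + correction\<close>. Hence the first inequality is imposed first, and the
    others are examined on the smaller open set.\<close>
  define U where "U = {x\<in>connectable j. - ?cor x < 1}"
  have UD: "U \<subseteq> connectable j" by (auto simp: U_def)
  have yz: "(\<lambda>x. fst x l) \<in> {f. continuous_on D f}" "(\<lambda>x. snd x l) \<in> {f. continuous_on D f}"
    for l :: nat and D :: "((nat \<Rightarrow> real) \<times> (nat \<Rightarrow> real)) set"
    by (simp_all add: continuous_on_product_then_coordinatewise[OF continuous_on_fst[OF continuous_on_id]]
      continuous_on_product_then_coordinatewise[OF continuous_on_snd[OF continuous_on_id]])
  have st: "(\<forall>l<m. (\<lambda>x. position j (fst x) (snd x) l) \<in> {f. continuous_on D f}) \<and>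
      (\<forall>l<m. (\<lambda>x. direction j (fst x) (snd x) l) \<in> {f. continuous_on D f}) \<and>
      (\<lambda>x. weight j (fst x) (snd x)) \<in> {f. continuous_on D f}" if "D \<subseteq> connectable j" for D
    by (rule state_algebra[OF function_algebra_continuous less_imp_le[OF j] yz]) (use that in auto)
  have "?cor \<in> {f. continuous_on (connectable j) f}"
    by (rule correction_algebra[OF function_algebra_continuous j yz(2)]) (use st[OF subset_refl] in blast)+
  then have opU: "openin (top_of_set (connectable j)) U"
    unfolding U_def by (intro openin_Collect_less continuous_on_minus) simp
  have "openin (top_of_set U) {x\<in>U. \<forall>l<m. \<bar>?mv l x\<bar> < 1}"
  proof (intro openin_Collect_all_less openin_Collect_less continuous_on_rabs)
    fix l assume l: "l < m"
    have "?mv l \<in> {f. continuous_on U f}"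
    proof (rule move_algebra[OF function_algebra_continuous j yz(2) _ _ _ _ l])
      show "1 + ?cor x \<noteq> 0" if "x \<in> U" for x using that by (simp add: U_def)
    qed (use st[OF UD] in blast)+
    then show "continuous_on U (?mv l)" by simp
  qed
  then have "openin (top_of_set (Y \<times> Y)) {x\<in>U. \<forall>l<m. \<bar>?mv l x\<bar> < 1}"
    using opU op openin_trans by blast
  moreover have "{x\<in>U. \<forall>l<m. \<bar>?mv l x\<bar> < 1} = connectable (Suc j)"
    by (auto simp: U_def connectable_def admissible_def less_Suc_eq)
  ultimately show ?case by simp
qed

text \<open>The relatively open set \<open>connectable k\<close> contains the compact diagonal over
  \<open>K\<close>, hence a uniform neighbourhood of it. The point \<open>y\<close> ranges over all
  of \<open>Y\<close>, since approximate homotopies leave the track of the given one.\<close>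

lemma connectable_near_compact:
  assumes "compact K" "K \<subseteq> Y" "\<And>z. z \<in> K \<Longrightarrow> 0 < tail 0 z"
  shows "\<exists>\<epsilon>>0. \<forall>y\<in>Y. \<forall>z\<in>K. dist y z < \<epsilon> \<longrightarrow> (y, z) \<in> connectable k"
proof -
  obtain T where T: "open T" "connectable k = (Y \<times> Y) \<inter> T"
    using openin_connectable[OF le_refl] unfolding openin_open by blast
  have "compact ((\<lambda>z. (z, z)) ` K)" (is "compact ?K")
    by (intro compact_continuous_image assms continuous_intros)
  moreover have "?K \<subseteq> T"
  proof
    fix x assume "x \<in> (\<lambda>z. (z, z)) ` K"
    then obtain z where z: "z \<in> K" "x = (z, z)" by blast
    then have "x \<in> connectable k"
      using connectable_diagonal[OF _ _ le_refl, of z] assms(2,3) by auto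
    then show "x \<in> T" unfolding T(2) by blast
  qed
  ultimately obtain \<epsilon> where \<epsilon>: "0 < \<epsilon>" "(\<Union>x\<in>?K. ball x \<epsilon>) \<subseteq> T"
    by (rule compact_subset_open_imp_ball_epsilon_subset[OF _ T(1)])
  show ?thesis
  proof (intro exI[of _ \<epsilon>] conjI ballI impI \<epsilon>(1))
    fix y z assume yz: "y \<in> Y" "z \<in> K" "dist y z < \<epsilon>"
    then have "(y, z) \<in> ball (z, z) \<epsilon>" by (simp add: dist_Pair_Pair dist_commute)
    then have "(y, z) \<in> T" using \<epsilon>(2) yz(2) by blast
    moreover have "z \<in> Y" using yz(2) assms(2) by blast
    ultimately show "(y, z) \<in> connectable k" unfolding T(2) using yz(1) by simp
  qed
qed

end

section \<open>Regular homotopies\<close>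

text \<open>The distance between functions weights the entries by the powers of 1/2 starting with 1,
  and the total weight is 2.\<close>

lemma dist_fun_le_bound:
  fixes a b :: "nat \<Rightarrow> 'b::metric_space"
  assumes "\<And>i. dist (a i) (b i) \<le> e"
  shows "dist a b \<le> 2 * e"
proof -
  let ?f = "\<lambda>n. (1/2)^n * min (dist (a (from_nat n)) (b (from_nat n))) 1 :: real"
  have geo: "(\<lambda>n. (1/2)^n * e) sums (2 * e)"
    using sums_mult2[OF geometric_sums[of "1/2::real"], of e] by simp
  have le: "?f n \<le> (1/2)^n * e" for n
    using assms[of "from_nat n"] by (intro mult_left_mono) (auto simp: min_le_iff_disj)
  have "summable ?f"
    using le by (intro summable_comparison_test'[OF sums_summable[OF geo], of 0]) (simp add: abs_mult)
  from suminf_le[OF le this sums_summable[OF geo]] show ?thesis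
    unfolding dist_fun_def sums_unique[OF geo, symmetric] .
qed

section \<open>Regular functions on a coordinate set and on its product with the line\<close>

lemma regular_functions_continuous:
  assumes "f \<in> regular_functions (\<lambda>x. x) n D"
  shows "continuous_on D f"
proof -
  obtain P Q where PQ: "P \<in> polys n" "Q \<in> polys n" "\<And>x. x \<in> D \<Longrightarrow> Q x \<noteq> 0"
    "\<And>x. x \<in> D \<Longrightarrow> f x = P x / Q x"
    using assms by (rule regular_functionsE) blast
  have "continuous_on D (\<lambda>x. P x / Q x)"
    by (intro continuous_on_divide continuous_on_polys[OF PQ(1)] continuous_on_polys[OF PQ(2)])
      (simp add: PQ(3))
  then show ?thesis by (rule continuous_on_eq) (simp add: PQ(4))
qed

text \<open>Stone-Weierstrass: distinct points of \<open>X\<close> differ in a coordinate below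
  \<open>n\<close>, so the coordinate functions separate them.\<close>

lemma polys_approximation:
  assumes "compact X" "\<And>x i. x \<in> X \<Longrightarrow> n \<le> i \<Longrightarrow> x i = 0" "continuous_on X f" "0 < e"
  shows "\<exists>P\<in>polys n. \<forall>x\<in>X. \<bar>f x - P x\<bar> < e"
proof -
  interpret function_ring_on "polys n" X
  proof
    fix x y assume xy: "x \<in> X" "y \<in> X" "x \<noteq> y"
    then obtain i where "x i \<noteq> y i" by blast
    moreover from this have "i < n" using assms(2) xy by (metis not_less)
    ultimately show "\<exists>f\<in>polys n. f x \<noteq> f y" using polys.var by (intro bexI[of _ "\<lambda>x. x i"])
  qed (auto intro: assms continuous_on_polys polys.add polys.mult polys.const)
  show ?thesis by (rule Stone_Weierstrass_basic[OF assms(3,4)])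
qed

text \<open>The form in which \<open>isomorphism_prod_real_line\<close> embeds the product with the
  line.\<close>

definition snoc :: "nat \<Rightarrow> (nat \<Rightarrow> real) \<times> real \<Rightarrow> nat \<Rightarrow> real" where
  "snoc n = (\<lambda>(x, t). x(n := t))"

lemma regular_functions_fst:
  assumes "f \<in> regular_functions (\<lambda>x. x) n X"
  shows "(\<lambda>p. f (fst p)) \<in> regular_functions (snoc n) (Suc n) (X \<times> T)"
proof -
  obtain P Q where PQ: "P \<in> polys n" "Q \<in> polys n" "\<And>x. x \<in> X \<Longrightarrow> Q x \<noteq> 0"
    "\<And>x. x \<in> X \<Longrightarrow> f x = P x / Q x"
    using assms by (rule regular_functionsE) blast
  show ?thesis
    using PQ(3,4)
    by (intro regular_functionsI[OF polys_update(2)[OF PQ(1)] polys_update(2)[OF PQ(2)]])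
      (auto simp: snoc_def polys_update(1)[OF PQ(1)] polys_update(1)[OF PQ(2)] simp del: fun_upd_apply)
qed

lemma regular_functions_snd: "snd \<in> regular_functions (snoc n) (Suc n) D"
  using regular_functions_polys[OF polys.var[of n "Suc n"], of "snoc n" D]
  by (simp add: snoc_def case_prod_unfold)

lemma regular_functions_slice:
  assumes "f \<in> regular_functions (snoc n) (Suc n) (X \<times> UNIV)"
  shows "(\<lambda>x. f (x, c)) \<in> regular_functions (\<lambda>x. x) n X"
proof -
  interpret function_algebra X "regular_functions (\<lambda>x. x) n X" by (rule function_algebra_regular)
  obtain P Q where PQ: "P \<in> polys (Suc n)" "Q \<in> polys (Suc n)" "\<And>p. p \<in> X \<times> UNIV \<Longrightarrow> Q (snoc n p) \<noteq> 0"
    "\<And>p. p \<in> X \<times> UNIV \<Longrightarrow> f p = P (snoc n p) / Q (snoc n p)"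
    using assms by (rule regular_functionsE) blast
  have c: "(\<lambda>x. snoc n (x, c) i) \<in> regular_functions (\<lambda>x. x) n X" if "i < Suc n" for i
    using that regular_functions_polys[OF polys.var[of i n], of "\<lambda>x. x" X] const[of c]
    by (cases "i = n") (simp_all add: snoc_def)
  have "(\<lambda>x. P (snoc n (x, c)) / Q (snoc n (x, c))) \<in> regular_functions (\<lambda>x. x) n X"
    by (rule divide[OF polys[OF PQ(1) c] polys[OF PQ(2) c]]) (simp_all add: PQ(3))
  then show ?thesis by (rule cong) (simp add: PQ(4))
qed

section \<open>Approximate and exact motion of regular families\<close>

context retraction_charts
begin

lemma spray_cong: "(\<And>l. l < m \<Longrightarrow> v l = w l) \<Longrightarrow> spray j y v = spray j y w"
proof -
  assume "\<And>l. l < m \<Longrightarrow> v l = w l"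
  then have "lin m y \<tau> v = lin m y \<tau> w" for \<tau> by (auto simp: lin_def)
  then show ?thesis by (simp add: spray_def)
qed

lemma sprays_cong:
  "(\<And>i l. i < j \<Longrightarrow> l < m \<Longrightarrow> v i l = w i l) \<Longrightarrow> sprays j y v = sprays j y w"
proof (induction j)
  case (Suc j)
  then have "sprays j y v = sprays j y w" by simp
  then show ?case using Suc.prems by (auto intro: spray_cong)
qed simp

lemma continuous_on_into_Y:
  assumes "\<And>l. l < m \<Longrightarrow> continuous_on D (\<lambda>x. F x l)" "\<And>x. x \<in> D \<Longrightarrow> F x \<in> Y"
  shows "continuous_on D F"
proof (rule continuous_on_coordinatewise_then_product)
  fix l
  show "continuous_on D (\<lambda>x. F x l)"
  proof (cases "l < m")
    case False
    then have "F x l = 0" if "x \<in> D" for x using Y_space[OF assms(2)[OF that]] by simp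
    then show ?thesis using continuous_on_cong[of D D "\<lambda>x. F x l" "\<lambda>x. 0"] by simp
  qed (rule assms)
qed

text \<open>The connector reaches \<open>z x\<close> exactly but is only continuous in
  \<open>x\<close>. The pairs \<open>(x, v)\<close> with \<open>v\<close> in the open cube whose
  sprays end within \<delta> of \<open>z x\<close> form a relatively open set containing the compact
  graph of the connector; a polynomial map close enough to it stays in this set.\<close>

lemma approximate_connection:
  assumes X: "compact X" "\<And>x i. x \<in> X \<Longrightarrow> n \<le> i \<Longrightarrow> x i = 0"
    and y: "continuous_on X y" and z: "continuous_on X z"
    and yz: "\<And>x. x \<in> X \<Longrightarrow> (y x, z x) \<in> connectable k" and \<delta>: "0 < \<delta>"
  shows "\<exists>w. (\<forall>i l. (\<lambda>x. w x i l) \<in> polys n) \<and>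
    (\<forall>x\<in>X. (\<forall>i<k. \<forall>l<m. \<bar>w x i l\<bar> < 1) \<and> dist (sprays k (y x) (w x)) (z x) < \<delta>)"
proof -
  note coord = continuous_on_product_then_coordinatewise
  have Y: "y x \<in> Y" "z x \<in> Y" if "x \<in> X" for x using yz[OF that] by (auto simp: connectable_def)
  \<comment> \<open>Entries outside \<open>i < k\<close>, \<open>l < m\<close> are set to zero, so
    that \<open>V\<close> is continuous into the full function space, whose metric sees all
    entries.\<close>
  define V where "V x i l = (if i < k \<and> l < m then connector (y x) (z x) i l else 0)" for x i l
  have V_cont: "continuous_on X (\<lambda>x. V x i l)" for i l
  proof (cases "i < k \<and> l < m")
    case True
    have "(\<lambda>x. connector (y x) (z x) i l) \<in> {f. continuous_on X f}"
      by (rule connector_algebra[OF function_algebra_continuous])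
        (use True coord[OF y] coord[OF z] yz in auto)
    then show ?thesis using True by (simp add: V_def)
  next
    case False
    show ?thesis unfolding V_def if_not_P[OF False] by (rule continuous_on_const)
  qed
  then have V: "continuous_on X V"
    by (intro continuous_on_coordinatewise_then_product) 
  have V_small: "\<bar>V x i l\<bar> < 1" if "x \<in> X" for x i l
    using connector_small[OF yz[OF that]] by (simp add: V_def)
  have V_sprays: "sprays k (y x) (V x) = z x" if "x \<in> X" for x
  proof -
    have "sprays k (y x) (V x) = sprays k (y x) (connector (y x) (z x))"
      by (rule sprays_cong) (simp add: V_def)
    then show ?thesis unfolding sprays_connector[OF yz[OF that]] .
  qed
  define U where "U = {p\<in>X \<times> UNIV. \<forall>i<k. \<forall>l<m. \<bar>snd p i l :: real\<bar> < 1}"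
  have w: "continuous_on D (\<lambda>p. snd p i l)" for D :: "((nat \<Rightarrow> real) \<times> (nat \<Rightarrow> nat \<Rightarrow> real)) set" and i l
    by (rule coord[OF coord[OF continuous_on_snd[OF continuous_on_id]]])
  have opU: "openin (top_of_set (X \<times> UNIV)) U"
    unfolding U_def by (intro openin_Collect_all_less openin_Collect_less continuous_on_rabs w)
  have fstU: "fst p \<in> X" if "p \<in> U" for p using that by (auto simp: U_def)
  have yU: "continuous_on U (\<lambda>p. y (fst p))" "continuous_on U (\<lambda>p. z (fst p))"
    using fstU by (auto intro!: continuous_on_compose2[OF y continuous_on_fst[OF continuous_on_id]]
      continuous_on_compose2[OF z continuous_on_fst[OF continuous_on_id]])
  have le1: "\<bar>snd p i l\<bar> \<le> 1" if "p \<in> U" "i < k" "l < m" for p i l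
    using that by (auto simp: U_def intro: less_imp_le)
  have "continuous_on U (\<lambda>p. sprays k (y (fst p)) (snd p))"
  proof (rule continuous_on_into_Y)
    show "sprays k (y (fst p)) (snd p) \<in> Y" if "p \<in> U" for p
      using le1 that Y(1)[OF fstU] by (intro sprays_in) auto
    show "continuous_on U (\<lambda>p. sprays k (y (fst p)) (snd p) l)" if l: "l < m" for l
    proof -
      have "(\<lambda>p. sprays k (y (fst p)) (snd p) l) \<in> {f. continuous_on U f}"
        by (rule sprays_algebra[OF function_algebra_continuous])
          (use coord[OF yU(1)] w le1 l Y(1)[OF fstU] in auto)
      then show ?thesis by simp
    qed
  qed
  then have "continuous_on U (\<lambda>p. dist (sprays k (y (fst p)) (snd p)) (z (fst p)))"
    by (rule continuous_on_dist) (rule yU(2))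
  then have "openin (top_of_set U) {p\<in>U. dist (sprays k (y (fst p)) (snd p)) (z (fst p)) < \<delta>}"
    by (rule openin_Collect_less)
  then have "openin (top_of_set (X \<times> UNIV)) {p\<in>U. dist (sprays k (y (fst p)) (snd p)) (z (fst p)) < \<delta>}"
    using opU by (rule openin_trans)
  then obtain T where T: "open T"
    "{p\<in>U. dist (sprays k (y (fst p)) (snd p)) (z (fst p)) < \<delta>} = (X \<times> UNIV) \<inter> T"
    unfolding openin_open by blast
  have "compact ((\<lambda>x. (x, V x)) ` X)" (is "compact ?G")
    by (intro compact_continuous_image continuous_on_Pair continuous_on_id V X)
  moreover have "?G \<subseteq> T"
  proof
    fix p assume "p \<in> ?G"
    then obtain x where x: "x \<in> X" "p = (x, V x)" by blast
    then have "p \<in> {p\<in>U. dist (sprays k (y (fst p)) (snd p)) (z (fst p)) < \<delta>}"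
      using V_small[OF x(1)] V_sprays[OF x(1)] \<delta> by (simp add: U_def)
    then show "p \<in> T" unfolding T(2) by blast
  qed
  ultimately obtain \<epsilon> where \<epsilon>: "0 < \<epsilon>" "(\<Union>p\<in>?G. ball p \<epsilon>) \<subseteq> T"
    by (rule compact_subset_open_imp_ball_epsilon_subset[OF _ T(1)])
  \<comment> \<open>Two nested function spaces cost a factor 2 each, so \<epsilon> / 8 per entry
    gives a distance of at most \<epsilon> / 2.\<close>
  have "\<exists>P\<in>polys n. \<forall>x\<in>X. \<bar>V x i l - P x\<bar> < \<epsilon> / 8" for i l
    using \<epsilon>(1) by (intro polys_approximation X V_cont) auto
  then obtain P where P: "\<And>i l. P i l \<in> polys n" "\<And>i l x. x \<in> X \<Longrightarrow> \<bar>V x i l - P i l x\<bar> < \<epsilon> / 8"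
    by metis
  have good: "(x, \<lambda>i l. P i l x) \<in> U \<and> dist (sprays k (y x) (\<lambda>i l. P i l x)) (z x) < \<delta>" if x: "x \<in> X" for x
  proof -
    have "dist (V x) (\<lambda>i l. P i l x) \<le> 2 * (2 * (\<epsilon> / 8))"
      by (intro dist_fun_le_bound) (simp only: dist_real_def less_imp_le[OF P(2)[OF x]])
    then have "dist (V x) (\<lambda>i l. P i l x) < \<epsilon>" using \<epsilon>(1) by simp
    then have "(x, \<lambda>i l. P i l x) \<in> ball (x, V x) \<epsilon>" by (simp add: dist_Pair_Pair)
    then have "(x, \<lambda>i l. P i l x) \<in> T" using \<epsilon>(2) imageI[OF x, of "\<lambda>x. (x, V x)"] by blast
    then have "(x, \<lambda>i l. P i l x) \<in> (X \<times> UNIV) \<inter> T" using x by simp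
    then show ?thesis unfolding T(2)[symmetric] by simp
  qed
  show ?thesis
  proof (intro exI[of _ "\<lambda>x i l. P i l x"] conjI ballI allI)
    show "(\<lambda>x. P i l x) \<in> polys n" for i l using P(1) .
  qed (use good in \<open>auto simp: U_def\<close>)
qed

definition regular_family :: "nat \<Rightarrow> (nat \<Rightarrow> real) set \<Rightarrow> ((nat \<Rightarrow> real) \<times> real \<Rightarrow> nat \<Rightarrow> real) \<Rightarrow> bool" where
  "regular_family n X G \<longleftrightarrow>
     (\<forall>l<m. (\<lambda>p. G p l) \<in> regular_functions (snoc n) (Suc n) (X \<times> UNIV)) \<and> G ` (X \<times> UNIV) \<subseteq> Y"

text \<open>Piecewise concatenation of homotopies would destroy regularity. Instead the new motion
  is superimposed on the old one: the spray with parameter \<open>\<sigma> t * w x\<close> acts on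
  \<open>G (x, t)\<close> for the same \<open>t\<close>.\<close>

lemma regular_family_move:
  assumes G: "regular_family n X G"
    and w: "\<And>i l. i < k \<Longrightarrow> l < m \<Longrightarrow> (\<lambda>x. w x i l) \<in> regular_functions (\<lambda>x. x) n X"
    and small: "\<And>x i l. x \<in> X \<Longrightarrow> i < k \<Longrightarrow> l < m \<Longrightarrow> \<bar>w x i l\<bar> \<le> 1"
  shows "\<exists>G'. regular_family n X G' \<and>
    (\<forall>x\<in>X. G' (x, 0) = G (x, 0) \<and> G' (x, 1) = sprays k (G (x, 1)) (w x))"
proof -
  define \<sigma> :: "real \<Rightarrow> real" where "\<sigma> t = 2 * t / (1 + t\<^sup>2)" for t
  \<comment> \<open>Maps \<open>\<real>\<close> into the interval \<open>[-1, 1]\<close>, on which the sprays may be evaluated, and fixes \<open>0\<close> and \<open>1\<close>.\<close>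
  have pos: "0 < 1 + t\<^sup>2" for t :: real by (simp add: add_pos_nonneg)
  have \<sigma>1: "\<bar>\<sigma> t\<bar> \<le> 1" for t
  proof -
    have "0 \<le> (1 - \<bar>t\<bar>)\<^sup>2" by simp
    then have "2 * \<bar>t\<bar> \<le> 1 + t\<^sup>2" by (simp add: power2_eq_square algebra_simps)
    then show ?thesis using pos[of t] by (simp add: \<sigma>_def abs_mult)
  qed
  define G' where "G' p = sprays k (G p) (\<lambda>i l. \<sigma> (snd p) * w (fst p) i l)" for p
  let ?A = "regular_functions (snoc n) (Suc n) (X \<times> UNIV)"
  interpret function_algebra "X \<times> UNIV" ?A by (rule function_algebra_regular)
  have \<sigma>A: "(\<lambda>p. \<sigma> (snd p)) \<in> ?A"
    unfolding \<sigma>_def by (intro divide mult add power const regular_functions_snd less_imp_neq[OF pos, symmetric])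
  have GY: "G p \<in> Y" if "p \<in> X \<times> UNIV" for p using G that by (auto simp: regular_family_def)
  have sm: "\<bar>\<sigma> (snd p) * w (fst p) i l\<bar> \<le> 1" if "p \<in> X \<times> UNIV" "i < k" "l < m" for p i l
    unfolding abs_mult using \<sigma>1 small that by (intro mult_le_one) auto
  show ?thesis
  proof (intro exI[of _ G'] conjI ballI)
    have "(\<lambda>p. G' p l) \<in> ?A" if "l < m" for l
      unfolding G'_def
      by (rule sprays_algebra[OF function_algebra_regular le_refl])
        (use G GY sm that in \<open>auto simp: regular_family_def intro!: mult \<sigma>A regular_functions_fst w\<close>)
    moreover have "G' p \<in> Y" if "p \<in> X \<times> UNIV" for p
      unfolding G'_def by (intro sprays_in le_refl GY that sm)
    ultimately show "regular_family n X G'" by (auto simp: regular_family_def)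
    show "G' (x, 0) = G (x, 0)" if "x \<in> X" for x
      unfolding G'_def using GY that by (intro sprays_zero) (auto simp: \<sigma>_def)
    show "G' (x, 1) = sprays k (G (x, 1)) (w x)" if "x \<in> X" for x
      by (simp add: G'_def \<sigma>_def)
  qed
qed

theorem regular_homotopy:
  assumes X: "compact X" "\<And>x i. x \<in> X \<Longrightarrow> n \<le> i \<Longrightarrow> x i = 0"
    and f: "\<And>l. l < m \<Longrightarrow> (\<lambda>x. f x l) \<in> regular_functions (\<lambda>x. x) n X"
    and g: "\<And>l. l < m \<Longrightarrow> (\<lambda>x. g x l) \<in> regular_functions (\<lambda>x. x) n X"
    and H: "continuous_on ({0..1::real} \<times> X) H" "H ` ({0..1} \<times> X) \<subseteq> Y"
    and H0: "\<And>x. x \<in> X \<Longrightarrow> H (0, x) = f x" and H1: "\<And>x. x \<in> X \<Longrightarrow> H (1, x) = g x"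
    and cover: "\<And>z. z \<in> H ` ({0..1} \<times> X) \<Longrightarrow> \<exists>j<k. Q j z \<noteq> 0"
  shows "\<exists>F. regular_family n X F \<and> (\<forall>x\<in>X. F (x, 0) = f x \<and> F (x, 1) = g x)"
proof -
  let ?K = "H ` ({0..1} \<times> X)"
  have cI: "compact ({0..1::real} \<times> X)" by (intro compact_Times X) simp
  have tail_pos: "0 < tail 0 z" if z: "z \<in> ?K" for z
  proof -
    obtain j where "j < k" "Q j z \<noteq> 0" using cover[OF z] by blast
    then show ?thesis unfolding tail_def by (intro sum_pos2[where i = j]) auto
  qed
  obtain \<epsilon> where \<epsilon>: "0 < \<epsilon>" "\<And>y z. y \<in> Y \<Longrightarrow> z \<in> ?K \<Longrightarrow> dist y z < \<epsilon> \<Longrightarrow> (y, z) \<in> connectable k"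
    using connectable_near_compact[OF compact_continuous_image[OF H(1) cI] H(2) tail_pos] by blast
  obtain d where d: "0 < d" "\<And>p q. p \<in> {0..1} \<times> X \<Longrightarrow> q \<in> {0..1} \<times> X \<Longrightarrow> dist q p < d \<Longrightarrow> dist (H q) (H p) < \<epsilon> / 2"
    using compact_uniformly_continuous[OF H(1) cI] \<epsilon>(1) unfolding uniformly_continuous_on_def
    by (metis half_gt_zero)
  obtain N where N: "inverse (real (Suc N)) < d" using reals_Archimedean[OF d(1)] by blast
  define t where "t j = real j * inverse (real (Suc N))" for j
  have t01: "t j \<in> {0..1}" if "j \<le> Suc N" for j using that by (simp add: t_def field_simps)
  have H_step: "dist (H (t j, x)) (H (t (Suc j), x)) < \<epsilon> / 2" if "Suc j \<le> Suc N" "x \<in> X" for j x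
  proof (rule d(2))
    show "dist (t j, x) (t (Suc j), x) < d"
      using N by (simp add: dist_Pair_Pair dist_real_def t_def algebra_simps)
  qed (use that t01[of j] t01[of "Suc j"] in auto)
  have H_cont: "continuous_on X (\<lambda>x. H (s, x))" if "s \<in> {0..1}" for s
    by (rule continuous_on_compose2[OF H(1)]) (use that in \<open>auto intro!: continuous_on_Pair\<close>)
  have slice_cont: "continuous_on X (\<lambda>x. G (x, 1))" if "regular_family n X G" for G
  proof (rule continuous_on_into_Y)
    show "continuous_on X (\<lambda>x. G (x, 1) l)" if "l < m" for l
      using \<open>regular_family n X G\<close> that
      by (intro regular_functions_continuous[of _ n] regular_functions_slice) (simp add: regular_family_def)
  qed (use that in \<open>auto simp: regular_family_def\<close>)
  \<comment> \<open>The tolerance \<delta> is free at every stage, while the preceding stage is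
    invoked only with \<epsilon> / 2. Together with a step of \<open>H\<close>, also below
    \<epsilon> / 2, this keeps \<open>G (x, 1)\<close> within reach \<epsilon> of the next target,
    so errors do not accumulate.\<close>
  have approx: "\<exists>G. regular_family n X G \<and> (\<forall>x\<in>X. G (x, 0) = f x \<and> dist (G (x, 1)) (H (t j, x)) < \<delta>)"
    if "j \<le> Suc N" "0 < \<delta>" for j \<delta>
    using that
  proof (induction j arbitrary: \<delta>)
    case 0
    have "f x \<in> Y" if "x \<in> X" for x
    proof -
      have "H (0, x) \<in> ?K" using that by simp
      then show ?thesis using H(2) H0[OF that] by auto
    qed
    then have "regular_family n X (\<lambda>p. f (fst p))"
      using f by (auto simp: regular_family_def intro: regular_functions_fst)
    then show ?case using H0 0 by (intro exI[of _ "\<lambda>p. f (fst p)"]) (simp add: t_def)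
  next
    case (Suc j)
    from Suc.IH[of "\<epsilon> / 2"] Suc.prems(1) \<epsilon>(1) obtain G where G: "regular_family n X G"
      "\<And>x. x \<in> X \<Longrightarrow> G (x, 0) = f x" "\<And>x. x \<in> X \<Longrightarrow> dist (G (x, 1)) (H (t j, x)) < \<epsilon> / 2" by auto
    have conn: "(G (x, 1), H (t (Suc j), x)) \<in> connectable k" if x: "x \<in> X" for x
    proof (rule \<epsilon>(2))
      show "G (x, 1) \<in> Y" using G(1) x by (auto simp: regular_family_def)
      show "H (t (Suc j), x) \<in> ?K" using t01[OF Suc.prems(1)] x by auto
      show "dist (G (x, 1)) (H (t (Suc j), x)) < \<epsilon>"
        using dist_triangle_half_r[of "H (t j, x)" "G (x, 1)" \<epsilon> "H (t (Suc j), x)"]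
          G(3)[OF x] H_step[OF Suc.prems(1) x] by (simp add: dist_commute)
    qed
    have "\<exists>w. (\<forall>i l. (\<lambda>x. w x i l) \<in> polys n) \<and> (\<forall>x\<in>X. (\<forall>i<k. \<forall>l<m. \<bar>w x i l\<bar> < 1) \<and>
        dist (sprays k (G (x, 1)) (w x)) (H (t (Suc j), x)) < \<delta>)"
      by (rule approximate_connection; fact X slice_cont[OF G(1)] H_cont[OF t01[OF Suc.prems(1)]] conn Suc.prems(2))
    then obtain w where w: "\<And>i l. (\<lambda>x. w x i l) \<in> polys n"
      "\<And>x i l. x \<in> X \<Longrightarrow> i < k \<Longrightarrow> l < m \<Longrightarrow> \<bar>w x i l\<bar> < 1"
      "\<And>x. x \<in> X \<Longrightarrow> dist (sprays k (G (x, 1)) (w x)) (H (t (Suc j), x)) < \<delta>" by blast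
    have "\<exists>G'. regular_family n X G' \<and>
        (\<forall>x\<in>X. G' (x, 0) = G (x, 0) \<and> G' (x, 1) = sprays k (G (x, 1)) (w x))"
    proof (rule regular_family_move[OF G(1)])
      show "(\<lambda>x. w x i l) \<in> regular_functions (\<lambda>x. x) n X" for i l
        by (rule regular_functions_polys[OF w(1)])
    qed (rule less_imp_le, rule w(2))
    then show ?case using G(2) w(3) by auto
  qed
  have "t (Suc N) = 1" by (simp add: t_def)
  with approx[OF le_refl \<epsilon>(1)] obtain G where G: "regular_family n X G"
    "\<And>x. x \<in> X \<Longrightarrow> G (x, 0) = f x" "\<And>x. x \<in> X \<Longrightarrow> dist (G (x, 1)) (g x) < \<epsilon>"
    using H1 by auto
  have conn: "(G (x, 1), g x) \<in> connectable k" if x: "x \<in> X" for x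
  proof (rule \<epsilon>(2)[OF _ _ G(3)[OF x]])
    show "G (x, 1) \<in> Y" using G(1) x by (auto simp: regular_family_def)
    have "H (1, x) \<in> ?K" using x by simp
    then show "g x \<in> ?K" using H1[OF x] by simp
  qed
  \<comment> \<open>\<open>G (x, 1)\<close> and \<open>g x\<close> are both regular in
    \<open>x\<close>, so the rational connector between them is regular itself and meets the
    endpoint exactly.\<close>
  have reg: "(\<lambda>x. connector (G (x, 1)) (g x) i l) \<in> regular_functions (\<lambda>x. x) n X" if "i < k" "l < m" for i l
  proof (rule connector_algebra[OF function_algebra_regular that(1) _ g conn that(2)])
    show "(\<lambda>x. G (x, 1) l) \<in> regular_functions (\<lambda>x. x) n X" if "l < m" for l
      using G(1) that by (intro regular_functions_slice) (simp add: regular_family_def)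
  qed
  have "\<exists>F. regular_family n X F \<and>
      (\<forall>x\<in>X. F (x, 0) = G (x, 0) \<and> F (x, 1) = sprays k (G (x, 1)) (connector (G (x, 1)) (g x)))"
    by (rule regular_family_move[OF G(1) reg], assumption+) (rule less_imp_le[OF connector_small[OF conn]])
  then show ?thesis using G(2) sprays_connector[OF conn] by auto
qed

end

section \<open>Regular maps in coordinates\<close>

lemma openin_iso:
  assumes iso: "isomorphism X (fspace_of Z (polys n)) h"
  shows "openin (zariski X) U \<longleftrightarrow>
    U \<subseteq> points X \<and> (\<forall>x\<in>U. \<exists>P\<in>polys n. P (h x) \<noteq> 0 \<and> (\<forall>y\<in>points X - U. P (h y) = 0))"
proof (cases "U \<subseteq> points X")
  case True
  have hom: "homeomorphic_map (zariski X) (zariski (fspace_of Z (polys n))) h"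
    using iso by (simp add: isomorphism_def)
  note h = isomorphism_onto_polys(1,2)[OF iso]
  have "Z - h ` U = h ` (points X - U)"
    using h True inj_on_image_set_diff[OF h(2), of "points X" U] by auto
  moreover have "h ` U \<subseteq> Z" using h(1) True by blast
  ultimately show ?thesis
    using True homeomorphic_map_openness[OF hom True]
    by (auto simp: openin_fspace_of_pointwise(2)[OF polys_one polys_mult])
next
  case False
  then show ?thesis using openin_subset by blast
qed

lemma sections_iso:
  assumes iso: "isomorphism X (fspace_of Z (polys n)) h" and U: "openin (zariski X) U"
  shows "sections X U = extensional U \<inter> regular_functions h n U"
proof -
  note h = isomorphism_onto_polys(1,2)[OF iso]
  have sub: "U \<subseteq> points X" by (rule openin_subset[OF U])
  have hom: "homeomorphic_map (zariski X) (zariski (fspace_of Z (polys n))) h"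
    using iso by (simp add: isomorphism_def)
  have op: "openin (zariski (fspace_of Z (polys n))) (h ` U)"
    using homeomorphic_map_openness[OF hom sub] U by blast
  have pre: "preim X h (h ` U) = U" using h(2) sub by (auto simp: inj_on_def)
  have re: "restrict (restrict (\<lambda>x. P x / Q x) (h ` U) \<circ> h) U = restrict (\<lambda>x. P (h x) / Q (h x)) U"
    for P Q :: "(nat \<Rightarrow> real) \<Rightarrow> real" by (auto simp: restrict_def)
  have eq: "sections X U = (\<lambda>s. restrict (s \<circ> h) U) ` sections (fspace_of Z (polys n)) (h ` U)"
    using conjunct2[OF iso[unfolded isomorphism_def], rule_format, OF op] unfolding pre .
  show ?thesis
    unfolding eq
  proof (intro subset_antisym subsetI)
    fix s assume "s \<in> (\<lambda>s. restrict (s \<circ> h) U) ` sections (fspace_of Z (polys n)) (h ` U)"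
    then obtain P Q where PQ: "s = restrict (restrict (\<lambda>x. P x / Q x) (h ` U) \<circ> h) U"
      "P \<in> polys n" "Q \<in> polys n" "\<forall>x\<in>h ` U. Q x \<noteq> 0"
      unfolding sections_fspace_of by blast
    then show "s \<in> extensional U \<inter> regular_functions h n U"
      unfolding PQ(1) re by (auto intro: regular_functionsI[OF PQ(2,3)])
  next
    fix s assume "s \<in> extensional U \<inter> regular_functions h n U"
    then obtain P Q where PQ: "P \<in> polys n" "Q \<in> polys n" "\<And>x. x \<in> U \<Longrightarrow> Q (h x) \<noteq> 0"
      "\<And>x. x \<in> U \<Longrightarrow> s x = P (h x) / Q (h x)" and s: "s \<in> extensional U"
      by (elim IntE regular_functionsE) blast
    have "s = restrict (restrict (\<lambda>x. P x / Q x) (h ` U) \<circ> h) U"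
      unfolding re by (rule extensionalityI[OF s restrict_extensional]) (simp add: PQ(4))
    moreover have "restrict (\<lambda>x. P x / Q x) (h ` U) \<in> sections (fspace_of Z (polys n)) (h ` U)"
      unfolding sections_fspace_of using PQ(1-3) by blast
    ultimately show "s \<in> (\<lambda>s. restrict (s \<circ> h) U) ` sections (fspace_of Z (polys n)) (h ` U)"
      by (rule image_eqI)
  qed
qed

lemma sections_affine_space:
  "sections (affine_space n) W = extensional W \<inter> regular_functions (\<lambda>x. x) n W"
proof (intro subset_antisym subsetI)
  fix s assume "s \<in> extensional W \<inter> regular_functions (\<lambda>x. x) n W"
  then obtain P Q where PQ: "P \<in> polys n" "Q \<in> polys n" "\<And>x. x \<in> W \<Longrightarrow> Q x \<noteq> 0"
    "\<And>x. x \<in> W \<Longrightarrow> s x = P x / Q x" and s: "s \<in> extensional W"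
    by (elim IntE regular_functionsE) blast
  have "s = restrict (\<lambda>x. P x / Q x) W"
    by (rule extensionalityI[OF s restrict_extensional]) (simp add: PQ(4))
  then show "s \<in> sections (affine_space n) W"
    unfolding affine_space_def sections_fspace_of using PQ(1-3) by blast
qed (auto simp: affine_space_def sections_fspace_of intro: regular_functionsI)

lemma restrict_regular_functions:
  "restrict s U \<in> regular_functions e n U \<longleftrightarrow> s \<in> regular_functions e n U"
  by (auto simp: regular_functions_def)

lemma coordinate_section:
  assumes iso: "isomorphism Y (fspace_of Z (polys m)) h" and V: "openin (zariski Y) V" and l: "l < m"
  shows "restrict (\<lambda>y. h y l) V \<in> sections Y V"
  unfolding sections_iso[OF iso V] using regular_functions_polys[OF polys.var[OF l], of h V]
  by (simp add: restrict_regular_functions)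

lemma regular_map_coordinates:
  assumes X: "isomorphism X (fspace_of Z (polys n)) h" and Y: "isomorphism Y (fspace_of Z' (polys m)) h'"
    and f: "regular_map X Y f" and l: "l < m"
  shows "(\<lambda>x. h' (f x) l) \<in> regular_functions h n (points X)"
proof -
  have "f x \<in> points Y" if "x \<in> points X" for x
    using f that unfolding regular_map_def continuous_map_def by blast
  then have pre: "preim X f (points Y) = points X" by blast
  have "restrict (restrict (\<lambda>y. h' y l) (points Y) \<circ> f) (preim X f (points Y)) \<in> sections X (preim X f (points Y))"
    using f coordinate_section[OF Y openin_topspace l] unfolding regular_map_def by blast
  then have "restrict (\<lambda>y. h' y l) (points Y) \<circ> f \<in> regular_functions h n (points X)"
    unfolding pre sections_iso[OF X openin_topspace] by (simp add: restrict_regular_functions)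
  then show ?thesis
    by (rule function_algebra.cong[OF function_algebra_regular]) (use pre in auto)
qed

text \<open>A polynomial in the coordinates of \<open>f x\<close> is a quotient of polynomials in
  the coordinates of \<open>x\<close>. Its numerator separates a point of a preimage from the
  complement, which gives Zariski continuity; sections pull back because the regular functions admit
  division.\<close>

lemma regular_mapI:
  assumes X: "isomorphism X (fspace_of Z (polys n)) h" and Y: "isomorphism Y (fspace_of Z' (polys m)) h'"
    and f: "\<And>x. x \<in> points X \<Longrightarrow> f x \<in> points Y"
    and reg: "\<And>l. l < m \<Longrightarrow> (\<lambda>x. h' (f x) l) \<in> regular_functions h n (points X)"
  shows "regular_map X Y f"
proof -
  have comp: "(\<lambda>x. P (h' (f x))) \<in> regular_functions h n U" if "U \<subseteq> points X" "P \<in> polys m" for U P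
    by (rule function_algebra.polys[OF function_algebra_regular that(2)])
      (rule regular_functions_subset[OF reg that(1)])
  have cont: "openin (zariski X) (preim X f V)" if V: "openin (zariski Y) V" for V
    unfolding openin_iso[OF X]
  proof (intro conjI ballI)
    fix x assume x: "x \<in> preim X f V"
    then obtain P where P: "P \<in> polys m" "P (h' (f x)) \<noteq> 0" "\<And>y. y \<in> points Y - V \<Longrightarrow> P (h' y) = 0"
      using V unfolding openin_iso[OF Y] by blast
    obtain R S where RS: "R \<in> polys n" "S \<in> polys n" "\<And>x. x \<in> points X \<Longrightarrow> S (h x) \<noteq> 0"
      "\<And>x. x \<in> points X \<Longrightarrow> P (h' (f x)) = R (h x) / S (h x)"
      by (rule regular_functionsE[OF comp[OF subset_refl P(1)]]) blast
    have "R (h x) \<noteq> 0" using RS(4)[of x] P(2) x by auto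
    moreover have "R (h y) = 0" if y: "y \<in> points X - preim X f V" for y
    proof -
      have "f y \<in> points Y - V" using f y by auto
      then have "P (h' (f y)) = 0" by (rule P(3))
      then show ?thesis using RS(3,4)[of y] y by simp
    qed
    ultimately show "\<exists>P\<in>polys n. P (h x) \<noteq> 0 \<and> (\<forall>y\<in>points X - preim X f V. P (h y) = 0)"
      using RS(1) by blast
  qed auto
  have "restrict (s \<circ> f) (preim X f V) \<in> sections X (preim X f V)"
    if V: "openin (zariski Y) V" and s: "s \<in> sections Y V" for V s
  proof -
    let ?U = "preim X f V"
    interpret function_algebra ?U "regular_functions h n ?U" by (rule function_algebra_regular)
    have "s \<in> regular_functions h' m V" using s unfolding sections_iso[OF Y V] by blast
    then obtain P Q where PQ: "P \<in> polys m" "Q \<in> polys m" "\<And>y. y \<in> V \<Longrightarrow> Q (h' y) \<noteq> 0"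
      "\<And>y. y \<in> V \<Longrightarrow> s y = P (h' y) / Q (h' y)"
      by (rule regular_functionsE) blast
    have "(\<lambda>x. P (h' (f x)) / Q (h' (f x))) \<in> regular_functions h n ?U"
      by (rule divide[OF comp[OF _ PQ(1)] comp[OF _ PQ(2)]]) (auto simp: PQ(3))
    then have "s \<circ> f \<in> regular_functions h n ?U"
      by (rule cong) (simp add: PQ(4))
    then show ?thesis
      unfolding sections_iso[OF X cont[OF V]] by (simp add: restrict_regular_functions)
  qed
  then show ?thesis
    unfolding regular_map_def continuous_map_def using f cont by blast
qed

text \<open>\<open>points_fspace_of\<close> applies once the algebra contains 1 and is closed under
  products. A product of two sums is a sum over pairs of indices, which are renumbered by an initial
  segment of the naturals.\<close>

lemma points_variety_prod_real_line:
  assumes iso: "isomorphism X (fspace_of Z (polys n)) h"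
  shows "points (variety_prod X real_line) = points X \<times> UNIV"
proof -
  let ?OX = "sections X (points X)" and ?OR = "sections real_line UNIV"
  let ?A = "{\<lambda>(x, y). \<Sum>k<m. s k x * t k y | (m::nat) s t. \<forall>k<m. s k \<in> ?OX \<and> t k \<in> ?OR}"
  have OR: "?OR = {\<lambda>x. poly p x / poly q x | p q. \<forall>x. poly q x \<noteq> 0}"
    by (auto simp: real_line_def sections_fspace_of restrict_def)
  interpret function_algebra "points X" "regular_functions h n (points X)" by (rule function_algebra_regular)
  have OX_mult: "restrict (\<lambda>x. s x * s' x) (points X) \<in> ?OX" if "s \<in> ?OX" "s' \<in> ?OX" for s s'
    using that mult unfolding sections_iso[OF iso openin_topspace] by (simp add: restrict_regular_functions)
  have OR_mult: "(\<lambda>x. t x * t' x) \<in> ?OR" if t: "t \<in> ?OR" "t' \<in> ?OR" for t t'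
  proof -
    obtain p q where 1: "t = (\<lambda>x. poly p x / poly q x)" "\<forall>x. poly q x \<noteq> 0"
      using t(1) unfolding OR by auto
    obtain p' q' where 2: "t' = (\<lambda>x. poly p' x / poly q' x)" "\<forall>x. poly q' x \<noteq> 0"
      using t(2) unfolding OR by auto
    show ?thesis
      unfolding OR 1(1) 2(1) using 1(2) 2(2)
      by (intro CollectI exI[of _ "p * p'"] exI[of _ "q * q'"]) auto
  qed
  have "\<exists>P\<in>?A. \<forall>x\<in>points X \<times> UNIV. P x = 1"
  proof -
    have "restrict (\<lambda>x. 1) (points X) \<in> ?OX"
      unfolding sections_iso[OF iso openin_topspace] by (simp add: restrict_regular_functions const)
    moreover have "(\<lambda>x. 1) \<in> ?OR"
      unfolding OR by (intro CollectI exI[of _ 1]) auto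
    ultimately have "(\<lambda>(x, y). \<Sum>k<1::nat. restrict (\<lambda>x. 1) (points X) x * 1) \<in> ?A"
      by (intro CollectI exI[of _ "1::nat"] exI[of _ "\<lambda>_. restrict (\<lambda>x. 1) (points X)"] exI[of _ "\<lambda>_ _. 1"] conjI refl) simp
    then show ?thesis by (rule bexI[rotated]) auto
  qed
  moreover have "\<forall>P\<in>?A. \<forall>Q\<in>?A. \<exists>R\<in>?A. \<forall>x\<in>points X \<times> UNIV. R x = P x * Q x"
  proof (intro ballI)
    fix a b assume "a \<in> ?A" "b \<in> ?A"
    then obtain m s t m' s' t' where a: "a = (\<lambda>(x, y). \<Sum>k<(m::nat). s k x * t k y)" "\<forall>k<m. s k \<in> ?OX \<and> t k \<in> ?OR"
      and b: "b = (\<lambda>(x, y). \<Sum>k<(m'::nat). s' k x * t' k y)" "\<forall>k<m'. s' k \<in> ?OX \<and> t' k \<in> ?OR"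
      by blast
    let ?K = "{..<m} \<times> {..<m'}"
    obtain e where e: "bij_betw e {..<card ?K} ?K"
      using ex_bij_betw_nat_finite[of ?K] by (auto simp: atLeast0LessThan)
    let ?u = "\<lambda>(i, j). restrict (\<lambda>x. s i x * s' j x) (points X)" and ?v = "\<lambda>(i, j) y. t i y * t' j y"
    let ?c = "\<lambda>(x, y). \<Sum>k<card ?K. ?u (e k) x * ?v (e k) y"
    have "\<forall>k<card ?K. ?u (e k) \<in> ?OX \<and> ?v (e k) \<in> ?OR"
    proof (intro allI impI)
      fix k assume "k < card ?K"
      then have "e k \<in> ?K" using bij_betwE[OF e] by blast
      then show "?u (e k) \<in> ?OX \<and> ?v (e k) \<in> ?OR"
        using a(2) b(2) OX_mult OR_mult by auto
    qed
    then have "?c \<in> ?A"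
      by (intro CollectI exI[of _ "card ?K"] exI[of _ "\<lambda>k. ?u (e k)"] exI[of _ "\<lambda>k. ?v (e k)"]) simp
    moreover have "?c (x, y) = a (x, y) * b (x, y)" if "x \<in> points X" for x y
    proof -
      have "?c (x, y) = (\<Sum>i\<in>?K. ?u i x * ?v i y)"
        using sum.reindex_bij_betw[OF e, of "\<lambda>i. ?u i x * ?v i y"] by simp
      also have "\<dots> = (\<Sum>(i, j)\<in>?K. (s i x * t i y) * (s' j x * t' j y))"
        using that by (intro sum.cong) (auto simp: mult_ac)
      also have "\<dots> = a (x, y) * b (x, y)"
        by (simp add: a(1) b(1) sum_product sum.cartesian_product)
      finally show ?thesis .
    qed
    ultimately show "\<exists>R\<in>?A. \<forall>x\<in>points X \<times> UNIV. R x = a x * b x" by (intro bexI[of _ ?c]) auto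
  qed
  ultimately show ?thesis
    unfolding variety_prod_def points_real_line by (rule points_fspace_of)
qed

section \<open>Charts of a uniformly retract rational variety\<close>

text \<open>The conditions of \<open>retraction_charts\<close> on a single chart, so that a chart
  can be chosen at each point before finitely many are selected.\<close>

definition retraction_chart ::
    "nat \<Rightarrow> (nat \<Rightarrow> real) set \<Rightarrow> (nat \<Rightarrow> (nat \<Rightarrow> real) \<Rightarrow> real) \<Rightarrow> ((nat \<Rightarrow> real) \<Rightarrow> real) \<Rightarrow> bool" where
  "retraction_chart m Z P Q \<longleftrightarrow> (\<forall>l<m. P l \<in> polys m) \<and> Q \<in> polys m \<and> (\<forall>u\<in>Z. \<forall>l<m. P l u = u l * Q u) \<and>
    (\<forall>u. Q u \<noteq> 0 \<longrightarrow> (\<lambda>l. if l < m then P l u / Q u else 0) \<in> Z)"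

text \<open>In coordinates \<open>i\<close> is given on \<open>V\<close> by quotients of
  polynomials, which define an extension \<open>I\<close> to an open subset of
  \<open>\<real>\<^sup>m\<close>; the retraction is \<open>I\<close> followed by \<open>r\<close>.
  Its domain \<open>D\<close> is cut down until \<open>I\<close> takes values in \<open>W\<close>
  and the points of \<open>Z\<close> in \<open>D\<close> come from \<open>V\<close>, where
  \<open>r (i x) = x\<close>. A common denominator then gives \<open>P\<close> and
  \<open>Q\<close>.\<close>

lemma retraction_chart_exists:
  assumes iso: "isomorphism Y (fspace_of Z (polys m)) h" and Z: "Z \<subseteq> topspace (Euclidean_space m)"
    and V: "openin (zariski Y) V" "y \<in> V" and rr: "globally_retract_rational (open_subspace Y V)"
  shows "\<exists>P Q. retraction_chart m Z P Q \<and> Q (h y) \<noteq> 0"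
proof -
  have VY: "V \<subseteq> points Y" by (rule openin_subset[OF V(1)])
  have pV: "points (open_subspace Y V) = V" using VY by (auto simp: open_subspace_def)
  have hZ: "h x \<in> Z" if "x \<in> points Y" for x using isomorphism_onto_polys(1)[OF iso] that by blast
  obtain n W i r where W: "openin (zariski (affine_space n)) W"
    and i: "regular_map (open_subspace Y V) (open_subspace (affine_space n) W) i"
    and r: "regular_map (open_subspace (affine_space n) W) (open_subspace Y V) r"
    and ri: "\<And>x. x \<in> V \<Longrightarrow> r (i x) = x"
    using rr unfolding globally_retract_rational_def pV by blast
  have WE: "W \<subseteq> topspace (Euclidean_space n)"
    using openin_subset[OF W] by (simp add: affine_space_def points_polys)
  have pW: "points (open_subspace (affine_space n) W) = W"
    using openin_subset[OF W] by (auto simp: open_subspace_def)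
  have iV: "i x \<in> W" if "x \<in> V" for x
    using i that unfolding regular_map_def continuous_map_def pV pW by blast
  have rW: "r w \<in> V" if "w \<in> W" for w
    using r that unfolding regular_map_def continuous_map_def pV pW by blast
  have "(\<lambda>x. i x k) \<in> regular_functions h m V" if k: "k < n" for k
  proof -
    let ?s = "restrict (\<lambda>w. w k) W"
    have "?s \<in> sections (open_subspace (affine_space n) W) W"
      using regular_functions_polys[OF polys.var[OF k], of "\<lambda>x. x" W]
      by (simp add: open_subspace_def sections_affine_space restrict_regular_functions)
    moreover have "openin (zariski (open_subspace (affine_space n) W)) W"
      using pW openin_topspace[of "zariski (open_subspace (affine_space n) W)"] by simp
    moreover have "preim (open_subspace Y V) i W = V" using iV pV by auto
    ultimately have "restrict (?s \<circ> i) V \<in> sections Y V"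
      using i unfolding regular_map_def by (metis (no_types, lifting) fspace.select_convs(2) open_subspace_def)
    then have "?s \<circ> i \<in> regular_functions h m V"
      unfolding sections_iso[OF iso V(1)] by (simp add: restrict_regular_functions)
    then show ?thesis
      by (rule function_algebra.cong[OF function_algebra_regular]) (simp add: iV)
  qed
  then have "\<forall>k<n. \<exists>a b. a \<in> polys m \<and> b \<in> polys m \<and> (\<forall>x\<in>V. b (h x) \<noteq> 0 \<and> i x k = a (h x) / b (h x))"
    unfolding regular_functions_def by blast
  then obtain a b where ab: "\<And>k. k < n \<Longrightarrow> a k \<in> polys m" "\<And>k. k < n \<Longrightarrow> b k \<in> polys m"
    "\<And>k x. k < n \<Longrightarrow> x \<in> V \<Longrightarrow> b k (h x) \<noteq> 0" "\<And>k x. k < n \<Longrightarrow> x \<in> V \<Longrightarrow> i x k = a k (h x) / b k (h x)"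
    by metis
  have "(\<lambda>w. h (r w) l) \<in> regular_functions (\<lambda>x. x) n W" if l: "l < m" for l
  proof -
    let ?s = "restrict (\<lambda>y. h y l) V"
    have "?s \<in> sections (open_subspace Y V) V"
      using coordinate_section[OF iso V(1) l] by (simp add: open_subspace_def)
    moreover have "openin (zariski (open_subspace Y V)) V"
      using pV openin_topspace[of "zariski (open_subspace Y V)"] by simp
    moreover have "preim (open_subspace (affine_space n) W) r V = W" using rW pW by auto
    ultimately have "restrict (?s \<circ> r) W \<in> sections (affine_space n) W"
      using r unfolding regular_map_def by (metis (no_types, lifting) fspace.select_convs(2) open_subspace_def)
    then have "?s \<circ> r \<in> regular_functions (\<lambda>x. x) n W"
      unfolding sections_affine_space by (simp add: restrict_regular_functions)
    then show ?thesis
      by (rule function_algebra.cong[OF function_algebra_regular]) (simp add: rW)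
  qed
  then have "\<forall>l<m. \<exists>c d. c \<in> polys n \<and> d \<in> polys n \<and> (\<forall>w\<in>W. d w \<noteq> 0 \<and> h (r w) l = c w / d w)"
    unfolding regular_functions_def by blast
  then obtain c d where cd: "\<And>l. l < m \<Longrightarrow> c l \<in> polys n" "\<And>l. l < m \<Longrightarrow> d l \<in> polys n"
    "\<And>l w. l < m \<Longrightarrow> w \<in> W \<Longrightarrow> d l w \<noteq> 0" "\<And>l w. l < m \<Longrightarrow> w \<in> W \<Longrightarrow> h (r w) l = c l w / d l w"
    by metis
  \<comment> \<open>The polynomials \<open>w0\<close> and \<open>v0\<close> certify membership in
    \<open>W\<close> and \<open>V\<close> by not vanishing, and they do not vanish at
    \<open>i y\<close> and \<open>h y\<close>.\<close>
  obtain w0 where w0: "w0 \<in> polys n" "w0 (i y) \<noteq> 0"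
    "\<And>w. w \<in> topspace (Euclidean_space n) - W \<Longrightarrow> w0 w = 0"
    using W iV[OF V(2)]
    unfolding affine_space_def openin_fspace_of_pointwise(2)[OF polys_one polys_mult] by blast
  obtain v0 where v0: "v0 \<in> polys m" "v0 (h y) \<noteq> 0" "\<And>x. x \<in> points Y - V \<Longrightarrow> v0 (h x) = 0"
    using V unfolding openin_iso[OF iso] by blast
  define I where "I u k = (if k < n then a k u / b k u else 0)" for u k
  define B where "B u = (\<Prod>k<n. b k u)" for u
  have B: "B \<in> polys m" unfolding B_def by (rule polys_prod) (auto simp: ab)
  have Ih: "I (h x) = i x" if "x \<in> V" for x
    using ab(4)[OF _ that] iV[OF that] WE by (force simp: I_def topspace_Euclidean_space)
  have I_reg: "(\<lambda>u. I u k) \<in> regular_functions (\<lambda>x. x) m D" if "k < n" "\<And>u. u \<in> D \<Longrightarrow> B u \<noteq> 0" for k D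
    using that ab(1,2)[OF that(1)]
    by (intro regular_functionsI[of "a k" _ "b k"]) (auto simp: I_def B_def)
  \<comment> \<open>Clearing denominators leaves a polynomial \<open>w1\<close> in \<open>u\<close>;
    where \<open>B u\<close> and \<open>w1 u\<close> are nonzero, \<open>I u\<close> is in
    \<open>W\<close>.\<close>
  have "(\<lambda>u. w0 (I u)) \<in> regular_functions (\<lambda>x. x) m {u. B u \<noteq> 0}"
    by (rule function_algebra.polys[OF function_algebra_regular w0(1) I_reg]) simp_all
  then obtain w1 w2 where w: "w1 \<in> polys m" "w2 \<in> polys m" "\<And>u. B u \<noteq> 0 \<Longrightarrow> w2 u \<noteq> 0"
    "\<And>u. B u \<noteq> 0 \<Longrightarrow> w0 (I u) = w1 u / w2 u"
    unfolding regular_functions_def by auto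
  define D where "D = {u. B u \<noteq> 0 \<and> w1 u \<noteq> 0 \<and> v0 u \<noteq> 0}"
  have IW: "I u \<in> W" if "u \<in> D" for u
  proof -
    have "w0 (I u) \<noteq> 0" using that w(3,4)[of u] by (simp add: D_def)
    then show ?thesis using w0(3)[of "I u"] by (auto simp: topspace_Euclidean_space I_def)
  qed
  have "(\<lambda>u. h (r (I u)) l) \<in> regular_functions (\<lambda>x. x) m D" if l: "l < m" for l
  proof -
    interpret function_algebra D "regular_functions (\<lambda>x. x) m D" by (rule function_algebra_regular)
    have "(\<lambda>u. c l (I u) / d l (I u)) \<in> regular_functions (\<lambda>x. x) m D"
      by (intro divide polys[OF cd(1)[OF l]] polys[OF cd(2)[OF l]] I_reg cd(3)[OF l] IW) (auto simp: D_def)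
    then show ?thesis by (rule cong) (simp add: cd(4)[OF l IW])
  qed
  then have "\<forall>l<m. \<exists>p q. p \<in> polys m \<and> q \<in> polys m \<and> (\<forall>u\<in>D. q u \<noteq> 0 \<and> h (r (I u)) l = p u / q u)"
    unfolding regular_functions_def by blast
  then obtain p q where pq: "\<And>l. l < m \<Longrightarrow> p l \<in> polys m" "\<And>l. l < m \<Longrightarrow> q l \<in> polys m"
    "\<And>l u. l < m \<Longrightarrow> u \<in> D \<Longrightarrow> q l u \<noteq> 0" "\<And>l u. l < m \<Longrightarrow> u \<in> D \<Longrightarrow> h (r (I u)) l = p l u / q l u"
    by metis
  \<comment> \<open>\<open>R\<close> vanishes exactly off \<open>D\<close>: the factor
    \<open>E\<close> encodes the conditions that define \<open>D\<close>, and the \<open>q l\<close>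
    have no zeros there. On \<open>D\<close>, \<open>S l / R\<close> is coordinate \<open>l\<close>
    of the retraction.\<close>
  define E where "E u = B u * (w1 u * v0 u)" for u
  define R where "R u = E u * (\<Prod>l<m. q l u)" for u
  define S where "S l u = p l u * (E u * (\<Prod>l\<in>{..<m} - {l}. q l u))" for l u
  have E: "E \<in> polys m" unfolding E_def by (intro polys.mult B w v0)
  have R: "R \<in> polys m" unfolding R_def by (intro polys.mult E polys_prod) (auto simp: pq)
  have S: "S l \<in> polys m" if "l < m" for l
    unfolding S_def by (intro polys.mult E polys_prod pq that) auto
  have R_D: "R u \<noteq> 0 \<longleftrightarrow> u \<in> D" for u
    using pq(3) by (auto simp: R_def E_def D_def)
  have SR: "S l u = h (r (I u)) l * R u" if "l < m" "u \<in> D" for l u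
  proof -
    have "(\<Prod>l<m. q l u) = q l u * (\<Prod>l\<in>{..<m} - {l}. q l u)"
      using that(1) by (intro prod.remove) auto
    then show ?thesis using pq(3,4)[OF that] by (simp add: S_def R_def)
  qed
  \<comment> \<open>The second factor \<open>R\<close> makes the numerators vanish where the retraction is undefined.\<close>
  show ?thesis
    unfolding retraction_chart_def
  proof (intro exI[of _ "\<lambda>l u. S l u * R u"] exI[of _ "\<lambda>u. R u * R u"] conjI allI ballI impI)
    fix u l assume u: "u \<in> Z" and l: "l < m"
    show "S l u * R u = u l * (R u * R u)"
    proof (cases "R u = 0")
      case False
      then have uD: "u \<in> D" by (simp add: R_D)
      obtain x where x: "x \<in> points Y" "u = h x" using u isomorphism_onto_polys(1)[OF iso] by blast
      have "x \<in> V" using v0(3)[of x] x uD by (auto simp: D_def)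
      then have "h (r (I u)) = u" using Ih ri x(2) by simp
      then show ?thesis using SR[OF l uD] by simp
    qed simp
  next
    fix u assume "R u * R u \<noteq> 0"
    then have uD: "u \<in> D" and nz: "R u \<noteq> 0" using R_D[of u] by auto
    have z: "h (r (I u)) \<in> Z" using hZ rW[OF IW[OF uD]] VY by blast
    have "(if l < m then S l u * R u / (R u * R u) else 0) = h (r (I u)) l" for l
    proof (cases "l < m")
      case False
      then show ?thesis using z Z by (auto simp: topspace_Euclidean_space)
    qed (use SR[OF _ uD] nz in simp)
    then show "(\<lambda>l. if l < m then S l u * R u / (R u * R u) else 0) \<in> Z" using z by simp
  next
    have hy: "B (h y) \<noteq> 0" using ab(3)[OF _ V(2)] by (simp add: B_def)
    moreover have "w1 (h y) \<noteq> 0" using w(4)[OF hy] w0(2) Ih[OF V(2)] by auto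
    ultimately have "h y \<in> D" using v0(2) by (simp add: D_def)
    then show "R (h y) * R (h y) \<noteq> 0" using R_D by simp
  qed (use R S in \<open>auto intro: polys.mult\<close>)
qed

section \<open>Transfer to abstract varieties\<close>

lemma Euclidean_space_eq_top_of_set: "Euclidean_space n = top_of_set (topspace (Euclidean_space n))"
  by (simp add: Euclidean_space_def euclidean_product_topology)

theorem corollary1p7:
  fixes X :: "'a fspace" and Y :: "'b fspace" and f g :: "'a \<Rightarrow> 'b"
  assumes "real_affine_variety Y"
    and "uniformly_retract_rational Y"
    and "real_affine_variety X"
    and "compact_space (euclidean_topology X)"
    and "regular_map X Y f"
    and "regular_map X Y g"
    and "homotopic_with (\<lambda>_. True) (euclidean_topology X) (euclidean_topology Y) f g"
  shows "\<exists>F. regular_map (variety_prod X real_line) Y F \<and>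
           (\<forall>x\<in>points X. F (x, 0) = f x \<and> F (x, 1) = g x)"
proof -
  obtain n X' hX where X': "closedin (zariski (affine_space n)) X'"
    and isoX: "isomorphism X (fspace_of X' (polys n)) hX"
    using assms(3) unfolding real_affine_variety_def by blast
  obtain m Y' hY where Y': "closedin (zariski (affine_space m)) Y'"
    and isoY: "isomorphism Y (fspace_of Y' (polys m)) hY"
    using assms(1) unfolding real_affine_variety_def by blast
  have XE: "X' \<subseteq> topspace (Euclidean_space n)" using X' unfolding closedin_affine_space by blast
  have YE: "Y' \<subseteq> topspace (Euclidean_space m)" using Y' unfolding closedin_affine_space by blast
  note hX = isomorphism_onto_polys(1,2)[OF isoX] and hY = isomorphism_onto_polys(1,2)[OF isoY]
  note topX = euclidean_topology_eq[OF XE isoX] and topY = euclidean_topology_eq[OF YE isoY]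
  define kX where "kX = inv_into (points X) hX"
  define kY where "kY = inv_into (points Y) hY"
  have kX: "kX z \<in> points X" "hX (kX z) = z" if "z \<in> X'" for z
    using that hX(1) by (auto simp: kX_def inv_into_into f_inv_into_f)
  have kXh: "kX (hX x) = x" if "x \<in> points X" for x
    using that hX(2) by (simp add: kX_def)
  have kY: "kY z \<in> points Y" "hY (kY z) = z" if "z \<in> Y'" for z
    using that hY(1) by (auto simp: kY_def inv_into_into f_inv_into_f)
  have kYh: "kY (hY x) = x" if "x \<in> points Y" for x
    using that hY(2) by (simp add: kY_def)
  have tX: "topspace (euclidean_topology X) = points X"
    unfolding topX topspace_pullback_topology using hX(1) XE by blast
  have tY: "topspace (euclidean_topology Y) = points Y"
    unfolding topY topspace_pullback_topology using hY(1) YE by blast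
  have contX: "continuous_map (euclidean_topology X) (Euclidean_space n) hX"
    unfolding topX using continuous_map_pullback[OF continuous_map_id] by (simp add: id_def o_def)
  have contY: "continuous_map (euclidean_topology Y) (Euclidean_space m) hY"
    unfolding topY using continuous_map_pullback[OF continuous_map_id] by (simp add: id_def o_def)
  have "compactin (Euclidean_space n) (hX ` points X)"
    using assms(4) contX tX by (metis compact_space_def image_compactin)
  then have compX: "compact X'"
    unfolding hX(1) by (subst (asm) Euclidean_space_eq_top_of_set) (simp add: compactin_subtopology)
  \<comment> \<open>The Euclidean topology is pulled back along \<open>hX\<close>, so continuity of
    \<open>kX\<close> reduces to that of \<open>hX \<circ> kX\<close>, the identity on
    \<open>X'\<close>.\<close>
  have contkX: "continuous_map (top_of_set X') (euclidean_topology X) kX"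
    unfolding topX
  proof (rule continuous_map_pullback')
    have "continuous_map (top_of_set X') (Euclidean_space n) (\<lambda>x. x)"
      by (subst Euclidean_space_eq_top_of_set) (use XE in \<open>auto simp: continuous_map_in_subtopology\<close>)
    then show "continuous_map (top_of_set X') (Euclidean_space n) (hX \<circ> kX)"
      by (rule continuous_map_eq) (simp add: kX)
  qed (use kX in auto)
  obtain H where H: "continuous_map (prod_topology (top_of_set {0..1::real}) (euclidean_topology X)) (euclidean_topology Y) H"
    and H0: "\<And>x. x \<in> points X \<Longrightarrow> H (0, x) = f x" and H1: "\<And>x. x \<in> points X \<Longrightarrow> H (1, x) = g x"
    using assms(7) unfolding homotopic_with_def by auto
  define K where "K p = hY (H (fst p, kX (snd p)))" for p
  have K: "continuous_on ({0..1} \<times> X') K"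
  proof -
    have "continuous_map (prod_topology (top_of_set {0..1}) (top_of_set X'))
        (prod_topology (top_of_set {0..1}) (euclidean_topology X)) (\<lambda>p. (fst p, kX (snd p)))"
      by (intro continuous_map_pairedI continuous_map_fst continuous_map_compose[OF continuous_map_snd contkX, unfolded o_def])
    from continuous_map_compose[OF continuous_map_compose[OF this H] contY]
    have "continuous_map (top_of_set ({0..1} \<times> X')) (Euclidean_space m) K"
      by (simp add: K_def[abs_def] o_def)
    then show ?thesis
      by (subst (asm) Euclidean_space_eq_top_of_set) (simp add: continuous_map_in_subtopology)
  qed
  have HY: "H (t, x) \<in> points Y" if "t \<in> {0..1}" "x \<in> points X" for t x
    using H that unfolding continuous_map_def by (auto simp: tX tY)
  have KY: "K ` ({0..1} \<times> X') \<subseteq> Y'" using HY kX hY(1) by (auto simp: K_def)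
  have "\<forall>z\<in>Y'. \<exists>c. retraction_chart m Y' (fst c) (snd c) \<and> snd c z \<noteq> 0"
  proof
    fix z assume "z \<in> Y'"
    then obtain y where y: "y \<in> points Y" "z = hY y" using hY(1) by blast
    obtain V where "openin (zariski Y) V" "y \<in> V" "globally_retract_rational (open_subspace Y V)"
      using assms(2) y(1) unfolding uniformly_retract_rational_def by blast
    from retraction_chart_exists[OF isoY YE this]
    show "\<exists>c. retraction_chart m Y' (fst c) (snd c) \<and> snd c z \<noteq> 0" unfolding y(2) by auto
  qed
  from bchoice[OF this] obtain c where
    c: "\<And>z. z \<in> Y' \<Longrightarrow> retraction_chart m Y' (fst (c z)) (snd (c z))" "\<And>z. z \<in> Y' \<Longrightarrow> snd (c z) z \<noteq> 0"
    by blast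
  define P where "P z = fst (c z)" for z
  define Q where "Q z = snd (c z)" for z
  have P: "P z l \<in> polys m" "u \<in> Y' \<Longrightarrow> P z l u = u l * Q z u" if "z \<in> Y'" "l < m" for z u l
    using c(1)[OF that(1)] that(2) by (simp_all add: retraction_chart_def P_def Q_def)
  have Q: "Q z \<in> polys m" "Q z z \<noteq> 0"
    and ret: "Q z u \<noteq> 0 \<Longrightarrow> (\<lambda>l. if l < m then P z l u / Q z u else 0) \<in> Y'" if "z \<in> Y'" for z u
    using c[OF that] unfolding retraction_chart_def P_def Q_def by blast+
  \<comment> \<open>\<open>Y\<close> need not be compact, but the track of the homotopy is, and
    finitely many charts have to cover only the track.\<close>
  have "compact (K ` ({0..1} \<times> X'))"
    by (intro compact_continuous_image[OF K] compact_Times compX) simp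
  moreover have "open {u. Q z u \<noteq> 0}" if "z \<in> Y'" for z
    by (rule open_Collect_neq[OF continuous_on_polys[OF Q(1)[OF that]] continuous_on_const])
  moreover have "K ` ({0..1} \<times> X') \<subseteq> (\<Union>z\<in>Y'. {u. Q z u \<noteq> 0})"
    using KY Q(2) by blast
  ultimately obtain C where C: "C \<subseteq> Y'" "finite C" "K ` ({0..1} \<times> X') \<subseteq> (\<Union>z\<in>C. {u. Q z u \<noteq> 0})"
    by (rule compactE_image)
  obtain e where e: "bij_betw e {..<card C} C"
    using ex_bij_betw_nat_finite[OF C(2)] by (auto simp: atLeast0LessThan)
  have eY: "e j \<in> Y'" if "j < card C" for j using bij_betwE[OF e] that C(1) by auto
  interpret retraction_charts m "card C" Y' "\<lambda>j. P (e j)" "\<lambda>j. Q (e j)"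
  proof
    show "y l = 0" if "y \<in> Y'" "m \<le> l" for y l
      using that YE by (auto simp: topspace_Euclidean_space)
  qed (use P Q ret eY in auto)
  have fpts: "f x \<in> points Y" "g x \<in> points Y" if "x \<in> points X" for x
    using assms(5,6) that unfolding regular_map_def continuous_map_def by blast+
  have pull: "(\<lambda>z. hY (\<phi> (kX z)) l) \<in> regular_functions (\<lambda>x. x) n X'" if \<phi>: "regular_map X Y \<phi>" "l < m" for \<phi> l
  proof -
    obtain R S where RS: "R \<in> polys n" "S \<in> polys n" "\<And>x. x \<in> points X \<Longrightarrow> S (hX x) \<noteq> 0"
      "\<And>x. x \<in> points X \<Longrightarrow> hY (\<phi> x) l = R (hX x) / S (hX x)"
      by (rule regular_functionsE[OF regular_map_coordinates[OF isoX isoY \<phi>]]) blast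
    show ?thesis
      by (rule regular_functionsI[OF RS(1,2)]) (use RS(3,4) kX in \<open>metis\<close>)+
  qed
  have "\<exists>G. regular_family n X' G \<and> (\<forall>z\<in>X'. G (z, 0) = hY (f (kX z)) \<and> G (z, 1) = hY (g (kX z)))"
  proof (rule regular_homotopy[OF compX _ pull[OF assms(5)] pull[OF assms(6)] K KY])
    show "x i = 0" if "x \<in> X'" "n \<le> i" for x i using that XE by (auto simp: topspace_Euclidean_space)
    show "K (0, z) = hY (f (kX z))" "K (1, z) = hY (g (kX z))" if "z \<in> X'" for z
      using H0 H1 kX(1)[OF that] by (simp_all add: K_def)
    show "\<exists>j<card C. Q (e j) z \<noteq> 0" if z: "z \<in> K ` ({0..1} \<times> X')" for z
    proof -
      have "z \<in> (\<Union>z\<in>C. {u. Q z u \<noteq> 0})" by (rule subsetD[OF C(3) z])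
      then obtain c where "c \<in> C" "Q c z \<noteq> 0" by blast
      moreover have "C = e ` {..<card C}" using e by (simp add: bij_betw_def)
      ultimately show ?thesis by (metis imageE lessThan_iff)
    qed
  qed
  then obtain G where G: "regular_family n X' G" "\<And>z. z \<in> X' \<Longrightarrow> G (z, 0) = hY (f (kX z))"
    "\<And>z. z \<in> X' \<Longrightarrow> G (z, 1) = hY (g (kX z))" by blast
  define F where "F p = kY (G (hX (fst p), snd p))" for p
  note isoXR = isomorphism_prod_real_line[OF XE isoX] and pXR = points_variety_prod_real_line[OF isoX]
  have hX': "hX x \<in> X'" if "x \<in> points X" for x using hX(1) that by blast
  have GY: "G (hX x, t) \<in> Y'" if "x \<in> points X" for x t
    using G(1) hX'[OF that] unfolding regular_family_def by blast
  have "regular_map (variety_prod X real_line) Y F"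
  proof (rule regular_mapI[OF isoXR isoY])
    show "F p \<in> points Y" if "p \<in> points (variety_prod X real_line)" for p
      using that kY GY unfolding pXR by (auto simp: F_def)
    show "(\<lambda>p. hY (F p) l) \<in> regular_functions (\<lambda>(x, t). (hX x)(n := t)) (Suc n) (points (variety_prod X real_line))"
      if l: "l < m" for l
    proof -
      have "(\<lambda>p. G p l) \<in> regular_functions (snoc n) (Suc n) (X' \<times> UNIV)"
        using G(1) l by (simp add: regular_family_def)
      then obtain R S where RS: "R \<in> polys (Suc n)" "S \<in> polys (Suc n)"
        "\<And>p. p \<in> X' \<times> UNIV \<Longrightarrow> S (snoc n p) \<noteq> 0"
        "\<And>p. p \<in> X' \<times> UNIV \<Longrightarrow> G p l = R (snoc n p) / S (snoc n p)"
        by (rule regular_functionsE) blast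
      show ?thesis
      proof (rule regular_functionsI[OF RS(1,2)])
        fix p assume "p \<in> points (variety_prod X real_line)"
        then obtain x t where p: "p = (x, t)" "x \<in> points X" unfolding pXR by blast
        have xt: "(hX x, t) \<in> X' \<times> UNIV" using hX'[OF p(2)] by simp
        show "S (case p of (x, t) \<Rightarrow> (hX x)(n := t)) \<noteq> 0"
          using RS(3)[OF xt] by (simp add: p snoc_def)
        show "hY (F p) l = R (case p of (x, t) \<Rightarrow> (hX x)(n := t)) / S (case p of (x, t) \<Rightarrow> (hX x)(n := t))"
          using RS(4)[OF xt] kY(2)[OF GY[OF p(2)]] by (simp add: p snoc_def F_def)
      qed
    qed
  qed
  moreover have "F (x, 0) = f x \<and> F (x, 1) = g x" if "x \<in> points X" for x
    using G(2,3)[OF hX'[OF that]] kXh[OF that] kYh fpts[OF that] by (simp add: F_def)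
  ultimately show ?thesis by blast
qed

end
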